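(* Let $0<\alpha_0<\alpha_1=\alpha_2<\alpha_3$ and consider the geodesic flow on the three-dimensional ellipsoid $\{x\in\mathbb{R}^4:\sum_{i=0}^3 x_i^2/\alpha_i=1\}$ with energy momentum map $\mathcal{EM}=(H,J,G):M\to\mathbb{R}^3$ (see context). Fix an energy $h>0$. The image of $\{H=h\}$ under $(J,G)$ is the compact region of the $(j,g)$-plane bounded by the curves $$g=\frac{2\alpha_1}{\alpha_1-\alpha_3}h-\frac{\alpha_3}{\alpha_1(\alpha_1-\alpha_3)}j^2,\qquad g=\frac{2\alpha_1}{\alpha_1-\alpha_0}h-\frac{\alpha_0}{\alpha_1(\alpha_1-\alpha_0)}j^2,$$ and the singular values at energy $h$ are the points of these boundary curves together with the isolated point $(j,g)=(0,0)$. Then: (i) the fibre $\mathcal{EM}^{-1}(h,j,g)$ over each point $(j,g)$ of the boundary curves, with the exception of their intersections, is a two-torus $T^2$; (ii) the fibre over each intersection point of the two boundary curves is a circle $S^1$; (iii) the fibre $\mathcal{EM}^{-1}(h,0,0)$ over the isolated singularity at the origin is the direct product of $S^1$ and a doubly pinched torus $T^2$.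
   Context: Coordinates on $\mathbb{R}^8$ are $(x,y)=(x_0,\dots,x_3,y_0,\dots,y_3)$. The phase space is $M=\{(x,y)\in\mathbb{R}^8:\ \sum_{i=0}^3 x_i^2/\alpha_i=1,\ \sum_{i=0}^3 x_iy_i/\alpha_i=0\}$, the tangent bundle of the ellipsoid. The integrals are $H=\frac12(y_0^2+y_1^2+y_2^2+y_3^2)$, $J=x_1y_2-x_2y_1$ and $$G = y_1^2 + y_2^2 + \frac{(x_0y_1 - x_1y_0)^2+(x_0y_2 - x_2y_0)^2}{\alpha_1 - \alpha_0} + \frac{(x_1y_3 - x_3y_1)^2+(x_2y_3 - x_3y_2)^2}{\alpha_1 - \alpha_3}.$$ A singular value is the image under $\mathcal{EM}=(H,J,G)$ of a point of $M$ where $dH,dJ,dG$ restricted to $M$ are linearly dependent. A doubly pinched torus is the space obtained from $T^2=S^1\times S^1$ by collapsing two distinct circles $\{p\}\times S^1$ and $\{q\}\times S^1$ each to a point (equivalently, two 2-spheres glued to each other at two points). Fibres are described up to homeomorphism. *)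

theory Defs
  imports "HOL-Analysis.Analysis"
begin

(* The index type 4 is the integers modulo 4, so its elements are exactly 0, 1, 2, 3 and
   the components of a vector are x$0, x$1, x$2, x$3 as in the source. *)

type_synonym phase = "(real ^ 4) \<times> (real ^ 4)"

definition phase_space :: "real ^ 4 \<Rightarrow> phase set" where
  "phase_space \<alpha> = {(x, y). (\<Sum>i\<in>UNIV. (x $ i)\<^sup>2 / \<alpha> $ i) = 1 \<and>
                            (\<Sum>i\<in>UNIV. x $ i * y $ i / \<alpha> $ i) = 0}"

definition H_int :: "phase \<Rightarrow> real" where
  "H_int = (\<lambda>(x, y). 1 / 2 * ((y$0)\<^sup>2 + (y$1)\<^sup>2 + (y$2)\<^sup>2 + (y$3)\<^sup>2))"

definition J_int :: "phase \<Rightarrow> real" where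
  "J_int = (\<lambda>(x, y). x$1 * y$2 - x$2 * y$1)"

definition G_int :: "real ^ 4 \<Rightarrow> phase \<Rightarrow> real" where
  "G_int \<alpha> = (\<lambda>(x, y). (y$1)\<^sup>2 + (y$2)\<^sup>2
     + ((x$0 * y$1 - x$1 * y$0)\<^sup>2 + (x$0 * y$2 - x$2 * y$0)\<^sup>2) / (\<alpha>$1 - \<alpha>$0)
     + ((x$1 * y$3 - x$3 * y$1)\<^sup>2 + (x$2 * y$3 - x$3 * y$2)\<^sup>2) / (\<alpha>$1 - \<alpha>$3))"

definition EM :: "real ^ 4 \<Rightarrow> phase \<Rightarrow> real \<times> real \<times> real" where
  "EM \<alpha> p = (H_int p, J_int p, G_int \<alpha> p)"

definition fibre :: "real ^ 4 \<Rightarrow> real \<times> real \<times> real \<Rightarrow> phase set" where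
  "fibre \<alpha> c = {p \<in> phase_space \<alpha>. EM \<alpha> p = c}"

(* Velocity vectors at p of curves in S. For an embedded submanifold S, such as
   phase_space \<alpha>, this is the usual tangent space at p. *)
definition tangent_space :: "'a::real_normed_vector set \<Rightarrow> 'a \<Rightarrow> 'a set" where
  "tangent_space S p =
     {v. \<exists>\<gamma>. (\<forall>t. \<gamma> t \<in> S) \<and> \<gamma> 0 = p \<and> (\<gamma> has_vector_derivative v) (at (0::real))}"

definition singular_point :: "real ^ 4 \<Rightarrow> phase \<Rightarrow> bool" where
  "singular_point \<alpha> p \<longleftrightarrow> p \<in> phase_space \<alpha> \<and>
     (\<exists>a b c :: real. (a, b, c) \<noteq> (0, 0, 0) \<and>
        (\<forall>v \<in> tangent_space (phase_space \<alpha>) p.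
           a * frechet_derivative H_int (at p) v
           + b * frechet_derivative J_int (at p) v
           + c * frechet_derivative (G_int \<alpha>) (at p) v = 0))"

definition singular_values :: "real ^ 4 \<Rightarrow> (real \<times> real \<times> real) set" where
  "singular_values \<alpha> = EM \<alpha> ` {p. singular_point \<alpha> p}"

(* Used for k = 3 and k = 0. When \<alpha>$0 < \<alpha>$1 < \<alpha>$3 the parabola for k = 3 opens upwards and
   that for k = 0 opens downwards. *)
definition curve_fun :: "real ^ 4 \<Rightarrow> real \<Rightarrow> 4 \<Rightarrow> real \<Rightarrow> real" where
  "curve_fun \<alpha> h k j =
     2 * \<alpha>$1 / (\<alpha>$1 - \<alpha>$k) * h - \<alpha>$k / (\<alpha>$1 * (\<alpha>$1 - \<alpha>$k)) * j\<^sup>2"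

definition curve :: "real ^ 4 \<Rightarrow> real \<Rightarrow> 4 \<Rightarrow> (real \<times> real) set" where
  "curve \<alpha> h k = {(j, g). g = curve_fun \<alpha> h k j}"

definition region :: "real ^ 4 \<Rightarrow> real \<Rightarrow> (real \<times> real) set" where
  "region \<alpha> h = {(j, g). curve_fun \<alpha> h 3 j \<le> g \<and> g \<le> curve_fun \<alpha> h 0 j}"

(* Only the arcs of the two parabolas between their intersection points bound the region. *)
definition boundary_curves :: "real ^ 4 \<Rightarrow> real \<Rightarrow> (real \<times> real) set" where
  "boundary_curves \<alpha> h = (curve \<alpha> h 3 \<union> curve \<alpha> h 0) \<inter> region \<alpha> h"

abbreviation circle :: "complex set" where
  "circle \<equiv> sphere 0 1"

abbreviation torus :: "(complex \<times> complex) set" where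
  "torus \<equiv> circle \<times> circle"

(* X is, up to homeomorphism, the quotient of the torus that collapses each of two distinct
   circles {p} \<times> circle and {q} \<times> circle to a point: the quotient map f makes no other
   identifications. *)
definition doubly_pinched_torus :: "'a topology \<Rightarrow> bool" where
  "doubly_pinched_torus X \<longleftrightarrow>
     (\<exists>p \<in> circle. \<exists>q \<in> circle. p \<noteq> q \<and>
        (\<exists>f. quotient_map (top_of_set torus) X f \<and>
             (\<forall>u \<in> torus. \<forall>v \<in> torus.
                f u = f v \<longleftrightarrow> u = v \<or> (fst u = p \<and> fst v = p) \<or> (fst u = q \<and> fst v = q))))"

end

theory Submission
  imports Defs
begin

text \<open>With \<open>a = \<alpha>\<^sub>0\<close>, \<open>b = \<alpha>\<^sub>1 = \<alpha>\<^sub>2\<close>, \<open>c = \<alpha>\<^sub>3\<close>: on the phase space \<open>H\<close>, \<open>J\<^sup>2\<close>, \<open>G\<close> are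
  equivalent to \<open>F\<^sub>0\<close>, \<open>J\<^sup>2\<close>, \<open>F\<^sub>3\<close>, where \<open>F\<^sub>0 \<le> 0 \<le> F\<^sub>3\<close> are the remaining partial fraction
  coefficients of the discriminant that decides tangency of a line to the confocal quadrics. The two
  boundary curves are \<open>F\<^sub>0 = 0\<close> and \<open>F\<^sub>3 = 0\<close>, and these equations confine the geodesic to one of the two
  ellipsoids of revolution \<open>x\<^sub>0 = 0\<close> and \<open>x\<^sub>3 = 0\<close>, where a level set is a torus, or a circle for the equator.

  Away from these curves and from \<open>J = G = 0\<close> a geodesic is tangent to confocal quadrics with simple
  parameters; moving the line along the normals in the points of tangency varies the parameters one at a
  time, so the integrals are independent.

  For \<open>J = G = 0\<close> the geodesic lies in an ellipsoid with three axes that contains the plane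
  \<open>x\<^sub>1 = x\<^sub>2 = 0\<close>, and its tangents meet the focal hyperbola of that plane. After scaling the ellipsoid to a
  sphere, the tangent is described by the great circle through position and velocity: the point \<open>e\<close> in
  which it meets the plane, the phase \<open>\<delta>\<close> measured from \<open>e\<close>, and the direction in \<open>e\<close>, which ranges
  over a 2-sphere. The focal condition determines \<open>e\<close> from \<open>\<delta>\<close> up to a reflection, so the fibre consists
  of two copies of circle times 2-sphere, glued along the circles over the poles. The gluing is
  untwisted by interpolating a rotation of the phase along the meridians.\<close>

text \<open>The two equal axes give the discriminant a double pole at b with coefficient -J^2, so
  test vectors see J^2 rather than J. For J = 0 one of the two touched parameters has moved into
  this pole and only one test vector remains; dJ is then treated directly, and it vanishes on the
  tangent space only if x_1 = x_2 = y_1 = y_2 = 0, where G = 0. Over the origin the focal condition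
  reads k^2 + A cos(m)^2 = C sin(m)^2, where k is the cosine of the phase, A = a / (b - a) > 0 and C
  = c / (c - b) > 1. These inequalities keep m strictly between 0 and pi / 2 and make it a strict
  contraction of the phase. Over the poles the great circle lies in the plane itself, so its
  crossing point is undetermined, and the gluing shifts the phase by m in opposite senses on the two
  copies. The contraction makes every interpolated shift a bijection of the circle. Homeomorphisms
  come from continuous injections of compact sets; quotients are compared as two images of one
  compact parameter set under maps that identify the same points.\<close>

lemma sum_UNIV_4: "sum f (UNIV :: 4 set) = (f 0 :: real) + f 1 + f 2 + f 3"
proof -
  \<comment> \<open>\<open>sum_4\<close> numbers the indices from 1 to 4, and 4 is 0 in this
    type.\<close>
  have 4: "(4 :: 4) = 0" by simp
  show ?thesis using sum_4[of f] unfolding 4 by linarith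
qed

text \<open>Polar form of the confocal quadric. The value \<kappa> = 0 belongs to the ellipsoid
  itself, and its equations cut out \<open>phase_space\<close>.\<close>

definition confocal_form :: "real ^ 4 \<Rightarrow> real \<Rightarrow> real ^ 4 \<Rightarrow> real ^ 4 \<Rightarrow> real" where
  "confocal_form \<alpha> \<kappa> x y = (\<Sum>i\<in>UNIV. x $ i * y $ i / (\<alpha> $ i - \<kappa>))"

text \<open>Up to a factor, the discriminant of the quadratic equation for the points in which the line
  \<open>x + t y\<close> meets the confocal quadric with parameter \<open>\<kappa>\<close>.\<close>

definition tangency :: "real ^ 4 \<Rightarrow> real \<Rightarrow> phase \<Rightarrow> real" where
  "tangency \<alpha> \<kappa> = (\<lambda>(x, y). confocal_form \<alpha> \<kappa> y y * (1 - confocal_form \<alpha> \<kappa> x x)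
     + (confocal_form \<alpha> \<kappa> x y)\<^sup>2)"

text \<open>\<open>F0_int\<close> and \<open>F3_int\<close> are the Uhlenbeck integrals of the axes
  0 and 3. \<open>G_int\<close> is the sum of those of the axes 1 and 2, in which the terms with
  denominator \<alpha>_1 - \<alpha>_2 cancel.\<close>

definition F0_int :: "real ^ 4 \<Rightarrow> phase \<Rightarrow> real" where
  "F0_int \<alpha> = (\<lambda>(x, y). (y$0)\<^sup>2
     - ((x$0 * y$1 - x$1 * y$0)\<^sup>2 + (x$0 * y$2 - x$2 * y$0)\<^sup>2) / (\<alpha>$1 - \<alpha>$0)
     - (x$0 * y$3 - x$3 * y$0)\<^sup>2 / (\<alpha>$3 - \<alpha>$0))"

definition F3_int :: "real ^ 4 \<Rightarrow> phase \<Rightarrow> real" where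
  "F3_int \<alpha> = (\<lambda>(x, y). (y$3)\<^sup>2
     + ((x$1 * y$3 - x$3 * y$1)\<^sup>2 + (x$2 * y$3 - x$3 * y$2)\<^sup>2) / (\<alpha>$3 - \<alpha>$1)
     + (x$0 * y$3 - x$3 * y$0)\<^sup>2 / (\<alpha>$3 - \<alpha>$0))"

lemma phase_space_iff_confocal_form:
  "(x, y) \<in> phase_space \<alpha> \<longleftrightarrow> confocal_form \<alpha> 0 x x = 1 \<and> confocal_form \<alpha> 0 x y = 0"
  by (simp add: phase_space_def confocal_form_def power2_eq_square)

text \<open>With the weights 1 / (\<alpha>_i - \<kappa>) this turns the discriminant into the 2 x 2
  minors of which the integrals are made.\<close>

lemma lagrange_identity_4:
  fixes A B C D x0 x1 x2 x3 y0 y1 y2 y3 :: real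
  shows "(A * y0\<^sup>2 + B * y1\<^sup>2 + C * y2\<^sup>2 + D * y3\<^sup>2) * (A * x0\<^sup>2 + B * x1\<^sup>2 + C * x2\<^sup>2 + D * x3\<^sup>2)
      - (A * x0 * y0 + B * x1 * y1 + C * x2 * y2 + D * x3 * y3)\<^sup>2
    = A * B * (x0 * y1 - x1 * y0)\<^sup>2 + A * C * (x0 * y2 - x2 * y0)\<^sup>2 + A * D * (x0 * y3 - x3 * y0)\<^sup>2
      + B * C * (x1 * y2 - x2 * y1)\<^sup>2 + B * D * (x1 * y3 - x3 * y1)\<^sup>2 + C * D * (x2 * y3 - x3 * y2)\<^sup>2"
  by algebra

lemma divided_difference_inverse:
  fixes p q :: real
  assumes "p \<noteq> 0" "q \<noteq> 0" "q \<noteq> p"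
  shows "(1 / q - 1 / p) / (q - p) = - (1 / p * (1 / q))"
proof -
  define r where "r = 1 / p * (1 / q)"
  have "1 / q - 1 / p = - (q - p) * r" using assms by (simp add: r_def field_simps)
  then show ?thesis using assms unfolding r_def[symmetric] by (simp add: divide_eq_eq algebra_simps)
qed

lemma weighted_Cauchy_Schwarz_3:
  fixes x1 x2 x3 r1 r2 r3 m n :: real
  assumes "m > 0" "n > 0"
  shows "(x1 * r1 + x2 * r2 + x3 * r3)\<^sup>2
    \<le> (m * (x1\<^sup>2 + x2\<^sup>2) + n * x3\<^sup>2) * ((r1\<^sup>2 + r2\<^sup>2) / m + r3\<^sup>2 / n)"
proof -
  have "(m * (x1\<^sup>2 + x2\<^sup>2) + n * x3\<^sup>2) * ((r1\<^sup>2 + r2\<^sup>2) / m + r3\<^sup>2 / n) - (x1 * r1 + x2 * r2 + x3 * r3)\<^sup>2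
    = (x1 * r2 - x2 * r1)\<^sup>2 + ((n * x3 * r1 - m * x1 * r3)\<^sup>2 + (n * x3 * r2 - m * x2 * r3)\<^sup>2) / (m * n)"
    using assms by (simp add: field_simps power2_eq_square)
  moreover have "\<dots> \<ge> 0"
    using assms by simp
  ultimately show ?thesis by linarith
qed

subsection \<open>Differentiation along curves in phase space\<close>

lemma curve_component_derivatives:
  fixes \<gamma> :: "real \<Rightarrow> phase"
  assumes "(\<gamma> has_vector_derivative (x', y')) (at 0)"
  shows "((\<lambda>t. fst (\<gamma> t) $ i) has_real_derivative x' $ i) (at 0)"
    and "((\<lambda>t. snd (\<gamma> t) $ i) has_real_derivative y' $ i) (at 0)"
proof -
  have "bounded_linear (\<lambda>z::phase. fst z $ i)" "bounded_linear (\<lambda>z::phase. snd z $ i)"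
    using bounded_linear_compose[OF bounded_linear_vec_nth bounded_linear_fst]
      bounded_linear_compose[OF bounded_linear_vec_nth bounded_linear_snd] by blast+
  from this[THEN bounded_linear.has_vector_derivative, OF assms]
  show "((\<lambda>t. fst (\<gamma> t) $ i) has_real_derivative x' $ i) (at 0)"
    and "((\<lambda>t. snd (\<gamma> t) $ i) has_real_derivative y' $ i) (at 0)"
    by (simp_all add: has_real_derivative_iff_has_vector_derivative)
qed

lemma DERIV_along_curve:
  fixes f :: "'a::real_normed_vector \<Rightarrow> real"
  assumes "(\<gamma> has_vector_derivative v) (at 0)" "\<gamma> 0 = p" "f differentiable (at p)"
  shows "((\<lambda>t. f (\<gamma> t)) has_real_derivative frechet_derivative f (at p) v) (at 0)"
proof -
  have f: "(f has_derivative frechet_derivative f (at p)) (at (\<gamma> 0))"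
    using assms by (simp add: frechet_derivative_works)
  have "((f \<circ> \<gamma>) has_derivative frechet_derivative f (at p) \<circ> (\<lambda>t. t *\<^sub>R v)) (at 0)"
    using diff_chain_at[where f = \<gamma> and x = 0, OF _ f] assms(1) unfolding has_vector_derivative_def by blast
  moreover have "frechet_derivative f (at p) (t *\<^sub>R v) = frechet_derivative f (at p) v * t" for t
    using has_derivative_bounded_linear[OF f]
    by (simp add: linear_scale bounded_linear.linear)
  ultimately show ?thesis
    by (simp add: has_field_derivative_def o_def)
qed

lemma differentiable_components [derivative_intros]:
  "(\<lambda>z::phase. fst z $ i) differentiable F" "(\<lambda>z::phase. snd z $ i) differentiable F"
  by (intro bounded_linear_imp_differentiable
    bounded_linear_compose[OF bounded_linear_vec_nth bounded_linear_fst]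
    bounded_linear_compose[OF bounded_linear_vec_nth bounded_linear_snd])+

lemma differentiable_integrals:
  "H_int differentiable (at z)" "J_int differentiable (at z)" "G_int \<alpha> differentiable (at z)"
proof -
  have const: "(\<lambda>w. f w / k) differentiable (at z)" if "f differentiable (at z)" for f :: "phase \<Rightarrow> real" and k
    using differentiable_mult[OF that differentiable_const, of "1 / k"] by simp
  have H: "H_int = (\<lambda>z. 1 / 2 * ((snd z$0)\<^sup>2 + (snd z$1)\<^sup>2 + (snd z$2)\<^sup>2 + (snd z$3)\<^sup>2))"
    by (auto simp: H_int_def fun_eq_iff)
  show "H_int differentiable (at z)"
    unfolding H by (intro differentiable_add differentiable_mult differentiable_power differentiable_components
      differentiable_const)
  have J: "J_int = (\<lambda>z. fst z$1 * snd z$2 - fst z$2 * snd z$1)"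
    by (auto simp: J_int_def fun_eq_iff)
  show "J_int differentiable (at z)"
    unfolding J by (intro differentiable_diff differentiable_mult differentiable_components)
  have G: "G_int \<alpha> = (\<lambda>z. (snd z$1)\<^sup>2 + (snd z$2)\<^sup>2
     + ((fst z$0 * snd z$1 - fst z$1 * snd z$0)\<^sup>2 + (fst z$0 * snd z$2 - fst z$2 * snd z$0)\<^sup>2) / (\<alpha>$1 - \<alpha>$0)
     + ((fst z$1 * snd z$3 - fst z$3 * snd z$1)\<^sup>2 + (fst z$2 * snd z$3 - fst z$3 * snd z$2)\<^sup>2) / (\<alpha>$1 - \<alpha>$3))"
    by (auto simp: G_int_def fun_eq_iff)
  show "G_int \<alpha> differentiable (at z)"
    unfolding G by (intro differentiable_add differentiable_diff differentiable_mult differentiable_power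
        differentiable_components const)
qed

lemma confocal_form_simps:
  "confocal_form \<alpha> \<kappa> (x + x') y = confocal_form \<alpha> \<kappa> x y + confocal_form \<alpha> \<kappa> x' y"
  "confocal_form \<alpha> \<kappa> x (y + y') = confocal_form \<alpha> \<kappa> x y + confocal_form \<alpha> \<kappa> x y'"
  "confocal_form \<alpha> \<kappa> (x - x') y = confocal_form \<alpha> \<kappa> x y - confocal_form \<alpha> \<kappa> x' y"
  "confocal_form \<alpha> \<kappa> x (y - y') = confocal_form \<alpha> \<kappa> x y - confocal_form \<alpha> \<kappa> x y'"
  "confocal_form \<alpha> \<kappa> (s *\<^sub>R x) y = s * confocal_form \<alpha> \<kappa> x y"
  "confocal_form \<alpha> \<kappa> x (s *\<^sub>R y) = s * confocal_form \<alpha> \<kappa> x y"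
  "confocal_form \<alpha> \<kappa> 0 y = 0" "confocal_form \<alpha> \<kappa> x 0 = 0"
  by (simp_all add: confocal_form_def sum.distrib sum_subtractf sum_distrib_left algebra_simps
      add_divide_distrib diff_divide_distrib)

lemma confocal_form_commute: "confocal_form \<alpha> \<kappa> x y = confocal_form \<alpha> \<kappa> y x"
  by (simp add: confocal_form_def mult.commute)

definition tangency_deriv :: "real ^ 4 \<Rightarrow> real \<Rightarrow> phase \<Rightarrow> phase \<Rightarrow> real" where
  "tangency_deriv \<alpha> \<kappa> = (\<lambda>(x, y) (x', y').
     2 * (confocal_form \<alpha> \<kappa> y y' * (1 - confocal_form \<alpha> \<kappa> x x) - confocal_form \<alpha> \<kappa> y y * confocal_form \<alpha> \<kappa> x x'
       + confocal_form \<alpha> \<kappa> x y * (confocal_form \<alpha> \<kappa> x' y + confocal_form \<alpha> \<kappa> x y')))"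

lemma DERIV_confocal_form:
  fixes f g :: "real \<Rightarrow> real ^ 4"
  assumes "\<And>i. ((\<lambda>t. f t $ i) has_real_derivative f' $ i) (at t)"
    and "\<And>i. ((\<lambda>t. g t $ i) has_real_derivative g' $ i) (at t)"
  shows "((\<lambda>t. confocal_form \<alpha> \<kappa> (f t) (g t)) has_real_derivative
    confocal_form \<alpha> \<kappa> f' (g t) + confocal_form \<alpha> \<kappa> (f t) g') (at t)"
proof -
  have "((\<lambda>t. \<Sum>i\<in>UNIV. f t $ i * g t $ i / (\<alpha> $ i - \<kappa>)) has_real_derivative
     (\<Sum>i\<in>UNIV. (f' $ i * g t $ i + g' $ i * f t $ i) / (\<alpha> $ i - \<kappa>))) (at t)"
    by (intro DERIV_sum DERIV_cdivide DERIV_mult assms)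
  then show ?thesis
    unfolding confocal_form_def sum.distrib[symmetric] by (simp add: add_divide_distrib mult.commute)
qed

lemma DERIV_tangency:
  assumes \<gamma>: "(\<gamma> has_vector_derivative (x', y')) (at 0)" "\<gamma> 0 = (x, y)"
  shows "((\<lambda>t. tangency \<alpha> \<kappa> (\<gamma> t)) has_real_derivative tangency_deriv \<alpha> \<kappa> (x, y) (x', y')) (at 0)"
proof -
  note D = curve_component_derivatives[OF \<gamma>(1)]
  have eq: "tangency \<alpha> \<kappa> (\<gamma> t) = confocal_form \<alpha> \<kappa> (snd (\<gamma> t)) (snd (\<gamma> t)) * (1 - confocal_form \<alpha> \<kappa> (fst (\<gamma> t)) (fst (\<gamma> t)))
     + (confocal_form \<alpha> \<kappa> (fst (\<gamma> t)) (snd (\<gamma> t)))\<^sup>2" for t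
    by (simp add: tangency_def split_beta)
  have xx: "((\<lambda>t. confocal_form \<alpha> \<kappa> (fst (\<gamma> t)) (fst (\<gamma> t))) has_real_derivative
       2 * confocal_form \<alpha> \<kappa> x x') (at 0)"
    and yy: "((\<lambda>t. confocal_form \<alpha> \<kappa> (snd (\<gamma> t)) (snd (\<gamma> t))) has_real_derivative
       2 * confocal_form \<alpha> \<kappa> y y') (at 0)"
    and xy: "((\<lambda>t. confocal_form \<alpha> \<kappa> (fst (\<gamma> t)) (snd (\<gamma> t))) has_real_derivative
       confocal_form \<alpha> \<kappa> x' y + confocal_form \<alpha> \<kappa> x y') (at 0)"
    using DERIV_confocal_form[OF D(1) D(1), of \<alpha> \<kappa>] DERIV_confocal_form[OF D(2) D(2), of \<alpha> \<kappa>]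
      DERIV_confocal_form[OF D(1) D(2), of \<alpha> \<kappa>] \<gamma>(2)
      confocal_form_commute[of \<alpha> \<kappa> x' x] confocal_form_commute[of \<alpha> \<kappa> y' y] by simp_all
  show ?thesis
    unfolding eq
    using DERIV_add[OF DERIV_mult[OF yy DERIV_diff[OF DERIV_const[of "1::real"] xx]] DERIV_power[OF xy, of 2]]
    by (simp add: \<gamma>(2) tangency_deriv_def algebra_simps)
qed

lemma DERIV_J_int:
  assumes \<gamma>: "(\<gamma> has_vector_derivative (x', y')) (at 0)" "\<gamma> 0 = (x, y)"
  shows "((\<lambda>t. J_int (\<gamma> t)) has_real_derivative
    x'$1 * y$2 + x$1 * y'$2 - x'$2 * y$1 - x$2 * y'$1) (at 0)"
proof -
  note D = curve_component_derivatives[OF \<gamma>(1)]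
  have eq: "J_int (\<gamma> t) = fst (\<gamma> t) $ 1 * snd (\<gamma> t) $ 2 - fst (\<gamma> t) $ 2 * snd (\<gamma> t) $ 1" for t
    by (simp add: J_int_def split_beta)
  show ?thesis
    unfolding eq by (rule derivative_eq_intros D | simp add: \<gamma>(2))+
qed

text \<open>Half the gradient of the form with parameter r, hence a normal of that quadric if x lies
  on it.\<close>

definition resolvent :: "real ^ 4 \<Rightarrow> real \<Rightarrow> real ^ 4 \<Rightarrow> real ^ 4" where
  "resolvent \<alpha> r x = (\<chi> i. x $ i / (\<alpha> $ i - r))"

text \<open>The triples \<open>(h, j, g)\<close> are differentials of \<open>(H, J\<^sup>2, G)\<close> in the direction of the scaling of \<open>y\<close>
  and of the two test vectors, and \<open>P\<close> is the differential of the separation polynomial.\<close>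

lemma quadratic_functional_zero:
  fixes l1 l2 l3 k m \<rho>1 \<rho>2 :: real
  defines "P \<equiv> \<lambda>(h, j, g) \<rho>. 2 * h * \<rho>\<^sup>2 + \<rho> * (k * g - m * j) - k * j"
  assumes k: "k \<noteq> 0" and \<rho>: "\<rho>1 \<noteq> \<rho>2"
    and E: "P (h0, j0, g0) \<rho>1 = 0" "P (h0, j0, g0) \<rho>2 = 0" "h0 \<noteq> 0" "l1 * h0 + l2 * j0 + l3 * g0 = 0"
    and V1: "P (h1, j1, g1) \<rho>1 \<noteq> 0" "P (h1, j1, g1) \<rho>2 = 0" "l1 * h1 + l2 * j1 + l3 * g1 = 0"
    and V2: "P (h2, j2, g2) \<rho>2 \<noteq> 0" "P (h2, j2, g2) \<rho>1 = 0" "l1 * h2 + l2 * j2 + l3 * g2 = 0"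
  shows "l1 = 0 \<and> l2 = 0 \<and> l3 = 0"
proof -
  \<comment> \<open>The functional is rewritten in the coefficients \<open>2 * h\<close>,
    \<open>k * g - m * j\<close>, \<open>- k * j\<close> of P as a quadratic in its
    argument.\<close>
  define \<beta> \<gamma> where "\<beta> = l3 / k" and "\<gamma> = - (l2 / k + l3 * m / k\<^sup>2)"
  have l3: "l3 = k * \<beta>" using k by (simp add: \<beta>_def)
  have l2: "l2 = - k * \<gamma> - m * \<beta>"
    using k by (simp add: \<beta>_def \<gamma>_def power2_eq_square field_simps)
  have functional: "l1 * h + l2 * j + l3 * g = l1 * h + \<beta> * (k * g - m * j) + \<gamma> * (- k * j)" for h j g
    unfolding l3 l2 by algebra
  have E': "2 * h0 * \<rho>1\<^sup>2 + \<rho>1 * (k * g0 - m * j0) - k * j0 = 0" "2 * h0 * \<rho>2\<^sup>2 + \<rho>2 * (k * g0 - m * j0) - k * j0 = 0"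
    using E by (simp_all add: P_def)
  \<comment> \<open>Vieta: the scaling direction gives a quadratic with both roots, so its
    coefficients are known up to the factor h0, and this determines l1.\<close>
  have "(\<rho>1 - \<rho>2) * (2 * h0 * (\<rho>1 + \<rho>2) + (k * g0 - m * j0)) = 0"
    using E' by algebra
  then have B0: "k * g0 - m * j0 = - 2 * h0 * (\<rho>1 + \<rho>2)" using \<rho> by simp
  have C0: "- k * j0 = 2 * h0 * \<rho>1 * \<rho>2" using E'(1) unfolding B0 by algebra
  have "h0 * (l1 - 2 * \<beta> * (\<rho>1 + \<rho>2) + 2 * \<gamma> * \<rho>1 * \<rho>2) = 0"
    using E(4) unfolding functional B0 C0 by algebra
  then have l1: "l1 = 2 * \<beta> * (\<rho>1 + \<rho>2) - 2 * \<gamma> * \<rho>1 * \<rho>2" using E(3) by simp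
  have key: "\<beta> = s * \<gamma>" if "P (h, j, g) t \<noteq> 0" "P (h, j, g) s = 0" "l1 * h + l2 * j + l3 * g = 0"
      "{s, t} = {\<rho>1, \<rho>2}" for h j g s t
  proof -
    define B C where "B = k * g - m * j" and "C = - k * j"
    have st: "s + t = \<rho>1 + \<rho>2" "s * t = \<rho>1 * \<rho>2"
      using that(4) by (auto simp: doubleton_eq_iff)
    have 1: "2 * h * s\<^sup>2 + s * B + C = 0" "2 * h * t\<^sup>2 + t * B + C \<noteq> 0"
      using that by (simp_all add: P_def B_def C_def)
    have l1': "l1 = 2 * \<beta> * (s + t) - 2 * \<gamma> * (s * t)" unfolding l1 st by simp
    have "l1 * h + \<beta> * B + \<gamma> * C = 0" using that(3) unfolding functional B_def C_def .
    \<comment> \<open>Eliminating C by the root s makes the functional factor. The first factor is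
      the difference quotient of P between s and t, which is nonzero since only s is a root.\<close>
    then have "(B + 2 * h * (s + t)) * (\<beta> - s * \<gamma>) = 0"
      using 1(1) unfolding l1' by algebra
    moreover have "(t - s) * (B + 2 * h * (s + t)) \<noteq> 0"
    proof -
      have "(t - s) * (B + 2 * h * (s + t)) = 2 * h * t\<^sup>2 + t * B + C - (2 * h * s\<^sup>2 + s * B + C)" by algebra
      then show ?thesis using 1 by simp
    qed
    ultimately show ?thesis by simp
  qed
  have "\<beta> = \<rho>2 * \<gamma>" "\<beta> = \<rho>1 * \<gamma>"
    using key[OF V1] key[OF V2] by auto
  then have "(\<rho>1 - \<rho>2) * \<gamma> = 0" by algebra
  then have "\<gamma> = 0" using \<rho> by simp
  then show ?thesis using \<open>\<beta> = \<rho>2 * \<gamma>\<close> by (simp add: l1 l2 l3)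
qed

section \<open>Phase space with the plane of rotation as the complex line\<close>

text \<open>The components 1 and 2 are packed into z and w: the rotational symmetry becomes
  multiplication by unit complex numbers, and J becomes \<open>Im (cnj z * w)\<close>.\<close>

definition phase_of :: "real \<Rightarrow> complex \<Rightarrow> real \<Rightarrow> real \<Rightarrow> complex \<Rightarrow> real \<Rightarrow> phase" where
  "phase_of u z v p w q =
    ((\<chi> i. if i = 0 then u else if i = 1 then Re z else if i = 2 then Im z else v),
     (\<chi> i. if i = 0 then p else if i = 1 then Re w else if i = 2 then Im w else q))"

lemma vec_eq_iff_4: "(x :: 'a ^ 4) = y \<longleftrightarrow> x$0 = y$0 \<and> x$1 = y$1 \<and> x$2 = y$2 \<and> x$3 = y$3"
proof -
  have 4: "(4 :: 4) = 0" by simp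
  show ?thesis unfolding vec_eq_iff forall_4 4 by blast
qed

lemma phase_of_components:
  "fst (phase_of u z v p w q) $ 0 = u" "fst (phase_of u z v p w q) $ 1 = Re z"
  "fst (phase_of u z v p w q) $ 2 = Im z" "fst (phase_of u z v p w q) $ 3 = v"
  "snd (phase_of u z v p w q) $ 0 = p" "snd (phase_of u z v p w q) $ 1 = Re w"
  "snd (phase_of u z v p w q) $ 2 = Im w" "snd (phase_of u z v p w q) $ 3 = q"
  by (simp_all add: phase_of_def)

lemma phase_of_eq_iff [simp]:
  "phase_of u z v p w q = phase_of u' z' v' p' w' q' \<longleftrightarrow> u = u' \<and> z = z' \<and> v = v' \<and> p = p' \<and> w = w' \<and> q = q'"
  unfolding prod_eq_iff vec_eq_iff_4 phase_of_components by (auto simp: complex_eq_iff)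

lemma phase_of_exhaust:
  obtains u z v p w q where "t = phase_of u z v p w q"
proof -
  have "t = phase_of (fst t$0) (Complex (fst t$1) (fst t$2)) (fst t$3) (snd t$0) (Complex (snd t$1) (snd t$2)) (snd t$3)"
    unfolding prod_eq_iff vec_eq_iff_4 phase_of_components by simp
  then show ?thesis using that by blast
qed

lemma continuous_on_phase_of [continuous_intros]:
  assumes "continuous_on S u" "continuous_on S z" "continuous_on S v"
    "continuous_on S p" "continuous_on S w" "continuous_on S q"
  shows "continuous_on S (\<lambda>t. phase_of (u t) (z t) (v t) (p t) (w t) (q t))"
proof -
  have *: "continuous_on S (\<lambda>t. if P then f t else g t)" if "continuous_on S f" "continuous_on S g"
    for P and f g :: "'a \<Rightarrow> real"
    using that by (cases P) simp_all
  show ?thesis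
    unfolding phase_of_def by (intro continuous_on_Pair continuous_on_vec_lambda * continuous_intros assms)
qed

lemma H_int_phase_of: "H_int (phase_of u z v p w q) = (p\<^sup>2 + (cmod w)\<^sup>2 + q\<^sup>2) / 2"
  by (simp add: H_int_def split_beta phase_of_components cmod_power2)

lemma J_int_phase_of: "J_int (phase_of u z v p w q) = Im (cnj z * w)"
  by (simp add: J_int_def split_beta phase_of_components)

lemma G_int_phase_of:
  "G_int \<alpha> (phase_of u z v p w q) = (cmod w)\<^sup>2 + (cmod (u *\<^sub>R w - p *\<^sub>R z))\<^sup>2 / (\<alpha>$1 - \<alpha>$0)
     + (cmod (v *\<^sub>R w - q *\<^sub>R z))\<^sup>2 / (\<alpha>$1 - \<alpha>$3)"
  by (simp add: G_int_def split_beta phase_of_components cmod_power2 mult.commute power2_commute)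

subsection \<open>Geodesics on an ellipsoid of revolution\<close>

text \<open>Level of energy and angular momentum for the surface of revolution that carries a
  boundary fibre; u and p are position and velocity along the axis. \<kappa> is c on the curve with
  k = 3 and a on the curve with k = 0.\<close>

definition revolution_level :: "real \<Rightarrow> real \<Rightarrow> real \<Rightarrow> real \<Rightarrow> (real \<times> real \<times> complex \<times> complex) set" where
  "revolution_level \<kappa> b h j = {(u, p, z, w). u\<^sup>2 / \<kappa> + (cmod z)\<^sup>2 / b = 1 \<and>
     u * p / \<kappa> + Re (cnj z * w) / b = 0 \<and> p\<^sup>2 + (cmod w)\<^sup>2 = 2 * h \<and> Im (cnj z * w) = j}"

text \<open>The squares \<open>A\<close>, \<open>B\<close> of the normalised meridian coordinates \<open>u / sqrt \<kappa>\<close>, \<open>p / sqrt (2 h)\<close> satisfy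
  \<open>meridian_poly (b / \<kappa>) A B = j\<^sup>2 / (2 h b)\<close>; this curve is star-shaped around the origin.\<close>

definition meridian_poly :: "real \<Rightarrow> real \<Rightarrow> real \<Rightarrow> real" where
  "meridian_poly \<kappa> A B = (1 - A) * (1 - B) - \<kappa> * (A * B)"

text \<open>This is the star-shapedness: A and B are squares, so scaling both by T moves along a
  ray. The drop has the factor T - 1, and inside the unit square the cofactor stays positive because
  \<open>T * A * B \<le> B\<close> and \<open>A * B \<le> A\<close>, one of them strictly unless A =
  0.\<close>

lemma meridian_poly_strict_decreasing:
  assumes "\<kappa> > 0" "T > 1" "A \<ge> 0" "B \<ge> 0" "A + B > 0" "T * A \<le> 1" "T * B \<le> 1"
  shows "meridian_poly \<kappa> (T * A) (T * B) < meridian_poly \<kappa> A B"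
proof -
  have 1: "T * A * B \<le> 1 * B" using assms by (intro mult_right_mono) auto
  have B1: "B < 1"
  proof (cases "B > 0")
    case True
    then have "1 * B < T * B" using assms by (intro mult_strict_right_mono) auto
    then show ?thesis using assms by simp
  qed simp
  have 2: "T * A * B + A * B < A + B"
  proof (cases "A = 0")
    case False
    then have "A * B < A * 1" using B1 assms by (intro mult_strict_left_mono) auto
    then show ?thesis using 1 by simp
  qed (use assms in auto)
  have "meridian_poly \<kappa> A B - meridian_poly \<kappa> (T * A) (T * B)
     = (T - 1) * (A + B - (T * A * B + A * B)) + \<kappa> * (A * B) * (T - 1) * (T + 1)"
    unfolding meridian_poly_def by algebra
  moreover have "(T - 1) * (A + B - (T * A * B + A * B)) > 0" using assms 2 by simp
  moreover have "\<kappa> * (A * B) * (T - 1) * (T + 1) \<ge> 0" using assms by simp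
  ultimately show ?thesis by linarith
qed

text \<open>Intermediate value theorem from the centre, where the polynomial is 1, to the point at
  distance R where the ray leaves the unit square: there one of 1 - A, 1 - B vanishes and the value
  is at most 0.\<close>

lemma meridian_ray_exists:
  assumes "\<kappa> > 0" "0 \<le> \<rho>" "\<rho> < 1" "x\<^sup>2 + y\<^sup>2 = 1"
  obtains r where "r > 0" "(r * x)\<^sup>2 \<le> 1" "(r * y)\<^sup>2 \<le> 1" "meridian_poly \<kappa> ((r * x)\<^sup>2) ((r * y)\<^sup>2) = \<rho>"
proof -
  define m where "m = max (x\<^sup>2) (y\<^sup>2)"
  have m: "m > 0"
  proof -
    have "2 * m \<ge> x\<^sup>2 + y\<^sup>2" by (simp add: m_def)
    then show ?thesis using assms by linarith
  qed
  define R where "R = 1 / sqrt m"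
  have R: "R > 0" "R\<^sup>2 * m = 1" using m by (simp_all add: R_def power_divide)
  have le: "(r * x)\<^sup>2 \<le> 1 \<and> (r * y)\<^sup>2 \<le> 1" if "0 \<le> r" "r \<le> R" for r
  proof -
    have "r\<^sup>2 \<le> R\<^sup>2" using that by (simp add: power_mono)
    then have "r\<^sup>2 * x\<^sup>2 \<le> R\<^sup>2 * m" "r\<^sup>2 * y\<^sup>2 \<le> R\<^sup>2 * m"
      by (auto intro!: mult_mono simp: m_def)
    then show ?thesis using R by (simp add: power_mult_distrib)
  qed
  define f where "f r = meridian_poly \<kappa> ((r * x)\<^sup>2) ((r * y)\<^sup>2)" for r
  have "(R * x)\<^sup>2 = 1 \<or> (R * y)\<^sup>2 = 1"
    using R by (auto simp: m_def max_def power_mult_distrib split: if_splits)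
  then have "f R \<le> 0" using assms by (auto simp: f_def meridian_poly_def)
  moreover have "f 0 = 1" by (simp add: f_def meridian_poly_def)
  moreover have "continuous_on {0..R} f"
    unfolding f_def meridian_poly_def by (intro continuous_intros)
  ultimately obtain r where r: "0 \<le> r" "r \<le> R" "f r = \<rho>"
    using IVT2'[of f R \<rho> 0] assms R by auto
  have "r \<noteq> 0" using r \<open>f 0 = 1\<close> assms by auto
  with r le[of r] show ?thesis by (intro that[of r]) (auto simp: f_def)
qed

lemma meridian_ray_unique:
  assumes "\<kappa> > 0" "meridian_poly \<kappa> ((Re \<xi>)\<^sup>2) ((Im \<xi>)\<^sup>2) = meridian_poly \<kappa> ((Re \<xi>')\<^sup>2) ((Im \<xi>')\<^sup>2)"
    and "(Re \<xi>)\<^sup>2 \<le> 1" "(Im \<xi>)\<^sup>2 \<le> 1" "(Re \<xi>')\<^sup>2 \<le> 1" "(Im \<xi>')\<^sup>2 \<le> 1"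
    and ne: "\<xi> \<noteq> 0" "\<xi>' \<noteq> 0" and sgn: "sgn \<xi> = sgn \<xi>'"
  shows "\<xi> = \<xi>'"
proof -
  have no: False if "meridian_poly \<kappa> ((Re x)\<^sup>2) ((Im x)\<^sup>2) = meridian_poly \<kappa> ((Re y)\<^sup>2) ((Im y)\<^sup>2)"
     "x \<noteq> 0" "sgn x = sgn y" "norm x < norm y" "(Re y)\<^sup>2 \<le> 1" "(Im y)\<^sup>2 \<le> 1" for x y :: complex
  proof -
    define t where "t = norm y / norm x"
    have t: "t > 1" using that by (simp add: t_def)
    have "y \<noteq> 0" using that(4) norm_ge_zero[of x] by auto
    then have "y = norm y *\<^sub>R sgn y" by (simp add: sgn_div_norm)
    also have "\<dots> = t *\<^sub>R x" using that(2) unfolding that(3)[symmetric] by (simp add: sgn_div_norm t_def divide_inverse)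
    finally have y: "y = t *\<^sub>R x" .
    have "(Re x)\<^sup>2 + (Im x)\<^sup>2 > 0" using that(2) by (simp add: cmod_power2[symmetric])
    then have "meridian_poly \<kappa> (t\<^sup>2 * (Re x)\<^sup>2) (t\<^sup>2 * (Im x)\<^sup>2) < meridian_poly \<kappa> ((Re x)\<^sup>2) ((Im x)\<^sup>2)"
      using that(5,6) t assms(1) unfolding y
      by (intro meridian_poly_strict_decreasing) (auto simp: power_mult_distrib one_less_power)
    then show False using that(1) unfolding y by (simp add: power_mult_distrib)
  qed
  have "norm \<xi> = norm \<xi>'"
    using no[of \<xi> \<xi>'] no[of \<xi>' \<xi>] assms by (metis linorder_neqE_linordered_idom)
  then show ?thesis
    using sgn ne by (metis sgn_div_norm scaleR_left_imp_eq inverse_nonzero_iff_nonzero norm_eq_zero)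
qed

lemma revolution_level_facts:
  assumes "\<kappa> > 0" "b > 0" "h > 0" and E: "(u, p, z, w) \<in> revolution_level \<kappa> b h j"
  shows "(cmod z)\<^sup>2 = b * (1 - u\<^sup>2 / \<kappa>)" "(cmod w)\<^sup>2 = 2 * h * (1 - p\<^sup>2 / (2 * h))"
    "Re (cnj z * w) = - b * u * p / \<kappa>"
    "u\<^sup>2 / \<kappa> \<le> 1" "p\<^sup>2 / (2 * h) \<le> 1"
    "meridian_poly (b / \<kappa>) (u\<^sup>2 / \<kappa>) (p\<^sup>2 / (2 * h)) = j\<^sup>2 / (2 * h * b)"
proof -
  have e: "u\<^sup>2 / \<kappa> + (cmod z)\<^sup>2 / b = 1" "u * p / \<kappa> + Re (cnj z * w) / b = 0" "p\<^sup>2 + (cmod w)\<^sup>2 = 2 * h"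
    "Im (cnj z * w) = j"
    using E by (auto simp: revolution_level_def)
  show z: "(cmod z)\<^sup>2 = b * (1 - u\<^sup>2 / \<kappa>)" using e(1) assms by (simp add: field_simps)
  show w: "(cmod w)\<^sup>2 = 2 * h * (1 - p\<^sup>2 / (2 * h))"
  proof -
    have "2 * h * (p\<^sup>2 / (2 * h)) = p\<^sup>2" using assms by simp
    then show ?thesis using e(3) unfolding right_diff_distrib by linarith
  qed
  have "Re (cnj z * w) / b = - (u * p / \<kappa>)" using e(2) by linarith
  then show d: "Re (cnj z * w) = - b * u * p / \<kappa>" using assms by (simp add: field_simps)
  show "u\<^sup>2 / \<kappa> \<le> 1"
  proof -
    have "(cmod z)\<^sup>2 / b \<ge> 0" using assms by simp
    then show ?thesis using e(1) by linarith
  qed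
  show "p\<^sup>2 / (2 * h) \<le> 1"
  proof -
    have "p\<^sup>2 \<le> 2 * h" using e(3) zero_le_power2[of "cmod w"] by linarith
    then show ?thesis using assms by simp
  qed
  \<comment> \<open>Splitting the modulus of \<open>cnj z * w\<close> into real and imaginary part
    leaves an equation in u and p alone, the meridian equation.\<close>
  have "(cmod z)\<^sup>2 * (cmod w)\<^sup>2 = (cmod (cnj z * w))\<^sup>2" by (simp add: norm_mult power_mult_distrib)
  also have "\<dots> = (b * u * p / \<kappa>)\<^sup>2 + j\<^sup>2" unfolding cmod_power2 d e(4) by simp
  finally have "b * (1 - u\<^sup>2 / \<kappa>) * (2 * h * (1 - p\<^sup>2 / (2 * h))) = (b * u * p / \<kappa>)\<^sup>2 + j\<^sup>2"
    unfolding z w .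
  moreover have "(b * u * p / \<kappa>)\<^sup>2 = 2 * h * b * (b / \<kappa> * (u\<^sup>2 / \<kappa> * (p\<^sup>2 / (2 * h))))"
    using assms by (simp add: power2_eq_square)
  ultimately have "2 * h * b * meridian_poly (b / \<kappa>) (u\<^sup>2 / \<kappa>) (p\<^sup>2 / (2 * h)) = j\<^sup>2"
    unfolding meridian_poly_def by algebra
  then show "meridian_poly (b / \<kappa>) (u\<^sup>2 / \<kappa>) (p\<^sup>2 / (2 * h)) = j\<^sup>2 / (2 * h * b)"
    using assms by (simp add: field_simps)
qed

lemma compact_revolution_level:
  assumes "\<kappa> > 0" "b > 0" "h > 0"
  shows "compact (revolution_level \<kappa> b h j)"
proof -
  define K where "K = {- sqrt \<kappa> .. sqrt \<kappa>} \<times> {- sqrt (2 * h) .. sqrt (2 * h)}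
    \<times> cball (0 :: complex) (sqrt b) \<times> cball (0 :: complex) (sqrt (2 * h))"
  have K: "compact K" unfolding K_def by (intro compact_Times compact_Icc compact_cball)
  have "closed (revolution_level \<kappa> b h j)"
  proof -
    have "revolution_level \<kappa> b h j = {t. (fst t)\<^sup>2 / \<kappa> + (cmod (fst (snd (snd t))))\<^sup>2 / b = 1}
      \<inter> {t. fst t * fst (snd t) / \<kappa> + Re (cnj (fst (snd (snd t))) * snd (snd (snd t))) / b = 0}
      \<inter> {t. (fst (snd t))\<^sup>2 + (cmod (snd (snd (snd t))))\<^sup>2 = 2 * h}
      \<inter> {t. Im (cnj (fst (snd (snd t))) * snd (snd (snd t))) = j}"
      by (auto simp: revolution_level_def)
    also have "closed \<dots>"
      using assms by (intro closed_Int closed_Collect_eq continuous_intros) auto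
    finally show ?thesis .
  qed
  moreover have "revolution_level \<kappa> b h j \<subseteq> K"
  proof clarify
    fix u p z w assume E: "(u, p, z, w) \<in> revolution_level \<kappa> b h j"
    note f = revolution_level_facts[OF assms E]
    have sq: "\<bar>x\<bar> \<le> sqrt y" if "x\<^sup>2 \<le> y" for x y
      using real_sqrt_le_mono[OF that] by simp
    have "u\<^sup>2 \<le> \<kappa>" "p\<^sup>2 \<le> 2 * h" using f(4,5) assms by simp_all
    moreover have "(cmod z)\<^sup>2 \<le> b" "(cmod w)\<^sup>2 \<le> 2 * h" 
      unfolding f(1,2) using assms by simp_all
    ultimately show "(u, p, z, w) \<in> K"
      unfolding K_def
      using sq[of u \<kappa>] sq[of p "2 * h"] sq[of "cmod z" b] sq[of "cmod w" "2 * h"] by (auto simp: abs_le_iff)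
  qed
  ultimately show ?thesis using compact_Int_closed[OF K] by (metis Int_absorb1)
qed

text \<open>One angle is the direction of \<xi> on the star-shaped meridian curve. It determines u
  and p, hence both moduli and \<open>cnj z * w\<close>, so (z, w) is known up to a common rotation,
  and the direction of \<zeta> fixes that rotation. The direction of z would not do, since z
  vanishes at the poles when j = 0.\<close>

lemma revolution_level_torus:
  assumes pos: "\<kappa> > 0" "b > 0" "h > 0" and j: "j\<^sup>2 < 2 * h * b"
  shows "revolution_level \<kappa> b h j homeomorphic torus"
proof -
  \<comment> \<open>With this sign all terms of \<open>\<zeta>_norm\<close> are nonnegative on the
    level, so \<zeta> = 0 would force z = w = 0.\<close>
  define \<sigma> :: real where "\<sigma> = (if j \<ge> 0 then 1 else -1)"
  have \<sigma>: "\<sigma>\<^sup>2 = 1" "\<sigma> * \<sigma> = 1" "\<sigma> * j \<ge> 0" "\<sigma> \<noteq> 0" by (simp_all add: \<sigma>_def)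
  define \<rho> where "\<rho> = j\<^sup>2 / (2 * h * b)"
  have \<rho>: "0 \<le> \<rho>" "\<rho> < 1" using pos j by (simp_all add: \<rho>_def)
  let ?E = "revolution_level \<kappa> b h j"
  define \<zeta> where "\<zeta> z w = z - \<i> * complex_of_real \<sigma> * w" for z w
  define \<xi> where "\<xi> u p = complex_of_real (u / sqrt \<kappa>) + \<i> * complex_of_real (p / sqrt (2 * h))" for u p
  define f where "f = (\<lambda>(u, p, z, w). (sgn (\<zeta> z w), sgn (\<xi> u p)))"
  have \<zeta>_norm: "(cmod (\<zeta> z w))\<^sup>2 = (cmod z)\<^sup>2 + (cmod w)\<^sup>2 + 2 * \<sigma> * Im (cnj z * w)" for z w
    unfolding \<zeta>_def cmod_power2 using \<sigma>(1) by (simp add: power2_eq_square algebra_simps) algebra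
  have \<xi>_comps: "Re (\<xi> u p) = u / sqrt \<kappa>" "Im (\<xi> u p) = p / sqrt (2 * h)"
    "(Re (\<xi> u p))\<^sup>2 = u\<^sup>2 / \<kappa>" "(Im (\<xi> u p))\<^sup>2 = p\<^sup>2 / (2 * h)" for u p
    using pos by (simp_all add: \<xi>_def power_divide)
  have \<zeta>_ne: "\<zeta> z w \<noteq> 0" and \<xi>_ne: "\<xi> u p \<noteq> 0" if E: "(u, p, z, w) \<in> ?E" for u p z w
  proof -
    note fs = revolution_level_facts[OF pos E]
    have jj: "Im (cnj z * w) = j" using E by (simp add: revolution_level_def)
    show "\<zeta> z w \<noteq> 0"
    proof
      assume "\<zeta> z w = 0"
      then have "(cmod z)\<^sup>2 + (cmod w)\<^sup>2 + 2 * (\<sigma> * j) = 0" using \<zeta>_norm[of z w] jj by simp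
      then have "(cmod z)\<^sup>2 = 0" "(cmod w)\<^sup>2 = 0"
        using \<sigma>(3) zero_le_power2[of "cmod z"] zero_le_power2[of "cmod w"] by linarith+
      then have "u\<^sup>2 / \<kappa> = 1" "p\<^sup>2 / (2 * h) = 1"
        unfolding fs(1,2) mult_eq_0_iff using pos by linarith+
      then have "meridian_poly (b / \<kappa>) 1 1 = \<rho>" using fs(6) unfolding \<rho>_def by metis
      then have "- (b / \<kappa>) = \<rho>" by (simp add: meridian_poly_def)
      then show False using \<rho> pos by (metis divide_pos_pos neg_0_le_iff_le not_le)
    qed
    show "\<xi> u p \<noteq> 0"
    proof
      assume "\<xi> u p = 0"
      then have "u\<^sup>2 / \<kappa> = 0" "p\<^sup>2 / (2 * h) = 0" using \<xi>_comps(3,4)[of u p] by simp_all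
      then have "meridian_poly (b / \<kappa>) 0 0 = \<rho>" using fs(6) unfolding \<rho>_def by metis
      then have "1 = \<rho>" by (simp add: meridian_poly_def)
      then show False using \<rho> by simp
    qed
  qed
  have "continuous_on ?E f"
  proof -
    have f': "f = (\<lambda>t. (sgn (\<zeta> (fst (snd (snd t))) (snd (snd (snd t)))), sgn (\<xi> (fst t) (fst (snd t)))))"
      by (auto simp: f_def)
    show ?thesis
      unfolding f' using \<zeta>_ne \<xi>_ne pos
      by (intro continuous_on_Pair continuous_on_sgn) (auto simp: \<zeta>_def \<xi>_def intro!: continuous_intros)
  qed
  moreover have "inj_on f ?E"
  proof (rule inj_onI)
    fix s t assume st: "s \<in> ?E" "t \<in> ?E" "f s = f t"
    obtain u p z w where s: "s = (u, p, z, w)" by (cases s) auto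
    obtain u' p' z' w' where t: "t = (u', p', z', w')" by (cases t) auto
    have E: "(u, p, z, w) \<in> ?E" and E': "(u', p', z', w') \<in> ?E" and eq: "f (u, p, z, w) = f (u', p', z', w')"
      using st unfolding s t by auto
    note fs = revolution_level_facts[OF pos E] and fs' = revolution_level_facts[OF pos E']
    have jj: "Im (cnj z * w) = j" "Im (cnj z' * w') = j" using E E' by (simp_all add: revolution_level_def)
    have "\<xi> u p = \<xi> u' p'"
    proof (rule meridian_ray_unique[of "b / \<kappa>"])
      show "sgn (\<xi> u p) = sgn (\<xi> u' p')" using eq by (simp add: f_def)
    qed (use pos fs(4-6) fs'(4-6) \<xi>_ne[OF E] \<xi>_ne[OF E'] in \<open>simp_all add: \<xi>_comps(3,4)\<close>)
    then have up: "u = u'" "p = p'"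
      using pos \<xi>_comps(1)[of u p] \<xi>_comps(1)[of u' p'] \<xi>_comps(2)[of u p] \<xi>_comps(2)[of u' p'] by auto
    have norms: "(cmod z)\<^sup>2 = (cmod z')\<^sup>2" "(cmod w)\<^sup>2 = (cmod w')\<^sup>2" "Re (cnj z * w) = Re (cnj z' * w')"
      using fs fs' up by simp_all
    then have "(cmod (\<zeta> z w))\<^sup>2 = (cmod (\<zeta> z' w'))\<^sup>2" unfolding \<zeta>_norm jj by simp
    then have "cmod (\<zeta> z w) = cmod (\<zeta> z' w')" by simp
    moreover have "sgn (\<zeta> z w) = sgn (\<zeta> z' w')" using eq by (simp add: f_def)
    ultimately have \<zeta>: "\<zeta> z w = \<zeta> z' w'"
      using \<zeta>_ne[OF E] by (metis sgn_div_norm scaleR_left_imp_eq inverse_nonzero_iff_nonzero norm_eq_zero)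
    \<comment> \<open>The product \<open>cnj (\<zeta> z w) * \<eta> z w\<close> depends only on
      quantities already known to agree, so \<zeta> determines \<eta>, and the two together
      determine z and w.\<close>
    define \<eta> where "\<eta> z w = z + \<i> * complex_of_real \<sigma> * w" for z w
    have \<zeta>\<eta>: "cnj (\<zeta> z w) * \<eta> z w = Complex ((cmod z)\<^sup>2 - (cmod w)\<^sup>2) (2 * \<sigma> * Re (cnj z * w))" for z w
      unfolding \<zeta>_def \<eta>_def cmod_power2 complex_eq_iff using \<sigma>(1)
      by (simp add: power2_eq_square algebra_simps)
    have "cnj (\<zeta> z w) * \<eta> z w = cnj (\<zeta> z w) * \<eta> z' w'"
      using \<zeta>\<eta>[of z w] \<zeta>\<eta>[of z' w'] norms \<zeta> by simp
    then have \<eta>: "\<eta> z w = \<eta> z' w'" using \<zeta>_ne[OF E] by simp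
    have "z = (\<zeta> z w + \<eta> z w) / 2" "z' = (\<zeta> z' w' + \<eta> z' w') / 2"
      by (simp_all add: \<zeta>_def \<eta>_def)
    then have "z = z'" using \<zeta> \<eta> by simp
    moreover from this have "w = w'" using \<zeta> \<sigma>(4) by (simp add: \<zeta>_def)
    ultimately show "s = t" using up by (simp add: s t)
  qed
  moreover have "f ` ?E = torus"
  proof (intro equalityI subsetI)
    fix t assume "t \<in> f ` ?E"
    then show "t \<in> torus" using \<zeta>_ne \<xi>_ne by (auto simp: f_def norm_sgn)
  next
    fix t assume "t \<in> torus"
    then obtain \<theta> e where t: "t = (\<theta>, e)" "norm \<theta> = 1" "norm e = 1" by auto
    have "(Re e)\<^sup>2 + (Im e)\<^sup>2 = 1" using t(3) by (simp add: cmod_power2[symmetric])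
    then obtain r where r: "r > 0" "(r * Re e)\<^sup>2 \<le> 1" "(r * Im e)\<^sup>2 \<le> 1"
      "meridian_poly (b / \<kappa>) ((r * Re e)\<^sup>2) ((r * Im e)\<^sup>2) = \<rho>"
      using meridian_ray_exists[of "b / \<kappa>" \<rho>] \<rho> pos by (metis divide_pos_pos)
    define U P where "U = r * Re e" and "P = r * Im e"
    define u p where "u = sqrt \<kappa> * U" and "p = sqrt (2 * h) * P"
    \<comment> \<open>The values that the sum and the difference of the squared moduli of z and w,
      and \<open>Re (cnj z * w)\<close>, are forced to take.\<close>
    define A B D where "A = b * (1 - U\<^sup>2) + 2 * h * (1 - P\<^sup>2)" and "B = b * (1 - U\<^sup>2) - 2 * h * (1 - P\<^sup>2)"
      and "D = - b * u * p / \<kappa>"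
    have UP: "U\<^sup>2 \<le> 1" "P\<^sup>2 \<le> 1" using r by (simp_all add: U_def P_def)
    have D2: "b * (1 - U\<^sup>2) * (2 * h * (1 - P\<^sup>2)) = D\<^sup>2 + j\<^sup>2"
    proof -
      have "D\<^sup>2 = b\<^sup>2 * (2 * h) * (U\<^sup>2 * P\<^sup>2) / \<kappa>"
        using pos by (simp add: D_def u_def p_def power_mult_distrib power_divide) (simp add: power2_eq_square)
      then have "D\<^sup>2 = 2 * h * b * (b / \<kappa> * (U\<^sup>2 * P\<^sup>2))"
        by (simp add: power2_eq_square)
      moreover have "j\<^sup>2 = 2 * h * b * \<rho>" using pos by (simp add: \<rho>_def)
      ultimately show ?thesis
        unfolding r(4)[symmetric] U_def[symmetric] P_def[symmetric] meridian_poly_def by algebra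
    qed
    define N where "N = A + 2 * \<sigma> * j"
    have "A \<ge> 0" unfolding A_def using UP pos by simp
    have "N > 0"
    proof (rule ccontr)
      assume "\<not> N > 0"
      moreover have "b * (1 - U\<^sup>2) \<ge> 0" "2 * h * (1 - P\<^sup>2) \<ge> 0" using UP pos by simp_all
      ultimately have "b * (1 - U\<^sup>2) = 0" "2 * h * (1 - P\<^sup>2) = 0"
        using \<sigma>(3) unfolding N_def A_def by linarith+
      then have "U\<^sup>2 = 1" "P\<^sup>2 = 1" using pos by simp_all
      then have "- (b / \<kappa>) = \<rho>" using r(4) by (simp add: U_def[symmetric] P_def[symmetric] meridian_poly_def)
      then show False using \<rho> pos by (metis divide_pos_pos neg_0_le_iff_le not_le)
    qed
    \<comment> \<open>l is the quotient \<eta> / \<zeta> forced by the product formula of the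
      injectivity part; z and w below are then recovered from \<zeta> and \<eta> = l
      \<zeta>.\<close>
    define l where "l = Complex (B / N) (2 * \<sigma> * D / N)"
    have l: "N * Re l = B" "N * Im l = 2 * \<sigma> * D" using \<open>N > 0\<close> by (simp_all add: l_def)
    have ll: "N * ((Re l)\<^sup>2 + (Im l)\<^sup>2) = A - 2 * \<sigma> * j"
    proof -
      have "N * (N * ((Re l)\<^sup>2 + (Im l)\<^sup>2)) = (N * Re l)\<^sup>2 + (N * Im l)\<^sup>2" by algebra
      also have "\<dots> = B\<^sup>2 + 4 * D\<^sup>2" unfolding l using \<sigma>(1) by (simp add: power_mult_distrib)
      also have "\<dots> = A\<^sup>2 - 4 * j\<^sup>2" using D2 unfolding A_def B_def by algebra
      also have "\<dots> = N * (A - 2 * \<sigma> * j)" unfolding N_def using \<sigma>(1) by algebra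
      finally show ?thesis using \<open>N > 0\<close> by simp
    qed
    define \<zeta>0 where "\<zeta>0 = sqrt N *\<^sub>R \<theta>"
    have \<zeta>0: "(cmod \<zeta>0)\<^sup>2 = N" "cnj \<zeta>0 * \<zeta>0 = N"
      using t(2) \<open>N > 0\<close> complex_norm_square[of \<zeta>0] by (simp_all add: \<zeta>0_def mult.commute)
    define z w where "z = \<zeta>0 * (1 + l) / 2" and "w = \<i> * complex_of_real \<sigma> * \<zeta>0 * (1 - l) / 2"
    have z: "(cmod z)\<^sup>2 = b * (1 - U\<^sup>2)"
    proof -
      have "(cmod z)\<^sup>2 = N * (cmod (1 + l))\<^sup>2 / 4"
        by (simp add: z_def norm_mult norm_divide power_mult_distrib power_divide \<zeta>0)
      also have "\<dots> = (N + 2 * (N * Re l) + N * ((Re l)\<^sup>2 + (Im l)\<^sup>2)) / 4"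
        unfolding cmod_power2 by (simp add: power2_eq_square algebra_simps)
      also have "\<dots> = b * (1 - U\<^sup>2)" unfolding l ll unfolding N_def A_def B_def by (simp add: field_simps)
      finally show ?thesis .
    qed
    have w: "(cmod w)\<^sup>2 = 2 * h * (1 - P\<^sup>2)"
    proof -
      have "(cmod w)\<^sup>2 = N * (cmod (1 - l))\<^sup>2 / 4"
        using \<sigma>(1) by (simp add: w_def norm_mult norm_divide power_mult_distrib power_divide \<zeta>0)
      also have "\<dots> = (N - 2 * (N * Re l) + N * ((Re l)\<^sup>2 + (Im l)\<^sup>2)) / 4"
        unfolding cmod_power2 by (simp add: power2_eq_square algebra_simps)
      also have "\<dots> = 2 * h * (1 - P\<^sup>2)" unfolding l ll unfolding N_def A_def B_def by (simp add: field_simps)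
      finally show ?thesis .
    qed
    have "cnj z * w = (cnj \<zeta>0 * \<zeta>0) * (cnj (1 + l) * (\<i> * complex_of_real \<sigma> * (1 - l))) / 4"
      unfolding z_def w_def by simp
    also have "\<dots> = Complex (\<sigma> * (N * Im l) / 2) (\<sigma> * (N - N * ((Re l)\<^sup>2 + (Im l)\<^sup>2)) / 4)"
      unfolding \<zeta>0 complex_eq_iff by (simp add: power2_eq_square algebra_simps)
    also have "\<dots> = Complex D j"
      unfolding l ll unfolding N_def using \<sigma>(2) by (simp add: algebra_simps)
    finally have zw: "cnj z * w = Complex D j" .
    have u2: "u\<^sup>2 / \<kappa> = U\<^sup>2" and p2: "p\<^sup>2 = 2 * h * P\<^sup>2"
      using pos by (simp_all add: u_def p_def power_mult_distrib)
    have "(u, p, z, w) \<in> ?E"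
      unfolding revolution_level_def prod.case mem_Collect_eq z w zw u2 p2 complex.sel
    proof (intro conjI)
      show "2 * h * P\<^sup>2 + 2 * h * (1 - P\<^sup>2) = 2 * h" by (simp add: right_diff_distrib)
    qed (use pos in \<open>simp_all add: D_def\<close>)
    moreover have "f (u, p, z, w) = t"
    proof -
      have "\<zeta> z w = \<zeta>0"
        by (cases "j \<ge> 0") (simp_all add: \<sigma>_def \<zeta>_def z_def w_def field_simps)
      moreover have "sgn \<zeta>0 = \<theta>"
        using \<open>N > 0\<close> t(2) by (simp add: \<zeta>0_def sgn_scaleR sgn_div_norm)
      moreover have "\<xi> u p = r *\<^sub>R e"
        using pos by (simp add: complex_eq_iff \<xi>_comps u_def p_def U_def P_def)
      moreover have "sgn (r *\<^sub>R e) = e" using r(1) t(3) by (simp add: sgn_scaleR sgn_div_norm)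
      ultimately show ?thesis by (simp add: f_def t)
    qed
    ultimately show "t \<in> f ` ?E" by (metis imageI)
  qed
  ultimately show ?thesis
    using homeomorphic_compact[OF compact_revolution_level[OF pos]] by blast
qed

text \<open>Here the meridian polynomial takes its maximum 1 on the unit square, which it does only
  at the origin. What remains is the equator, run through in the direction given by the sign of
  j.\<close>

lemma revolution_level_circle:
  assumes pos: "\<kappa> > 0" "b > 0" "h > 0" and j: "j\<^sup>2 = 2 * h * b"
  shows "revolution_level \<kappa> b h j homeomorphic circle"
proof -
  let ?E = "revolution_level \<kappa> b h j"
  define f where "f \<omega> = (0 :: real, 0 :: real, sqrt b *\<^sub>R \<omega>, (j / sqrt b) *\<^sub>R (\<i> * \<omega>))" for \<omega> :: complex
  have "continuous_on circle f" unfolding f_def by (intro continuous_intros)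
  moreover have "inj_on f circle" using pos by (auto simp: f_def inj_on_def)
  moreover have "f ` circle = ?E"
  proof (intro equalityI subsetI)
    fix t assume "t \<in> f ` circle"
    then obtain \<omega> where \<omega>: "norm \<omega> = 1" "t = f \<omega>" by auto
    have "cnj \<omega> * \<omega> = 1" using \<omega>(1) complex_norm_square[of \<omega>] by (simp add: mult.commute)
    moreover have "cnj (sqrt b *\<^sub>R \<omega>) * ((j / sqrt b) *\<^sub>R (\<i> * \<omega>)) = j *\<^sub>R (\<i> * (cnj \<omega> * \<omega>))"
      using pos by (simp add: scaleR_conv_of_real mult_ac)
    ultimately have "cnj (sqrt b *\<^sub>R \<omega>) * ((j / sqrt b) *\<^sub>R (\<i> * \<omega>)) = j *\<^sub>R \<i>" by simp
    then have 1: "Re (cnj (sqrt b *\<^sub>R \<omega>) * ((j / sqrt b) *\<^sub>R (\<i> * \<omega>))) = 0"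
      "Im (cnj (sqrt b *\<^sub>R \<omega>) * ((j / sqrt b) *\<^sub>R (\<i> * \<omega>))) = j" by simp_all
    have "(cmod ((j / sqrt b) *\<^sub>R (\<i> * \<omega>)))\<^sup>2 = (j / sqrt b)\<^sup>2"
      using \<omega>(1) by (simp add: norm_mult power_mult_distrib power_divide)
    also have "\<dots> = 2 * h" using pos j by (simp add: power_divide)
    finally have 2: "(cmod ((j / sqrt b) *\<^sub>R (\<i> * \<omega>)))\<^sup>2 = 2 * h" .
    have 3: "(cmod (sqrt b *\<^sub>R \<omega>))\<^sup>2 = b" using pos \<omega>(1) by (simp add: power_mult_distrib)
    show "t \<in> ?E"
      unfolding \<omega>(2) f_def revolution_level_def prod.case mem_Collect_eq 1 2 3 using pos by simp
  next
    fix t assume "t \<in> ?E"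
    then obtain u p z w where t: "t = (u, p, z, w)" and E: "(u, p, z, w) \<in> ?E" by (cases t) auto
    note fs = revolution_level_facts[OF pos E]
    define A B where "A = u\<^sup>2 / \<kappa>" and "B = p\<^sup>2 / (2 * h)"
    have AB: "0 \<le> A" "0 \<le> B" "A \<le> 1" "B \<le> 1" "(1 - A) * (1 - B) - b / \<kappa> * (A * B) = 1"
      using fs pos j by (simp_all add: A_def B_def meridian_poly_def)
    have nonneg: "A * (1 - B) \<ge> 0" "B * (1 - A) \<ge> 0" "b / \<kappa> * (A * B) \<ge> 0" using AB pos by simp_all
    have sums: "A * (1 - B) + B + b / \<kappa> * (A * B) = 0" "B * (1 - A) + A + b / \<kappa> * (A * B) = 0"
      using AB(5) by algebra+
    have zero: "Y = 0" if "X \<ge> 0" "Y \<ge> 0" "Z \<ge> 0" "X + Y + Z = 0" for X Y Z :: real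
      using that by linarith
    have "A = 0" "B = 0"
      using zero[OF nonneg(2) AB(1) nonneg(3) sums(2)] zero[OF nonneg(1) AB(2) nonneg(3) sums(1)] by auto
    then have up: "u = 0" "p = 0" using pos by (auto simp: A_def B_def)
    have z: "(cmod z)\<^sup>2 = b" and w: "(cmod w)\<^sup>2 = 2 * h" using fs up by simp_all
    have "Im (cnj z * w) = j" using E by (simp add: revolution_level_def)
    \<comment> \<open>Equality in Cauchy-Schwarz: this square turns out to be zero, so w is the
      tangent multiple of i z.\<close>
    moreover have "(cmod (w - (j / b) *\<^sub>R (\<i> * z)))\<^sup>2 = (cmod w)\<^sup>2 + (j / b)\<^sup>2 * (cmod z)\<^sup>2 - 2 * (j / b) * Im (cnj z * w)"
      unfolding cmod_power2 by (simp add: power2_eq_square algebra_simps)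
    ultimately have "(cmod (w - (j / b) *\<^sub>R (\<i> * z)))\<^sup>2 = 2 * h - j\<^sup>2 / b"
      unfolding z w using pos by (simp add: power_divide) (simp add: power2_eq_square)
    also have "\<dots> = 0" using pos j by simp
    finally have "w = (j / b) *\<^sub>R (\<i> * z)" by simp
    moreover have "inverse b = inverse (sqrt b) * inverse (sqrt b)"
      using pos by (simp flip: inverse_mult_distrib)
    ultimately have "t = f (z /\<^sub>R sqrt b)"
      using pos up by (simp add: t f_def divide_inverse)
    moreover have "norm (z /\<^sub>R sqrt b) = 1"
    proof -
      have "cmod z = sqrt b" using z by (metis real_sqrt_abs abs_norm_cancel)
      then show ?thesis using pos by simp
    qed
    ultimately show "t \<in> f ` circle" by auto
  qed
  ultimately have "circle homeomorphic ?E"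
    by (intro homeomorphic_compact[of circle f]) auto
  then show ?thesis using homeomorphic_sym by blast
qed

text \<open>Both images are the same quotient of K. The compact set of pairs (f x, g x) projects
  continuously and bijectively onto each of them, which avoids quotient topologies.\<close>

lemma homeomorphic_images_same_kernel:
  fixes f :: "'a::topological_space \<Rightarrow> 'b::t2_space" and g :: "'a \<Rightarrow> 'c::t2_space"
  assumes "compact K" "continuous_on K f" "continuous_on K g"
    and "\<And>x y. x \<in> K \<Longrightarrow> y \<in> K \<Longrightarrow> f x = f y \<longleftrightarrow> g x = g y"
  shows "f ` K homeomorphic g ` K"
proof -
  define \<Gamma> where "\<Gamma> = (\<lambda>x. (f x, g x)) ` K"
  have "compact \<Gamma>"
    unfolding \<Gamma>_def using assms by (intro compact_continuous_image continuous_on_Pair)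
  have im: "fst ` \<Gamma> = f ` K" "snd ` \<Gamma> = g ` K" by (simp_all add: \<Gamma>_def image_image)
  have inj: "inj_on fst \<Gamma>" "inj_on snd \<Gamma>"
    using assms(4) by (auto simp: \<Gamma>_def inj_on_def)
  have "\<Gamma> homeomorphic f ` K" "\<Gamma> homeomorphic g ` K"
    by (rule homeomorphic_compact[OF \<open>compact \<Gamma>\<close> _ im(1) inj(1)]
        homeomorphic_compact[OF \<open>compact \<Gamma>\<close> _ im(2) inj(2)], intro continuous_intros)+
  then show ?thesis
    by (meson homeomorphic_sym homeomorphic_trans)
qed

section \<open>The doubly pinched torus as a compact subset of C^2\<close>

text \<open>A circle bundle over the unit circle whose radius vanishes exactly at 1 and -1, the two
  pinch points.\<close>

definition pinched_torus_model :: "(complex \<times> complex) set" where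
  "pinched_torus_model = {(\<zeta>, \<omega>). norm \<zeta> = 1 \<and> norm \<omega> = \<bar>Im \<zeta>\<bar>}"

text \<open>Multiplying the second circle by \<open>Im \<zeta>\<close> performs the collapse. The
  points of X have to be sets, so the model is carried over to its singletons.\<close>

lemma pinched_torus_model:
  obtains X :: "(complex \<times> complex) set topology"
    where "doubly_pinched_torus X" "top_of_set pinched_torus_model homeomorphic_space X"
proof -
  let ?D = pinched_torus_model
  define A where "A = (\<lambda>d. {d}) ` ?D"
  define X where "X = pullback_topology A the_elem (top_of_set ?D)"
  have top: "topspace X = A"
    by (auto simp: X_def A_def topspace_pullback_topology)
  have hom: "homeomorphic_map (top_of_set ?D) X (\<lambda>d. {d})"
  proof -
    have "homeomorphic_maps (top_of_set ?D) X (\<lambda>d. {d}) the_elem"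
      unfolding homeomorphic_maps_def
    proof (intro conjI ballI)
      show "continuous_map (top_of_set ?D) X (\<lambda>d. {d})"
        unfolding X_def by (rule continuous_map_pullback') (auto simp: A_def o_def)
      show "continuous_map X (top_of_set ?D) the_elem"
        unfolding X_def using continuous_map_pullback[of "top_of_set ?D" "top_of_set ?D" id A the_elem] by simp
    qed (auto simp: top A_def)
    then show ?thesis by (rule homeomorphic_maps_map[THEN iffD1, THEN conjunct1])
  qed
  define p where "p = (\<lambda>(\<zeta>, \<eta>). (\<zeta>, complex_of_real (Im \<zeta>) * \<eta>))"
  have im: "p ` torus = ?D"
  proof (intro equalityI subsetI)
    fix t assume "t \<in> p ` torus"
    then show "t \<in> ?D" by (auto simp: p_def pinched_torus_model_def norm_mult)
  next
    fix t assume "t \<in> ?D"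
    then obtain \<zeta> \<omega> where t: "t = (\<zeta>, \<omega>)" "norm \<zeta> = 1" "norm \<omega> = \<bar>Im \<zeta>\<bar>"
      by (auto simp: pinched_torus_model_def)
    show "t \<in> p ` torus"
    proof (cases "Im \<zeta> = 0")
      case True
      then show ?thesis using t by (intro image_eqI[of _ _ "(\<zeta>, 1)"]) (auto simp: p_def)
    next
      case False
      then show ?thesis using t
        by (intro image_eqI[of _ _ "(\<zeta>, \<omega> / complex_of_real (Im \<zeta>))"]) (auto simp: p_def norm_divide)
    qed
  qed
  have "continuous_on torus p"
    unfolding p_def split_beta by (intro continuous_intros)
  then have "quotient_map (top_of_set torus) (top_of_set ?D) p"
    using im compact_Times[OF compact_sphere compact_sphere, of "0 :: complex" 1 "0 :: complex" 1]
    by (intro continuous_imp_quotient_map)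
      (auto simp: compact_space_subtopology Hausdorff_space_subtopology)
  then have q: "quotient_map (top_of_set torus) X ((\<lambda>d. {d}) \<circ> p)"
    by (rule quotient_map_compose) (use hom in \<open>simp add: homeomorphic_map_def\<close>)
  have real_unit: "Im \<zeta> = 0 \<longleftrightarrow> \<zeta> = 1 \<or> \<zeta> = -1" if "norm \<zeta> = 1" for \<zeta> :: complex
  proof
    assume "Im \<zeta> = 0"
    then have "\<bar>Re \<zeta>\<bar> = 1" using that by (simp add: cmod_eq_Re)
    then have "Re \<zeta> = 1 \<or> Re \<zeta> = -1" by linarith
    then show "\<zeta> = 1 \<or> \<zeta> = -1" using \<open>Im \<zeta> = 0\<close> by (simp add: complex_eq_iff)
  qed auto
  have kernel: "((\<lambda>d. {d}) \<circ> p) u = ((\<lambda>d. {d}) \<circ> p) v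
      \<longleftrightarrow> u = v \<or> (fst u = 1 \<and> fst v = 1) \<or> (fst u = -1 \<and> fst v = -1)"
    if "u \<in> torus" "v \<in> torus" for u v
  proof -
    obtain \<zeta> \<eta> \<zeta>' \<eta>' where uv: "u = (\<zeta>, \<eta>)" "v = (\<zeta>', \<eta>')" by (metis surj_pair)
    then have \<zeta>: "norm \<zeta> = 1" using that by simp
    have "((\<lambda>d. {d}) \<circ> p) u = ((\<lambda>d. {d}) \<circ> p) v \<longleftrightarrow> \<zeta> = \<zeta>' \<and> (Im \<zeta> = 0 \<or> \<eta> = \<eta>')"
      by (auto simp: uv p_def)
    also have "\<dots> \<longleftrightarrow> u = v \<or> (fst u = 1 \<and> fst v = 1) \<or> (fst u = -1 \<and> fst v = -1)"
      unfolding real_unit[OF \<zeta>] by (auto simp: uv)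
    finally show ?thesis .
  qed
  have "doubly_pinched_torus X"
    unfolding doubly_pinched_torus_def
  proof (rule bexI[of _ 1], rule bexI[of _ "-1"], intro conjI exI)
    show "quotient_map (top_of_set torus) X ((\<lambda>d. {d}) \<circ> p)" by (rule q)
    show "\<forall>u\<in>torus. \<forall>v\<in>torus. (((\<lambda>d. {d}) \<circ> p) u = ((\<lambda>d. {d}) \<circ> p) v) =
      (u = v \<or> fst u = 1 \<and> fst v = 1 \<or> fst u = - 1 \<and> fst v = - 1)"
      by (intro ballI kernel)
  qed simp_all
  then show ?thesis
    by (rule that[OF _ homeomorphic_map_imp_homeomorphic_space[OF hom]])
qed

subsection \<open>Twisting the circle by a contraction\<close>

lemma unit_circle_cis:
  assumes "norm (\<delta> :: complex) = 1"
  obtains d where "\<delta> = cis d"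
  using assms cis_Arg[of \<delta>] by (metis norm_zero sgn_div_norm inverse_1 scaleR_one zero_neq_one)

text \<open>On angles the twist is d + t m(cis d), the identity plus a strict contraction, so it is
  injective on the real line and commutes with shifts by 2 pi.\<close>

lemma twist_injective:
  fixes m :: "complex \<Rightarrow> real"
  assumes contr: "\<And>x y. x \<noteq> y \<Longrightarrow> \<bar>m (cis x) - m (cis y)\<bar> < \<bar>x - y\<bar>"
    and "\<bar>t\<bar> \<le> 1" "norm \<delta> = 1" "norm \<delta>' = 1"
    and eq: "\<delta> * cis (t * m \<delta>) = \<delta>' * cis (t * m \<delta>')"
  shows "\<delta> = \<delta>'"
proof -
  obtain d d' where d: "\<delta> = cis d" "\<delta>' = cis d'"
    using assms unit_circle_cis by metis
  have "cis (d + t * m \<delta>) = cis (d' + t * m \<delta>')"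
    using eq by (simp add: d cis_mult)
  then have "cis (d + t * m \<delta> - (d' + t * m \<delta>')) = 1"
    by (simp add: cis_divide[symmetric])
  then have "cos (d + t * m \<delta> - (d' + t * m \<delta>')) = 1"
    by (metis cis.simps(1) one_complex.simps(1))
  then obtain n :: int where "d + t * m \<delta> - (d' + t * m \<delta>') = n * (2 * pi)"
    unfolding cos_one_2pi_int by (auto simp: mult.assoc)
  then have n: "d + t * m (cis d) = (d' + n * (2 * pi)) + t * m (cis d')"
    by (simp add: d)
  \<comment> \<open>The second angle is replaced by the representative with exactly the same twisted
    angle.\<close>
  define d'' where "d'' = d' + n * (2 * pi)"
  have "cis (n * (2 * pi)) = 1"
    using cis_multiple_2pi[of "real_of_int n"] by (simp add: mult_ac)
  then have cis: "cis d'' = cis d'"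
    unfolding d''_def cis_mult[symmetric] by simp
  have "d = d''"
  proof (rule ccontr)
    assume "d \<noteq> d''"
    have "d - d'' = t * (m (cis d'') - m (cis d))"
      using n unfolding cis d''_def[symmetric] by (simp add: algebra_simps)
    then have "\<bar>d - d''\<bar> = \<bar>t\<bar> * \<bar>m (cis d'') - m (cis d)\<bar>" by (simp add: abs_mult)
    also have "\<dots> \<le> 1 * \<bar>m (cis d'') - m (cis d)\<bar>" using assms by (intro mult_right_mono) auto
    also have "\<dots> < \<bar>d - d''\<bar>" using contr[of d'' d] \<open>d \<noteq> d''\<close> by (simp add: abs_minus_commute)
    finally show False by simp
  qed
  then show ?thesis using cis d by simp
qed

text \<open>The twisted angle differs from d by at most B, so the intermediate value theorem applies
  on [x - B, x + B]. No contraction is required for this half.\<close>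

lemma twist_surjective:
  fixes m :: "complex \<Rightarrow> real"
  assumes cont: "continuous_on circle m" and bound: "\<And>\<delta>. norm \<delta> = 1 \<Longrightarrow> \<bar>m \<delta>\<bar> \<le> B"
    and t: "\<bar>t\<bar> \<le> 1" and \<phi>: "norm \<phi> = 1"
  obtains \<delta> where "norm \<delta> = 1" "\<delta> * cis (t * m \<delta>) = \<phi>"
proof -
  obtain x where x: "\<phi> = cis x" using \<phi> unit_circle_cis by metis
  define g where "g d = d + t * m (cis d)" for d
  have tm: "\<bar>t * m (cis d)\<bar> \<le> B" for d
  proof -
    have "\<bar>t * m (cis d)\<bar> \<le> 1 * \<bar>m (cis d)\<bar>" unfolding abs_mult using t by (intro mult_right_mono) auto
    then show ?thesis using bound[of "cis d"] by simp
  qed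
  have "continuous_on {x - B..x + B} (\<lambda>d. m (cis d))"
    by (rule continuous_on_compose2[OF cont]) (auto intro!: continuous_intros)
  then have "continuous_on {x - B..x + B} g"
    unfolding g_def by (intro continuous_intros)
  moreover have "g (x - B) \<le> x" "x \<le> g (x + B)"
    using tm[of "x - B"] tm[of "x + B"] by (auto simp: g_def abs_le_iff)
  moreover have "x - B \<le> x + B" using bound[of 1] by simp
  ultimately obtain d where "g d = x" using IVT'[of g "x - B" x "x + B"] by auto
  then show ?thesis using that[of "cis d"] by (simp add: g_def x cis_mult)
qed

subsection \<open>The fibre over the isolated singular value\<close>

text \<open>With \<open>A = a / (b - a)\<close>, \<open>C = c / (c - b)\<close>, a line touching the ellipsoid at a point of the fibre
  meets the focal hyperbola in the coordinate plane \<open>x\<^sub>1 = x\<^sub>2 = 0\<close>. In affine coordinates the polar of that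
  focal point has unit normal \<open>cis (\<plusminus> m)\<close>, where \<open>Re \<delta>\<close> is the signed distance of that polar from the origin and
  \<open>m = latitude A C \<delta>\<close>.\<close>

definition latitude :: "real \<Rightarrow> real \<Rightarrow> complex \<Rightarrow> real" where
  "latitude A C \<delta> = arccos ((C - A - 2 * (Re \<delta>)\<^sup>2) / (A + C)) / 2"

lemma latitude_argument_bounds:
  assumes "A > 0" "C > 1" "norm \<delta> = 1"
  shows "-1 < (C - A - 2 * (Re \<delta>)\<^sup>2) / (A + C)" "(C - A - 2 * (Re \<delta>)\<^sup>2) / (A + C) < 1"
proof -
  have "(Re \<delta>)\<^sup>2 + (Im \<delta>)\<^sup>2 = 1" using assms(3) by (simp add: cmod_power2[symmetric])
  then have "(Re \<delta>)\<^sup>2 \<le> 1" using zero_le_power2[of "Im \<delta>"] by linarith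
  moreover have "(Re \<delta>)\<^sup>2 \<ge> 0" by simp
  ultimately have "- (A + C) < C - A - 2 * (Re \<delta>)\<^sup>2" "C - A - 2 * (Re \<delta>)\<^sup>2 < A + C"
    using assms(1,2) by linarith+
  then show "-1 < (C - A - 2 * (Re \<delta>)\<^sup>2) / (A + C)" "(C - A - 2 * (Re \<delta>)\<^sup>2) / (A + C) < 1"
    using assms by (simp_all add: pos_less_divide_eq pos_divide_less_eq)
qed

text \<open>The last two claims are the half-angle formulas; they say that m solves the focal
  condition \<open>(Re \<delta>)\<^sup>2 + A * (cos m)\<^sup>2 = C * (sin m)\<^sup>2\<close>. The
  bounds are strict because A > 0 and C > 1.\<close>

lemma latitude_facts:
  assumes "A > 0" "C > 1" "norm \<delta> = 1"
  shows "0 < latitude A C \<delta>" "latitude A C \<delta> < pi / 2"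
    "sin (latitude A C \<delta>) > 0" "cos (latitude A C \<delta>) > 0"
    "(sin (latitude A C \<delta>))\<^sup>2 = (A + (Re \<delta>)\<^sup>2) / (A + C)"
    "(cos (latitude A C \<delta>))\<^sup>2 = (C - (Re \<delta>)\<^sup>2) / (A + C)"
proof -
  let ?m = "latitude A C \<delta>"
  note b = latitude_argument_bounds[OF assms]
  have "0 < arccos ((C - A - 2 * (Re \<delta>)\<^sup>2) / (A + C))" "arccos ((C - A - 2 * (Re \<delta>)\<^sup>2) / (A + C)) < pi"
    using arccos_lt_bounded[OF b] by auto
  then show m: "0 < ?m" "?m < pi / 2" by (simp_all add: latitude_def)
  then show "sin ?m > 0" "cos ?m > 0" by (simp_all add: sin_gt_zero cos_gt_zero)
  have c2: "cos (2 * ?m) = (C - A - 2 * (Re \<delta>)\<^sup>2) / (A + C)"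
    using b by (simp add: latitude_def)
  have AC: "A + C > 0" using assms by simp
  have "(sin ?m)\<^sup>2 = (1 - cos (2 * ?m)) / 2" unfolding cos_double_sin by simp
  also have "\<dots> = (A + (Re \<delta>)\<^sup>2) / (A + C)" unfolding c2 using AC by (simp add: field_simps)
  finally show "(sin ?m)\<^sup>2 = (A + (Re \<delta>)\<^sup>2) / (A + C)" .
  have "(cos ?m)\<^sup>2 = (1 + cos (2 * ?m)) / 2" unfolding cos_double_cos by simp
  also have "\<dots> = (C - (Re \<delta>)\<^sup>2) / (A + C)" unfolding c2 using AC by (simp add: field_simps)
  finally show "(cos ?m)\<^sup>2 = (C - (Re \<delta>)\<^sup>2) / (A + C)" .
qed

lemma continuous_on_latitude:
  assumes "A > 0" "C > 1"
  shows "continuous_on circle (latitude A C)"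
  unfolding latitude_def[abs_def] using assms latitude_argument_bounds[OF assms]
  by (intro continuous_intros) (auto intro: less_imp_le)

text \<open>With k = cos(d)^2 the squared derivative of the latitude is k (1 - k) / ((C - k) (A +
  k)), which is below 1; the mean value theorem gives the claim.\<close>

lemma latitude_contraction:
  assumes "A > 0" "C > 1" "x \<noteq> y"
  shows "\<bar>latitude A C (cis x) - latitude A C (cis y)\<bar> < \<bar>x - y\<bar>"
proof -
  define F where "F d = (C - A - 2 * (cos d)\<^sup>2) / (A + C)" for d
  define g where "g d = latitude A C (cis d)" for d
  define g' where "g' d = (4 * cos d * sin d / (A + C)) * inverse (- sqrt (1 - (F d)\<^sup>2)) / 2" for d
  have b: "-1 < F d" "F d < 1" for d
    using latitude_argument_bounds[OF assms(1,2), of "cis d"] by (simp_all add: F_def)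
  have g: "g d = arccos (F d) / 2" for d by (simp add: g_def latitude_def F_def)
  have dF: "(F has_real_derivative 4 * cos d * sin d / (A + C)) (at d)" for d
  proof -
    have "((\<lambda>d. (cos d)\<^sup>2) has_real_derivative - 2 * cos d * sin d) (at d)"
      using DERIV_power[OF DERIV_cos[of d], of 2] by (simp add: mult_ac)
    from DERIV_cdivide[OF DERIV_diff[OF DERIV_const[of "C - A"] DERIV_cmult[OF this, of 2]], of "A + C"]
    show ?thesis unfolding F_def[abs_def] by (simp add: mult.assoc)
  qed
  have dg: "(g has_real_derivative g' d) (at d)" for d
  proof -
    have "((\<lambda>d. arccos (F d) / 2) has_real_derivative g' d) (at d)"
      using DERIV_cdivide[OF DERIV_chain2[OF DERIV_arccos[OF b(1) b(2)] dF], of 2 d]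
      by (simp only: g'_def mult.commute)
    then show ?thesis using g by presburger
  qed
  have small: "\<bar>g' d\<bar> < 1" for d
  proof -
    define k where "k = (cos d)\<^sup>2"
    have k: "0 \<le> k" "k \<le> 1" "(sin d)\<^sup>2 = 1 - k"
      using abs_cos_le_one[of d] by (simp_all add: k_def sin_squared_eq abs_square_le_1)
    have AC: "A + C > 0" using assms by simp
    have "(A + C)\<^sup>2 * (1 - (F d)\<^sup>2) = (A + C)\<^sup>2 - (C - A - 2 * k)\<^sup>2"
      using AC by (simp add: F_def k_def power_divide right_diff_distrib)
    also have "\<dots> = 4 * ((C - k) * (A + k))" by algebra
    finally have 1: "(A + C)\<^sup>2 * (1 - (F d)\<^sup>2) = 4 * ((C - k) * (A + k))" .
    \<comment> \<open>The only use of A > 0 and C > 1 for the slope: each factor of the denominator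
      exceeds its counterpart.\<close>
    have "(1 - k) * k \<le> (1 - k) * (A + k)" using assms k by (intro mult_left_mono) auto
    also have "\<dots> < (C - k) * (A + k)" using assms k by (intro mult_strict_right_mono) auto
    finally have "(1 - k) * k < (C - k) * (A + k)" .
    moreover have "(2 * cos d * sin d)\<^sup>2 = 4 * ((1 - k) * k)"
      unfolding power_mult_distrib k(3) k_def[symmetric] by simp
    ultimately have "(2 * cos d * sin d)\<^sup>2 < (A + C)\<^sup>2 * (1 - (F d)\<^sup>2)"
      unfolding 1 by linarith
    moreover have "0 < (A + C)\<^sup>2 * (1 - (F d)\<^sup>2)"
      using calculation zero_le_power2[of "2 * cos d * sin d"] by linarith
    ultimately have 2: "(2 * cos d * sin d)\<^sup>2 / ((A + C)\<^sup>2 * (1 - (F d)\<^sup>2)) < 1"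
      by (simp only: divide_less_eq_1_pos)
    define D where "D = sqrt (1 - (F d)\<^sup>2)"
    have "(F d)\<^sup>2 < 1" using b[of d] by (simp add: abs_square_less_1 abs_less_iff)
    then have D: "D\<^sup>2 = 1 - (F d)\<^sup>2" by (simp add: D_def)
    have "4 * x / y * inverse (- z) / 2 = - (2 * x) / (y * z)" for x y z :: real
      by (simp add: inverse_eq_divide)
    from this[of "cos d * sin d" "A + C" D]
    have "g' d = - (2 * cos d * sin d) / ((A + C) * D)"
      unfolding g'_def D_def[symmetric] mult.assoc .
    then have "(g' d)\<^sup>2 = (2 * cos d * sin d)\<^sup>2 / ((A + C)\<^sup>2 * (1 - (F d)\<^sup>2))"
      unfolding D[symmetric] by (simp only: power_divide power_mult_distrib power2_minus)
    then have "(g' d)\<^sup>2 < 1" using 2 by simp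
    then show ?thesis by (simp only: abs_square_less_1)
  qed
  have lt: "\<bar>g v - g u\<bar> < v - u" if uv: "u < v" for u v
  proof -
    obtain z where z: "g v - g u = (v - u) * g' z"
      using MVT2[OF uv, of g g'] dg by blast
    have "\<bar>g v - g u\<bar> = (v - u) * \<bar>g' z\<bar>" using uv unfolding z abs_mult by simp
    also have "\<dots> < (v - u) * 1" using uv small by (intro mult_strict_left_mono) auto
    finally show ?thesis by simp
  qed
  have "\<bar>g x - g y\<bar> < \<bar>x - y\<bar>"
  proof (cases "x < y")
    case True
    then show ?thesis using lt[OF True] by linarith
  next
    case False
    then have "y < x" using assms(3) by simp
    then show ?thesis using lt[OF \<open>y < x\<close>] by linarith
  qed
  then show ?thesis by (simp add: g_def)
qed

text \<open>Points \<open>(\<xi>, Z, \<xi>', W)\<close> are affine coordinates on the fibre: \<open>\<xi>\<close> and \<open>Z\<close> are the components of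
  the position in the planes \<open>x\<^sub>0 x\<^sub>3\<close> and \<open>x\<^sub>1 x\<^sub>2\<close> after scaling the ellipsoid to the unit sphere,
  \<open>\<xi>'\<close> and \<open>W\<close> those of the direction of the velocity.\<close>

definition pinched_level :: "real \<Rightarrow> real \<Rightarrow> (complex \<times> complex \<times> complex \<times> complex) set" where
  "pinched_level A C = {(\<xi>, Z, \<xi>', W). (cmod \<xi>)\<^sup>2 + (cmod Z)\<^sup>2 = 1 \<and> (cmod \<xi>')\<^sup>2 + (cmod W)\<^sup>2 = 1
     \<and> Re (cnj \<xi> * \<xi>') + Re (cnj Z * W) = 0 \<and> Im (cnj Z * W) = 0
     \<and> (cmod W)\<^sup>2 + A * (cmod (Re \<xi> *\<^sub>R W - Re \<xi>' *\<^sub>R Z))\<^sup>2 = C * (cmod (Im \<xi> *\<^sub>R W - Im \<xi>' *\<^sub>R Z))\<^sup>2}"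

definition pinched_params :: "(complex \<times> real \<times> real \<times> complex) set" where
  "pinched_params = sphere 0 1 \<times> {1, -1} \<times> sphere 0 1"

text \<open>The great circle through position and velocity meets the circle \<open>Z = 0\<close> in the point \<open>cis (\<epsilon> m)\<close>,
  and \<open>\<delta>\<close> is the phase along the great circle measured from there; \<open>(\<mu>, \<nu>)\<close> is the unit tangent vector
  in that point.\<close>

definition pinched_chart :: "real \<Rightarrow> real \<Rightarrow> complex \<times> real \<times> real \<times> complex \<Rightarrow> complex \<times> complex \<times> complex \<times> complex" where
  "pinched_chart A C = (\<lambda>(\<delta>, \<epsilon>, \<mu>, \<nu>).
     (cis (\<epsilon> * latitude A C \<delta>) * (of_real (Re \<delta>) + \<i> * of_real (\<mu> * Im \<delta>)), Im \<delta> *\<^sub>R \<nu>,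
      cis (\<epsilon> * latitude A C \<delta>) * (of_real (- Im \<delta>) + \<i> * of_real (\<mu> * Re \<delta>)), Re \<delta> *\<^sub>R \<nu>))"

text \<open>The second component joins the meridians of the two copies (\<epsilon> = 1 and
  \<epsilon> = -1) at \<mu> = 1 and \<mu> = -1 into a circle, with \<nu> on a circle of radius equal
  to the modulus of its imaginary part. At a pole (\<nu> = 0) the chart sees only the angle of
  \<xi>, which is that of \<open>\<delta> * cis (\<epsilon> * \<mu> * latitude A C \<delta>)\<close>
  up to conjugation; using the same formula for all \<mu> between -1 and 1 extends this angle over
  the spheres.\<close>

definition pinched_collapse :: "real \<Rightarrow> real \<Rightarrow> complex \<times> real \<times> real \<times> complex \<Rightarrow> complex \<times> complex \<times> complex" where
  "pinched_collapse A C = (\<lambda>(\<delta>, \<epsilon>, \<mu>, \<nu>).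
     (\<delta> * cis (\<epsilon> * \<mu> * latitude A C \<delta>), of_real \<mu> + \<i> * of_real (\<epsilon> * norm \<nu>), \<nu>))"

lemma pinched_params_iff:
  "(\<delta>, \<epsilon>, \<mu>, \<nu>) \<in> pinched_params \<longleftrightarrow> norm \<delta> = 1 \<and> \<epsilon> \<in> {1, -1} \<and> \<mu>\<^sup>2 + (cmod \<nu>)\<^sup>2 = 1"
  by (auto simp: pinched_params_def norm_Pair)

lemma compact_pinched_params: "compact pinched_params"
  unfolding pinched_params_def by (intro compact_Times compact_sphere) auto

lemma continuous_on_latitude_fst:
  assumes "A > 0" "C > 1"
  shows "continuous_on pinched_params (\<lambda>t. latitude A C (fst t))"
  by (rule continuous_on_compose2[OF continuous_on_latitude[OF assms]])
    (auto simp: pinched_params_def intro!: continuous_intros)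

lemma continuous_on_pinched_chart:
  assumes "A > 0" "C > 1"
  shows "continuous_on pinched_params (pinched_chart A C)"
  unfolding pinched_chart_def split_beta
  by (intro continuous_intros continuous_on_latitude_fst assms)

lemma continuous_on_pinched_collapse:
  assumes "A > 0" "C > 1"
  shows "continuous_on pinched_params (pinched_collapse A C)"
  unfolding pinched_collapse_def split_beta
  by (intro continuous_intros continuous_on_latitude_fst assms)

lemma pinched_params_bounds:
  assumes "(\<delta>, \<epsilon>, \<mu>, \<nu>) \<in> pinched_params"
  shows "\<bar>\<epsilon> * \<mu>\<bar> \<le> 1" "\<epsilon>\<^sup>2 = 1" "(Re \<delta>)\<^sup>2 + (Im \<delta>)\<^sup>2 = 1"
proof -
  have *: "norm \<delta> = 1" "\<epsilon> \<in> {1, -1}" "\<mu>\<^sup>2 + (cmod \<nu>)\<^sup>2 = 1"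
    using assms by (simp_all add: pinched_params_iff)
  have "\<mu>\<^sup>2 \<le> 1" using *(3) zero_le_power2[of "cmod \<nu>"] by linarith
  then have "\<bar>\<mu>\<bar> \<le> 1" by (simp add: abs_square_le_1)
  then show "\<bar>\<epsilon> * \<mu>\<bar> \<le> 1" using *(2) by auto
  show "\<epsilon>\<^sup>2 = 1" using *(2) by auto
  show "(Re \<delta>)\<^sup>2 + (Im \<delta>)\<^sup>2 = 1" using *(1) by (simp add: cmod_power2[symmetric])
qed

lemma pinched_collapse_image:
  assumes "A > 0" "C > 1"
  shows "pinched_collapse A C ` pinched_params = circle \<times> pinched_torus_model"
proof (intro equalityI subsetI)
  fix t assume "t \<in> pinched_collapse A C ` pinched_params"
  then obtain \<delta> \<epsilon> \<mu> \<nu> where t: "t = pinched_collapse A C (\<delta>, \<epsilon>, \<mu>, \<nu>)" and p: "(\<delta>, \<epsilon>, \<mu>, \<nu>) \<in> pinched_params"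
    by auto
  note b = pinched_params_bounds[OF p]
  have "(cmod (of_real \<mu> + \<i> * of_real (\<epsilon> * norm \<nu>)))\<^sup>2 = 1"
    using p b by (simp add: cmod_power2 power_mult_distrib pinched_params_iff)
  then have "cmod (of_real \<mu> + \<i> * of_real (\<epsilon> * norm \<nu>)) = 1"
    unfolding abs_square_eq_1 by simp
  moreover have "\<bar>\<epsilon> * norm \<nu>\<bar> = norm \<nu>" using p by (auto simp: pinched_params_iff)
  ultimately show "t \<in> circle \<times> pinched_torus_model"
    using p by (simp add: t pinched_collapse_def pinched_torus_model_def norm_mult pinched_params_iff)
next
  fix t assume "t \<in> circle \<times> pinched_torus_model"
  then obtain \<phi> \<zeta> \<omega> where t: "t = (\<phi>, \<zeta>, \<omega>)" "norm \<phi> = 1" "norm \<zeta> = 1" "norm \<omega> = \<bar>Im \<zeta>\<bar>"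
    by (auto simp: pinched_torus_model_def)
  define \<epsilon> :: real where "\<epsilon> = (if Im \<zeta> \<ge> 0 then 1 else -1)"
  have "(Re \<zeta>)\<^sup>2 + (Im \<zeta>)\<^sup>2 = 1" using t(3) by (simp add: cmod_power2[symmetric])
  then have p: "(\<delta>, \<epsilon>, Re \<zeta>, \<omega>) \<in> pinched_params" if "norm \<delta> = 1" for \<delta>
    using that t(4) by (simp add: pinched_params_iff \<epsilon>_def)
  have bound: "\<bar>latitude A C \<delta>\<bar> \<le> pi / 2" if "norm \<delta> = 1" for \<delta>
    using latitude_facts(1,2)[OF assms that] by simp
  obtain \<delta> where \<delta>: "norm \<delta> = 1" "\<delta> * cis (\<epsilon> * Re \<zeta> * latitude A C \<delta>) = \<phi>"
    by (rule twist_surjective[OF continuous_on_latitude[OF assms] bound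
          pinched_params_bounds(1)[OF p[OF norm_one]] t(2)])
  have "pinched_collapse A C (\<delta>, \<epsilon>, Re \<zeta>, \<omega>) = t"
    by (simp add: pinched_collapse_def \<delta>(2) t(1,4) complex_eq_iff) (simp add: \<epsilon>_def)
  then show "t \<in> pinched_collapse A C ` pinched_params"
    using p[OF \<delta>(1)] by force
qed

lemma cnj_cis_mult: "cnj (cis t * x) * (cis t * y) = cnj x * y"
proof -
  have 1: "cnj (cis t) * cis t = 1" by (simp add: cis_cnj cis_mult)
  have "cnj (cis t * x) * (cis t * y) = (cnj (cis t) * cis t) * (cnj x * y)" by (simp only: complex_cnj_mult mult_ac)
  then show ?thesis unfolding 1 by simp
qed

lemma cnj_scaleR_mult: "cnj (s *\<^sub>R \<nu>) * (k *\<^sub>R \<nu>) = of_real (k * s * (cmod \<nu>)\<^sup>2)"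
  unfolding cmod_power2 complex_eq_iff by (simp add: power2_eq_square algebra_simps)

text \<open>Position and direction are orthonormal in the plane of the great circle. Rotating this
  pair back by \<delta> gives the crossing point, which has no Z-component, and the unit tangent
  vector there.\<close>

lemma pinched_chart_rotate_back:
  assumes "(\<delta>, \<epsilon>, \<mu>, \<nu>) \<in> pinched_params" and ch: "pinched_chart A C (\<delta>, \<epsilon>, \<mu>, \<nu>) = (\<xi>, Z, \<xi>', W)"
  shows "of_real (Re \<delta>) * \<xi> - of_real (Im \<delta>) * \<xi>' = cis (\<epsilon> * latitude A C \<delta>)"
    "of_real (Im \<delta>) * \<xi> + of_real (Re \<delta>) * \<xi>' = \<i> * of_real \<mu> * cis (\<epsilon> * latitude A C \<delta>)"
    "Z = Im \<delta> *\<^sub>R \<nu>" "W = Re \<delta> *\<^sub>R \<nu>" "(cmod \<nu>)\<^sup>2 = (cmod Z)\<^sup>2 + (cmod W)\<^sup>2"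
proof -
  define k s where "k = Re \<delta>" and "s = Im \<delta>"
  define E where "E = cis (\<epsilon> * latitude A C \<delta>)"
  have ks: "k\<^sup>2 + s\<^sup>2 = 1" using pinched_params_bounds(3)[OF assms(1)] by (simp add: k_def s_def)
  have eq: "\<xi> = E * (of_real k + \<i> * of_real (\<mu> * s))" "Z = s *\<^sub>R \<nu>"
    "\<xi>' = E * (of_real (- s) + \<i> * of_real (\<mu> * k))" "W = k *\<^sub>R \<nu>"
    using ch by (auto simp: pinched_chart_def k_def s_def E_def)
  have "of_real k * \<xi> - of_real s * \<xi>' = E * of_real (k\<^sup>2 + s\<^sup>2)"
    unfolding eq by (simp add: algebra_simps power2_eq_square)
  then show "of_real (Re \<delta>) * \<xi> - of_real (Im \<delta>) * \<xi>' = cis (\<epsilon> * latitude A C \<delta>)"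
    unfolding ks by (simp add: k_def s_def E_def)
  have "of_real s * \<xi> + of_real k * \<xi>' = \<i> * of_real \<mu> * E * of_real (k\<^sup>2 + s\<^sup>2)"
    unfolding eq by (simp add: algebra_simps power2_eq_square)
  then show "of_real (Im \<delta>) * \<xi> + of_real (Re \<delta>) * \<xi>' = \<i> * of_real \<mu> * cis (\<epsilon> * latitude A C \<delta>)"
    unfolding ks by (simp add: k_def s_def E_def)
  show "Z = Im \<delta> *\<^sub>R \<nu>" "W = Re \<delta> *\<^sub>R \<nu>" using eq by (simp_all add: k_def s_def)
  have "(cmod Z)\<^sup>2 + (cmod W)\<^sup>2 = (k\<^sup>2 + s\<^sup>2) * (cmod \<nu>)\<^sup>2"
    unfolding eq by (simp add: power_mult_distrib algebra_simps)
  then show "(cmod \<nu>)\<^sup>2 = (cmod Z)\<^sup>2 + (cmod W)\<^sup>2" using ks by simp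
qed

lemma pinched_chart_in_level:
  assumes AC: "A > 0" "C > 1" and p: "(\<delta>, \<epsilon>, \<mu>, \<nu>) \<in> pinched_params"
  shows "pinched_chart A C (\<delta>, \<epsilon>, \<mu>, \<nu>) \<in> pinched_level A C"
proof -
  obtain \<xi> Z \<xi>' W where ch: "pinched_chart A C (\<delta>, \<epsilon>, \<mu>, \<nu>) = (\<xi>, Z, \<xi>', W)"
    by (cases "pinched_chart A C (\<delta>, \<epsilon>, \<mu>, \<nu>)") auto
  define k s m where "k = Re \<delta>" and "s = Im \<delta>" and "m = latitude A C \<delta>"
  have \<delta>: "norm \<delta> = 1" and \<epsilon>: "\<epsilon> \<in> {1, -1}" and \<mu>\<nu>: "\<mu>\<^sup>2 + (cmod \<nu>)\<^sup>2 = 1"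
    using p by (simp_all add: pinched_params_iff)
  have ks: "k\<^sup>2 + s\<^sup>2 = 1" using pinched_params_bounds(3)[OF p] by (simp add: k_def s_def)
  have \<nu>2: "(cmod \<nu>)\<^sup>2 = 1 - \<mu>\<^sup>2" using \<mu>\<nu> by linarith
  have eq: "\<xi> = cis (\<epsilon> * m) * (of_real k + \<i> * of_real (\<mu> * s))" "Z = s *\<^sub>R \<nu>"
    "\<xi>' = cis (\<epsilon> * m) * (of_real (- s) + \<i> * of_real (\<mu> * k))" "W = k *\<^sub>R \<nu>"
    using ch by (auto simp: pinched_chart_def k_def s_def m_def)
  note bk = pinched_chart_rotate_back[OF p ch, folded k_def s_def m_def]
  have "(cmod \<xi>)\<^sup>2 = k\<^sup>2 + \<mu>\<^sup>2 * s\<^sup>2" "(cmod \<xi>')\<^sup>2 = s\<^sup>2 + \<mu>\<^sup>2 * k\<^sup>2"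
    unfolding eq norm_mult norm_cis by (simp_all add: cmod_power2 power_mult_distrib)
  moreover have "(cmod Z)\<^sup>2 = s\<^sup>2 * (1 - \<mu>\<^sup>2)" "(cmod W)\<^sup>2 = k\<^sup>2 * (1 - \<mu>\<^sup>2)"
    unfolding eq by (simp_all add: power_mult_distrib \<nu>2)
  ultimately have 1: "(cmod \<xi>)\<^sup>2 + (cmod Z)\<^sup>2 = 1" "(cmod \<xi>')\<^sup>2 + (cmod W)\<^sup>2 = 1"
    using ks by (simp_all add: algebra_simps)
  have d: "Re (cnj \<xi> * \<xi>') = - (k * s) + \<mu>\<^sup>2 * (k * s)"
    unfolding eq cnj_cis_mult by (simp add: power2_eq_square)
  have ZW: "cnj Z * W = of_real (k * s * (cmod \<nu>)\<^sup>2)"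
    unfolding eq by (rule cnj_scaleR_mult)
  have 2: "Re (cnj \<xi> * \<xi>') + Re (cnj Z * W) = 0" "Im (cnj Z * W) = 0"
    unfolding ZW d \<nu>2 by (simp_all add: algebra_simps del: of_real_mult)
  \<comment> \<open>The minors are unchanged by rotating the pair back, so they reduce to the
    coordinates of the crossing point times \<nu>, and the last equation of the level becomes the
    focal condition.\<close>
  have "Re \<xi> *\<^sub>R W - Re \<xi>' *\<^sub>R Z = Re (of_real k * \<xi> - of_real s * \<xi>') *\<^sub>R \<nu>"
    "Im \<xi> *\<^sub>R W - Im \<xi>' *\<^sub>R Z = Im (of_real k * \<xi> - of_real s * \<xi>') *\<^sub>R \<nu>"
    unfolding bk(3,4) by (simp_all add: scaleR_diff_left mult.commute)
  then have XY: "Re \<xi> *\<^sub>R W - Re \<xi>' *\<^sub>R Z = cos m *\<^sub>R \<nu>" "Im \<xi> *\<^sub>R W - Im \<xi>' *\<^sub>R Z = (\<epsilon> * sin m) *\<^sub>R \<nu>"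
    unfolding bk(1) using \<epsilon> by auto
  note lat = latitude_facts(5,6)[OF AC \<delta>, folded k_def m_def]
  have "k\<^sup>2 + A * (cos m)\<^sup>2 = C * (sin m)\<^sup>2"
    unfolding lat using AC by (simp add: field_simps)
  then have "(cmod W)\<^sup>2 + A * (cmod (Re \<xi> *\<^sub>R W - Re \<xi>' *\<^sub>R Z))\<^sup>2 = C * (cmod (Im \<xi> *\<^sub>R W - Im \<xi>' *\<^sub>R Z))\<^sup>2"
    unfolding XY unfolding eq(4) using \<epsilon> by (auto simp: power_mult_distrib simp flip: distrib_right mult.assoc)
  then show ?thesis using 1 2 by (simp add: ch pinched_level_def)
qed

text \<open>Inverts the chart away from the poles. Z and W determine \<nu> and (k, s) up to a common
  sign; the condition on the real part of the crossing point selects the sign.\<close>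

lemma pinched_level_chart_aux:
  assumes AC: "A > 0" "C > 1" and L: "(\<xi>, Z, \<xi>', W) \<in> pinched_level A C"
    and Z: "Z = s *\<^sub>R \<nu>" "W = k *\<^sub>R \<nu>" and \<nu>: "\<nu> \<noteq> 0" and ks: "k\<^sup>2 + s\<^sup>2 = 1"
    and pos: "Re (of_real k * \<xi> - of_real s * \<xi>') > 0"
  shows "(\<xi>, Z, \<xi>', W) \<in> pinched_chart A C ` pinched_params"
proof -
  have l: "(cmod \<xi>)\<^sup>2 + (cmod Z)\<^sup>2 = 1" "(cmod \<xi>')\<^sup>2 + (cmod W)\<^sup>2 = 1"
     "Re (cnj \<xi> * \<xi>') + Re (cnj Z * W) = 0"
     "(cmod W)\<^sup>2 + A * (cmod (Re \<xi> *\<^sub>R W - Re \<xi>' *\<^sub>R Z))\<^sup>2 = C * (cmod (Im \<xi> *\<^sub>R W - Im \<xi>' *\<^sub>R Z))\<^sup>2"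
    using L by (simp_all add: pinched_level_def)
  \<comment> \<open>The plane parts of crossing point and tangent vector, as in
    \<open>pinched_chart_rotate_back\<close>. The level equations make e a unit vector orthogonal to
    g.\<close>
  define e g where "e = of_real k * \<xi> - of_real s * \<xi>'" and "g = of_real s * \<xi> + of_real k * \<xi>'"
  have \<xi>: "\<xi> = of_real k * e + of_real s * g" "\<xi>' = of_real k * g - of_real s * e"
  proof -
    have "of_real k * e + of_real s * g = of_real (k\<^sup>2 + s\<^sup>2) * \<xi>" "of_real k * g - of_real s * e = of_real (k\<^sup>2 + s\<^sup>2) * \<xi>'"
      by (simp_all add: e_def g_def algebra_simps power2_eq_square)
    then show "\<xi> = of_real k * e + of_real s * g" "\<xi>' = of_real k * g - of_real s * e" using ks by simp_all
  qed
  define n where "n = (cmod \<nu>)\<^sup>2"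
  have n: "n > 0" using \<nu> by (simp add: n_def)
  have Z2: "(cmod Z)\<^sup>2 = s\<^sup>2 * n" "(cmod W)\<^sup>2 = k\<^sup>2 * n" by (simp_all add: Z power_mult_distrib n_def)
  have "cnj Z * W = of_real (k * s * n)"
    unfolding Z n_def by (rule cnj_scaleR_mult)
  then have ZW: "Re (cnj Z * W) = k * s * n" by simp
  define x y d where "x = (cmod \<xi>)\<^sup>2" and "y = (cmod \<xi>')\<^sup>2" and "d = Re (cnj \<xi> * \<xi>')"
  have l': "x + s\<^sup>2 * n = 1" "y + k\<^sup>2 * n = 1" "d + k * s * n = 0"
    using l(1-3) unfolding Z2 ZW x_def y_def d_def by simp_all
  have "(cmod e)\<^sup>2 = k\<^sup>2 * x + s\<^sup>2 * y - 2 * (k * s) * d"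
    unfolding e_def x_def y_def d_def cmod_power2 by (simp add: power2_eq_square algebra_simps)
  also have "\<dots> = 1" using l' ks by algebra
  finally have e1: "(cmod e)\<^sup>2 = 1" .
  have "(cmod g)\<^sup>2 = s\<^sup>2 * x + k\<^sup>2 * y + 2 * (k * s) * d"
    unfolding g_def x_def y_def d_def cmod_power2 by (simp add: power2_eq_square algebra_simps)
  also have "\<dots> = 1 - n" using l' ks by algebra
  finally have g1: "(cmod g)\<^sup>2 = 1 - n" .
  have "Re (cnj e * g) = k * s * (x - y) + (k\<^sup>2 - s\<^sup>2) * d"
    unfolding e_def g_def x_def y_def d_def cmod_power2 by (simp add: power2_eq_square algebra_simps)
  also have "\<dots> = 0" using l' ks by algebra
  finally have eg: "Re (cnj e * g) = 0" .
  define \<mu> where "\<mu> = Im (cnj e * g)"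
  have "cnj e * g = \<i> * of_real \<mu>" using eg by (simp add: complex_eq_iff \<mu>_def)
  then have "e * (cnj e * g) = e * (\<i> * of_real \<mu>)" by simp
  moreover have "e * cnj e = 1" using e1 complex_norm_square[of e] by simp
  ultimately have g: "g = e * (\<i> * of_real \<mu>)" by (metis mult.assoc mult_1)
  have "(cmod g)\<^sup>2 = \<mu>\<^sup>2" unfolding g using e1 by (simp add: norm_mult power_mult_distrib)
  then have \<mu>: "\<mu>\<^sup>2 + (cmod \<nu>)\<^sup>2 = 1" using g1 by (simp add: n_def)
  have "Re \<xi> *\<^sub>R W - Re \<xi>' *\<^sub>R Z = Re e *\<^sub>R \<nu>" "Im \<xi> *\<^sub>R W - Im \<xi>' *\<^sub>R Z = Im e *\<^sub>R \<nu>"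
    unfolding Z e_def by (simp_all add: scaleR_diff_left mult.commute)
  then have "(k\<^sup>2 + A * (Re e)\<^sup>2) * n = C * (Im e)\<^sup>2 * n"
    using l(4) unfolding Z2 by (simp add: power_mult_distrib n_def algebra_simps)
  then have foc: "k\<^sup>2 + A * (Re e)\<^sup>2 = C * (Im e)\<^sup>2" using n by simp
  have e2: "(Re e)\<^sup>2 + (Im e)\<^sup>2 = 1" using e1 by (simp add: cmod_power2)
  define \<delta> where "\<delta> = Complex k s"
  have \<delta>: "norm \<delta> = 1" "Re \<delta> = k" "Im \<delta> = s" using ks by (simp_all add: \<delta>_def cmod_def)
  define m where "m = latitude A C \<delta>"
  note lat = latitude_facts[OF AC \<delta>(1), folded m_def]
  \<comment> \<open>Together with |e| = 1 the focal condition fixes both squares; the sign of Im e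
    is the reflection left open and becomes \<epsilon>.\<close>
  have Im2: "(A + C) * (Im e)\<^sup>2 = A + k\<^sup>2" using foc e2 by algebra
  have "(Im e)\<^sup>2 = (sin m)\<^sup>2" unfolding lat \<delta>(2) using Im2 AC by (simp add: field_simps)
  moreover have "(Re e)\<^sup>2 = (cos m)\<^sup>2" using calculation e2 by (simp add: cos_squared_eq)
  ultimately have "Re e = cos m" "\<bar>Im e\<bar> = sin m"
    using lat(3,4) pos unfolding e_def[symmetric] by (simp_all add: power2_eq_iff) (auto simp: abs_if)
  define \<epsilon> :: real where "\<epsilon> = (if Im e \<ge> 0 then 1 else -1)"
  have "e = cis (\<epsilon> * m)"
    using \<open>Re e = cos m\<close> \<open>\<bar>Im e\<bar> = sin m\<close> by (auto simp: complex_eq_iff \<epsilon>_def)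
  then have "pinched_chart A C (\<delta>, \<epsilon>, \<mu>, \<nu>) = (\<xi>, Z, \<xi>', W)"
    unfolding \<xi> g Z by (simp add: pinched_chart_def \<delta> m_def[symmetric] algebra_simps)
  moreover have "(\<delta>, \<epsilon>, \<mu>, \<nu>) \<in> pinched_params"
    using \<delta>(1) \<mu> by (simp add: pinched_params_iff \<epsilon>_def)
  ultimately show ?thesis by force
qed

lemma real_collinear:
  fixes Z W :: complex
  assumes "Im (cnj Z * W) = 0" "(Z, W) \<noteq> (0, 0)"
  obtains k s \<nu> where "Z = s *\<^sub>R \<nu>" "W = k *\<^sub>R \<nu>" "\<nu> \<noteq> 0" "k\<^sup>2 + s\<^sup>2 = (1 :: real)"
proof -
  have "\<exists>s k \<nu>. Z = s *\<^sub>R \<nu> \<and> W = k *\<^sub>R \<nu> \<and> \<nu> \<noteq> 0 \<and> (s, k) \<noteq> (0 :: real, 0)"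
  proof (cases "Z = 0")
    case True
    then show ?thesis using assms(2) by (intro exI[of _ 0] exI[of _ 1] exI[of _ W]) auto
  next
    case False
    define t where "t = Re (cnj Z * W)"
    have "cnj Z * W = of_real t" using assms(1) by (simp add: complex_eq_iff t_def)
    then have "Z * cnj Z * W = t *\<^sub>R Z" by (simp add: scaleR_conv_of_real mult_ac)
    then have "(cmod Z)\<^sup>2 *\<^sub>R W = t *\<^sub>R Z" using complex_norm_square[of Z] by (simp add: scaleR_conv_of_real)
    moreover have "W = inverse ((cmod Z)\<^sup>2) *\<^sub>R ((cmod Z)\<^sup>2 *\<^sub>R W)" using False by simp
    ultimately have "W = (t / (cmod Z)\<^sup>2) *\<^sub>R Z"
      by (simp only: scaleR_scaleR divide_inverse mult.commute)
    then show ?thesis using False by (intro exI[of _ 1] exI[of _ "t / (cmod Z)\<^sup>2"] exI[of _ Z]) auto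
  qed
  then obtain s k \<nu> where 1: "Z = s *\<^sub>R \<nu>" "W = k *\<^sub>R \<nu>" "\<nu> \<noteq> 0" "(s, k) \<noteq> (0 :: real, 0)" by blast
  define r where "r = sqrt (k\<^sup>2 + s\<^sup>2)"
  have r: "r > 0" "r\<^sup>2 = k\<^sup>2 + s\<^sup>2"
    using 1(4) by (auto simp: r_def sum_power2_gt_zero_iff)
  show ?thesis
  proof (rule that[of "s / r" "r *\<^sub>R \<nu>" "k / r"])
    have "(k\<^sup>2 + s\<^sup>2) / r\<^sup>2 = 1" unfolding r(2)[symmetric] using r(1) by simp
    then show "(k / r)\<^sup>2 + (s / r)\<^sup>2 = 1" by (simp add: power_divide add_divide_distrib)
  qed (use 1 r in auto)
qed

text \<open>If Z = W = 0 the great circle is the circle Z = 0 and every point of it is a crossing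
  point; \<delta> then comes from solving the twisted equation. Otherwise Z and W lie on a real
  line, and the sign in \<open>pinched_level_chart_aux\<close> can be arranged.\<close>

lemma pinched_level_chart:
  assumes AC: "A > 0" "C > 1" and L: "(\<xi>, Z, \<xi>', W) \<in> pinched_level A C"
  shows "(\<xi>, Z, \<xi>', W) \<in> pinched_chart A C ` pinched_params"
proof (cases "(Z, W) = (0, 0)")
  case True
  then have l: "(cmod \<xi>)\<^sup>2 = 1" "(cmod \<xi>')\<^sup>2 = 1" "Re (cnj \<xi> * \<xi>') = 0"
    using L by (simp_all add: pinched_level_def)
  define \<mu> where "\<mu> = Im (cnj \<xi> * \<xi>')"
  have "cnj \<xi> * \<xi>' = \<i> * of_real \<mu>" using l(3) by (simp add: complex_eq_iff \<mu>_def)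
  then have "\<xi> * (cnj \<xi> * \<xi>') = \<xi> * (\<i> * of_real \<mu>)" by simp
  moreover have "\<xi> * cnj \<xi> = 1" using l(1) complex_norm_square[of \<xi>] by simp
  ultimately have \<xi>': "\<xi>' = \<xi> * (\<i> * of_real \<mu>)" by (metis mult.assoc mult_1)
  have \<mu>2: "\<mu>\<^sup>2 = 1" using l unfolding \<xi>' by (simp add: norm_mult power_mult_distrib)
  then have \<mu>: "\<mu> = 1 \<or> \<mu> = -1" by (simp add: power2_eq_1_iff)
  define \<phi> where "\<phi> = (if \<mu> = 1 then \<xi> else cnj \<xi>)"
  have "norm \<phi> = 1"
    using l(1) norm_ge_zero[of \<xi>] by (auto simp: \<phi>_def power2_eq_1_iff)
  have bound: "\<bar>latitude A C \<delta>\<bar> \<le> pi / 2" if "norm \<delta> = 1" for \<delta>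
    using latitude_facts(1,2)[OF AC that] by simp
  have "\<bar>\<mu>\<bar> \<le> 1" using \<mu> by auto
  \<comment> \<open>Taking \<epsilon> = 1, the phase must agree with \<xi>, or with its conjugate
    for \<mu> = -1, after the shift by the latitude that itself depends on \<delta>.\<close>
  obtain \<delta> where \<delta>: "norm \<delta> = 1" "\<delta> * cis (\<mu> * latitude A C \<delta>) = \<phi>"
    by (rule twist_surjective[OF continuous_on_latitude[OF AC] bound \<open>\<bar>\<mu>\<bar> \<le> 1\<close> \<open>norm \<phi> = 1\<close>])
  have p: "(\<delta>, 1, \<mu>, 0) \<in> pinched_params" using \<delta>(1) \<mu>2 by (simp add: pinched_params_iff)
  have \<xi>: "\<xi> = cis (latitude A C \<delta>) * (of_real (Re \<delta>) + \<i> * of_real (\<mu> * Im \<delta>))"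
  proof (cases "\<mu> = 1")
    case True
    then show ?thesis using \<delta>(2) complex_eq[of \<delta>] by (simp add: \<phi>_def mult.commute)
  next
    case False
    then have "\<mu> = -1" using \<mu> by simp
    then have "\<xi> = cnj (\<delta> * cis (- latitude A C \<delta>))" using \<delta>(2) by (simp add: \<phi>_def)
    also have "\<dots> = cis (latitude A C \<delta>) * cnj \<delta>" by (simp add: cis_cnj)
    also have "cnj \<delta> = of_real (Re \<delta>) + \<i> * of_real (\<mu> * Im \<delta>)"
      using \<open>\<mu> = -1\<close> by (simp add: complex_eq_iff)
    finally show ?thesis .
  qed
  have "(of_real (Re \<delta>) + \<i> * of_real (\<mu> * Im \<delta>)) * (\<i> * of_real \<mu>) = of_real (- Im \<delta>) + \<i> * of_real (\<mu> * Re \<delta>)"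
    using \<mu> by (auto simp: complex_eq_iff)
  then have "\<xi>' = cis (latitude A C \<delta>) * (of_real (- Im \<delta>) + \<i> * of_real (\<mu> * Re \<delta>))"
    unfolding \<xi>' \<xi> by (simp only: mult.assoc)
  then have "pinched_chart A C (\<delta>, 1, \<mu>, 0) = (\<xi>, Z, \<xi>', W)"
    using \<xi> True by (simp add: pinched_chart_def)
  then show ?thesis using p by force
next
  case False
  have "Im (cnj Z * W) = 0" using L by (simp add: pinched_level_def)
  then obtain k s \<nu> where Z: "Z = s *\<^sub>R \<nu>" "W = k *\<^sub>R \<nu>" and \<nu>: "\<nu> \<noteq> 0" and ks: "k\<^sup>2 + s\<^sup>2 = (1 :: real)"
    using real_collinear False by metis
  define e where "e = of_real k * \<xi> - of_real s * \<xi>'"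
  consider "Re e > 0" | "Re e < 0" | "Re e = 0" by linarith
  then show ?thesis
  proof cases
    case 1
    then show ?thesis using pinched_level_chart_aux[OF AC L Z \<nu> ks] by (simp add: e_def)
  next
    case 2
    \<comment> \<open>Negating s, \<nu> and k keeps Z and W and replaces e by -e.\<close>
    show ?thesis
      by (rule pinched_level_chart_aux[OF AC L, of "- s" "- \<nu>" "- k"]) (use Z \<nu> ks 2 in \<open>auto simp: e_def\<close>)
  next
    case 3
    \<comment> \<open>Excluded: the focal point would be a vertex of the focal hyperbola, which lies inside the ellipsoid.\<close>
    have n: "(cmod \<nu>)\<^sup>2 > 0" using \<nu> by simp
    have "Re \<xi> *\<^sub>R W - Re \<xi>' *\<^sub>R Z = Re e *\<^sub>R \<nu>" "Im \<xi> *\<^sub>R W - Im \<xi>' *\<^sub>R Z = Im e *\<^sub>R \<nu>"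
      unfolding Z e_def by (simp_all add: scaleR_diff_left mult.commute)
    then have "k\<^sup>2 * (cmod \<nu>)\<^sup>2 = C * (Im e)\<^sup>2 * (cmod \<nu>)\<^sup>2"
      using L 3 by (simp add: pinched_level_def power_mult_distrib Z(2))
    then have k: "k\<^sup>2 = C * (Im e)\<^sup>2" using n by simp
    have l: "(cmod \<xi>)\<^sup>2 + (cmod Z)\<^sup>2 = 1" "(cmod \<xi>')\<^sup>2 + (cmod W)\<^sup>2 = 1"
      "Re (cnj \<xi> * \<xi>') + Re (cnj Z * W) = 0"
      using L by (simp_all add: pinched_level_def)
    define x y d N where "x = (cmod \<xi>)\<^sup>2" and "y = (cmod \<xi>')\<^sup>2" and "d = Re (cnj \<xi> * \<xi>')" and "N = (cmod \<nu>)\<^sup>2"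
    have "cnj Z * W = of_real (k * s * N)"
      unfolding Z N_def by (rule cnj_scaleR_mult)
    then have l': "x + s\<^sup>2 * N = 1" "y + k\<^sup>2 * N = 1" "d + k * s * N = 0"
      using l by (simp_all add: Z power_mult_distrib x_def y_def d_def N_def)
    have "(cmod e)\<^sup>2 = k\<^sup>2 * x + s\<^sup>2 * y - 2 * (k * s) * d"
      unfolding e_def x_def y_def d_def cmod_power2 by (simp add: power2_eq_square algebra_simps)
    also have "\<dots> = 1" using l' ks by algebra
    finally have "(Im e)\<^sup>2 = 1" using 3 by (simp add: cmod_power2)
    then have "k\<^sup>2 = C" using k by simp
    then show ?thesis using ks AC zero_le_power2[of s] by linarith
  qed
qed

lemma pinched_chart_image:
  assumes "A > 0" "C > 1"
  shows "pinched_chart A C ` pinched_params = pinched_level A C"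
  using pinched_chart_in_level[OF assms] pinched_level_chart[OF assms] by auto

text \<open>Off the poles the collapse loses nothing: it shows \<epsilon>, and the twist with fixed
  \<epsilon> and \<mu> is injective. At the poles the chart depends on \<delta> and \<epsilon> only
  through the twisted phase.\<close>

lemma pinched_collapse_eqD:
  assumes AC: "A > 0" "C > 1"
    and p: "(\<delta>, \<epsilon>, \<mu>, \<nu>) \<in> pinched_params" "(\<delta>', \<epsilon>', \<mu>', \<nu>') \<in> pinched_params"
    and eq: "pinched_collapse A C (\<delta>, \<epsilon>, \<mu>, \<nu>) = pinched_collapse A C (\<delta>', \<epsilon>', \<mu>', \<nu>')"
  shows "pinched_chart A C (\<delta>, \<epsilon>, \<mu>, \<nu>) = pinched_chart A C (\<delta>', \<epsilon>', \<mu>', \<nu>')"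
proof -
  have 1: "\<delta> * cis (\<epsilon> * \<mu> * latitude A C \<delta>) = \<delta>' * cis (\<epsilon>' * \<mu>' * latitude A C \<delta>')"
    and \<mu>: "\<mu> = \<mu>'" and \<nu>: "\<nu> = \<nu>'" and \<epsilon>\<nu>: "\<epsilon> * norm \<nu> = \<epsilon>' * norm \<nu>'"
    using eq by (auto simp: pinched_collapse_def complex_eq_iff)
  show ?thesis
  proof (cases "\<nu> = 0")
    case False
    then have "\<epsilon> = \<epsilon>'" using \<epsilon>\<nu> \<nu> by simp
    then have "\<delta> = \<delta>'"
      using twist_injective[where m = "latitude A C" and t = "\<epsilon> * \<mu>"] latitude_contraction[OF AC]
        pinched_params_bounds(1)[OF p(1)] p 1 \<mu> by (auto simp: pinched_params_iff)
    then show ?thesis using \<mu> \<nu> \<open>\<epsilon> = \<epsilon>'\<close> by simp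
  next
    case True
    then have "\<mu>\<^sup>2 = 1" using p by (simp add: pinched_params_iff)
    then have \<mu>1: "\<mu> = 1 \<or> \<mu> = -1" by (simp add: power2_eq_1_iff)
    \<comment> \<open>For \<mu> = 1 or -1 the position is the twisted phase or its
      conjugate.\<close>
    have conj: "cis (\<epsilon> * l) * (of_real (Re \<delta>) + \<i> * of_real (\<mu> * Im \<delta>))
        = (if \<mu> = 1 then \<delta> * cis (\<epsilon> * \<mu> * l) else cnj (\<delta> * cis (\<epsilon> * \<mu> * l)))" for \<epsilon> l \<delta>
      using \<mu>1 by (auto simp: complex_eq_iff algebra_simps)
    have vel: "of_real (- Im \<delta>) + \<i> * of_real (\<mu> * Re \<delta>) = (of_real (Re \<delta>) + \<i> * of_real (\<mu> * Im \<delta>)) * (\<i> * of_real \<mu>)" for \<delta>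
      using \<mu>1 by (auto simp: complex_eq_iff)
    show ?thesis
      unfolding pinched_chart_def prod.case \<mu>[symmetric] \<nu>[symmetric] vel mult.assoc[symmetric] conj 1[folded \<mu>]
      using True by simp
  qed
qed

text \<open>Off the poles the chart is injective: Z and W give \<delta> and \<nu> up to a common
  sign t, and the crossing points of both tuples have positive real part. At the poles only \<mu>
  and the twisted phase can be read off, which is all the collapse records.\<close>

lemma pinched_chart_eqD:
  assumes AC: "A > 0" "C > 1"
    and p: "(\<delta>, \<epsilon>, \<mu>, \<nu>) \<in> pinched_params" "(\<delta>', \<epsilon>', \<mu>', \<nu>') \<in> pinched_params"
    and eq: "pinched_chart A C (\<delta>, \<epsilon>, \<mu>, \<nu>) = pinched_chart A C (\<delta>', \<epsilon>', \<mu>', \<nu>')"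
  shows "pinched_collapse A C (\<delta>, \<epsilon>, \<mu>, \<nu>) = pinched_collapse A C (\<delta>', \<epsilon>', \<mu>', \<nu>')"
proof -
  obtain \<xi> Z \<xi>' W where ch: "pinched_chart A C (\<delta>, \<epsilon>, \<mu>, \<nu>) = (\<xi>, Z, \<xi>', W)"
    by (cases "pinched_chart A C (\<delta>, \<epsilon>, \<mu>, \<nu>)") auto
  have ch': "pinched_chart A C (\<delta>', \<epsilon>', \<mu>', \<nu>') = (\<xi>, Z, \<xi>', W)" using ch eq by simp
  note b = pinched_chart_rotate_back[OF p(1) ch] and b' = pinched_chart_rotate_back[OF p(2) ch']
  have norms: "norm \<delta> = 1" "norm \<delta>' = 1" "\<epsilon> \<in> {1, -1}" "\<epsilon>' \<in> {1, -1}"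
    "\<mu>\<^sup>2 + (cmod \<nu>)\<^sup>2 = 1" "\<mu>'\<^sup>2 + (cmod \<nu>')\<^sup>2 = 1"
    using p by (simp_all add: pinched_params_iff)
  have \<nu>n: "norm \<nu> = norm \<nu>'" using b(5) b'(5) by (metis norm_ge_zero power2_eq_iff_nonneg)
  define l l' where "l = latitude A C \<delta>" and "l' = latitude A C \<delta>'"
  have lat: "sin l > 0" "cos l > 0" "sin l' > 0" "cos l' > 0"
    using latitude_facts(3,4)[OF AC norms(1)] latitude_facts(3,4)[OF AC norms(2)] by (simp_all add: l_def l'_def)
  show ?thesis
  proof (cases "\<nu> = 0")
    case True
    then have \<nu>': "\<nu>' = 0" using \<nu>n by simp
    have \<mu>1: "\<mu> = 1 \<or> \<mu> = -1" "\<mu>' = 1 \<or> \<mu>' = -1" using norms(5,6) True \<nu>' by (simp_all add: power2_eq_1_iff)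
    have vel: "\<xi>' = \<xi> * (\<i> * of_real \<mu>)"
      if "pinched_chart A C (\<delta>, \<epsilon>, \<mu>, \<nu>) = (\<xi>, Z, \<xi>', W)" "\<mu> = 1 \<or> \<mu> = -1" for \<delta> \<epsilon> \<mu> \<nu>
    proof -
      have "of_real (- Im \<delta>) + \<i> * of_real (\<mu> * Re \<delta>) = (of_real (Re \<delta>) + \<i> * of_real (\<mu> * Im \<delta>)) * (\<i> * of_real \<mu>)"
        using that(2) by (auto simp: complex_eq_iff)
      then show ?thesis using that(1) by (auto simp: pinched_chart_def mult.assoc)
    qed
    have pos: "\<delta> * cis (\<epsilon> * \<mu> * latitude A C \<delta>) = (if \<mu> = 1 then \<xi> else cnj \<xi>)"
      if "pinched_chart A C (\<delta>, \<epsilon>, \<mu>, \<nu>) = (\<xi>, Z, \<xi>', W)" "\<mu> = 1 \<or> \<mu> = -1" for \<delta> \<epsilon> \<mu> \<nu>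
    proof -
      have "\<xi> = cis (\<epsilon> * latitude A C \<delta>) * (of_real (Re \<delta>) + \<i> * of_real (\<mu> * Im \<delta>))"
        using that(1) by (simp add: pinched_chart_def)
      then show ?thesis using that(2) by (auto simp: complex_eq_iff algebra_simps)
    qed
    have "\<xi> \<noteq> 0" using pos[OF ch \<mu>1(1)] norms(1) by (auto split: if_splits)
    then have "\<mu> = \<mu>'" using vel[OF ch \<mu>1(1)] vel[OF ch' \<mu>1(2)] by simp
    then show ?thesis
      using pos[OF ch \<mu>1(1)] pos[OF ch' \<mu>1(2)] True \<nu>' by (simp add: pinched_collapse_def)
  next
    case False
    then have \<nu>': "\<nu>' \<noteq> 0" using \<nu>n by auto
    have "\<exists>t :: real. \<nu> = t *\<^sub>R \<nu>'"
    proof (cases "Re \<delta> = 0")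
      case True
      then have "Im \<delta> \<noteq> 0" using pinched_params_bounds(3)[OF p(1)] by auto
      moreover have "Im \<delta> *\<^sub>R \<nu> = Im \<delta>' *\<^sub>R \<nu>'" using b(3) b'(3) by simp
      ultimately have "\<nu> = (Im \<delta>' / Im \<delta>) *\<^sub>R \<nu>'"
        by (metis divide_inverse_commute scaleR_scaleR scaleR_one left_inverse)
      then show ?thesis by blast
    next
      case False
      moreover have "Re \<delta> *\<^sub>R \<nu> = Re \<delta>' *\<^sub>R \<nu>'" using b(4) b'(4) by simp
      ultimately have "\<nu> = (Re \<delta>' / Re \<delta>) *\<^sub>R \<nu>'"
        by (metis divide_inverse_commute scaleR_scaleR scaleR_one left_inverse)
      then show ?thesis by blast
    qed
    then obtain t :: real where t: "\<nu> = t *\<^sub>R \<nu>'" by blast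
    then have "\<bar>t\<bar> = 1" using \<nu>n \<nu>' by simp
    have ks: "Re \<delta>' = t * Re \<delta>" "Im \<delta>' = t * Im \<delta>"
      using b(3,4) b'(3,4) \<nu>' unfolding t by (simp_all add: mult.commute)
    have "cis (\<epsilon>' * l') = of_real t * cis (\<epsilon> * l)"
      unfolding l_def l'_def b(1)[symmetric] b'(1)[symmetric] ks by (simp add: algebra_simps)
    then have cis: "cos (\<epsilon>' * l') = t * cos (\<epsilon> * l)" "sin (\<epsilon>' * l') = t * sin (\<epsilon> * l)"
      by (simp_all add: complex_eq_iff)
    have "cos (\<epsilon>' * l') = cos l'" "cos (\<epsilon> * l) = cos l" using norms by auto
    \<comment> \<open>The latitude is below pi / 2, so both cosines are positive.\<close>
    then have "t > 0" using cis(1) lat by (metis zero_less_mult_pos2)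
    then have t1: "t = 1" using \<open>\<bar>t\<bar> = 1\<close> by simp
    then have \<delta>: "\<delta> = \<delta>'" using ks by (simp add: complex_eq_iff)
    have "\<epsilon>' * sin l' = \<epsilon> * sin l" using cis(2) t1 norms by auto
    then have \<epsilon>: "\<epsilon> = \<epsilon>'" using \<delta> lat by (simp add: l_def l'_def)
    have "\<i> * of_real \<mu> * cis (\<epsilon> * l) = \<i> * of_real \<mu>' * cis (\<epsilon> * l)"
      using b(2) b'(2) \<delta> \<epsilon> by (simp add: l_def)
    then have "\<mu> = \<mu>'" by simp
    then show ?thesis using \<delta> \<epsilon> t t1 by simp
  qed
qed

lemma pinched_level_homeomorphic:
  assumes "A > 0" "C > 1"
  shows "pinched_level A C homeomorphic circle \<times> pinched_torus_model"
  unfolding pinched_chart_image[OF assms, symmetric] pinched_collapse_image[OF assms, symmetric]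
proof (rule homeomorphic_images_same_kernel[OF compact_pinched_params
      continuous_on_pinched_chart[OF assms] continuous_on_pinched_collapse[OF assms]])
  fix x y assume "x \<in> pinched_params" "y \<in> pinched_params"
  then show "pinched_chart A C x = pinched_chart A C y \<longleftrightarrow> pinched_collapse A C x = pinched_collapse A C y"
    using pinched_collapse_eqD[OF assms] pinched_chart_eqD[OF assms] by (cases x; cases y) blast
qed

lemma compact_pinched_level:
  assumes "A > 0" "C > 1"
  shows "compact (pinched_level A C)"
  unfolding pinched_chart_image[OF assms, symmetric]
  by (intro compact_continuous_image continuous_on_pinched_chart assms compact_pinched_params)

lemma homeomorphic_imp_homeomorphic_space:
  assumes "S homeomorphic T"
  shows "top_of_set S homeomorphic_space top_of_set T"
proof -
  obtain f g where fg: "homeomorphism S T f g" using assms by (auto simp: homeomorphic_def)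
  have "homeomorphic_maps (top_of_set S) (top_of_set T) f g"
    using fg unfolding homeomorphic_maps_def homeomorphism_def
    by (auto simp: continuous_map_in_subtopology)
  then show ?thesis unfolding homeomorphic_space_def by blast
qed

lemma cnj_scaleR_mult_scaleR: "cnj (s *\<^sub>R Z) * (t *\<^sub>R W) = (s * t) *\<^sub>R (cnj Z * W)"
  by simp

subsection \<open>The image of an energy level\<close>

locale revolution_ellipsoid =
  fixes \<alpha> :: "real ^ 4"
  assumes pos: "0 < \<alpha>$0" and lt01: "\<alpha>$0 < \<alpha>$1" and eq12: "\<alpha>$2 = \<alpha>$1" and lt13: "\<alpha>$1 < \<alpha>$3"
begin

abbreviation a where "a \<equiv> \<alpha> $ 0"
abbreviation b where "b \<equiv> \<alpha> $ 1"
abbreviation c where "c \<equiv> \<alpha> $ 3"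

lemma axis_facts:
  "0 < a" "0 < b" "0 < c" "0 < b - a" "0 < c - b" "0 < c - a" "a \<noteq> 0" "b \<noteq> 0" "c \<noteq> 0"
  "a < b" "b < c" "a < c"
  using pos lt01 lt13 by auto

text \<open>Each minor in these integrals occurs in two of them with opposite signs.\<close>

lemma sum_of_integrals: "F0_int \<alpha> z + G_int \<alpha> z + F3_int \<alpha> z = 2 * H_int z"
proof (cases z)
  case (Pair x y)
  have *: "P / (b - c) = - (P / (c - b))" for P
    by (metis minus_diff_eq minus_divide_right)
  show ?thesis
    unfolding Pair F0_int_def G_int_def F3_int_def H_int_def by (simp add: eq12 *)
qed

text \<open>After the Lagrange identity each product of two different poles splits into partial
  fractions. The minor of the equal axes 1 and 2 carries a square instead and leaves the double pole
  with coefficient -J^2.\<close>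

lemma tangency_expansion:
  assumes "\<kappa> \<noteq> a" "\<kappa> \<noteq> b" "\<kappa> \<noteq> c"
  shows "tangency \<alpha> \<kappa> z = F0_int \<alpha> z / (a - \<kappa>) + G_int \<alpha> z / (b - \<kappa>)
     - (J_int z)\<^sup>2 / (b - \<kappa>)\<^sup>2 + F3_int \<alpha> z / (c - \<kappa>)"
proof (cases z)
  case (Pair x y)
  define A where "A = 1 / (a - \<kappa>)"
  define B where "B = 1 / (b - \<kappa>)"
  define C where "C = 1 / (c - \<kappa>)"
  define m where "m i j = (x$i * y$j - x$j * y$i)\<^sup>2" for i j
  have nz: "a - \<kappa> \<noteq> 0" "b - \<kappa> \<noteq> 0" "c - \<kappa> \<noteq> 0" "b - a \<noteq> 0" "c - b \<noteq> 0" "c - a \<noteq> 0"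
    using assms axis_facts by auto
  have ab: "(B - A) / (b - a) = - (A * B)" and bc: "(C - B) / (c - b) = - (B * C)"
    and ac: "(C - A) / (c - a) = - (A * C)"
    unfolding A_def B_def C_def
    using divided_difference_inverse[of "a - \<kappa>" "b - \<kappa>"]
      divided_difference_inverse[of "b - \<kappa>" "c - \<kappa>"]
      divided_difference_inverse[of "a - \<kappa>" "c - \<kappa>"] nz by simp_all
  have lag: "tangency \<alpha> \<kappa> z = (A * (y$0)\<^sup>2 + B * (y$1)\<^sup>2 + B * (y$2)\<^sup>2 + C * (y$3)\<^sup>2)
     - (A * B * m 0 1 + A * B * m 0 2 + A * C * m 0 3 + B * B * m 1 2 + B * C * m 1 3 + B * C * m 2 3)"
    unfolding m_def lagrange_identity_4[symmetric]
    unfolding Pair tangency_def confocal_form_def sum_UNIV_4 A_def B_def C_def eq12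
    by (simp add: eq12 power2_eq_square algebra_simps)
  have gneg: "P / (b - c) = - (P / (c - b))" for P
    by (metis minus_diff_eq minus_divide_right)
  have m13: "(x$1 * y$3 - x$3 * y$1)\<^sup>2 = m 1 3" "(x$2 * y$3 - x$3 * y$2)\<^sup>2 = m 2 3"
     "(x$0 * y$1 - x$1 * y$0)\<^sup>2 = m 0 1" "(x$0 * y$2 - x$2 * y$0)\<^sup>2 = m 0 2" "(x$0 * y$3 - x$3 * y$0)\<^sup>2 = m 0 3"
     "(x$1 * y$2 - x$2 * y$1)\<^sup>2 = m 1 2"
    by (simp_all add: m_def)
  have "F0_int \<alpha> z / (a - \<kappa>) + G_int \<alpha> z / (b - \<kappa>) - (J_int z)\<^sup>2 / (b - \<kappa>)\<^sup>2 + F3_int \<alpha> z / (c - \<kappa>)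
    = A * ((y$0)\<^sup>2 - (m 0 1 + m 0 2) / (b - a) - m 0 3 / (c - a))
      + B * ((y$1)\<^sup>2 + (y$2)\<^sup>2 + (m 0 1 + m 0 2) / (b - a) - (m 1 3 + m 2 3) / (c - b))
      - B\<^sup>2 * m 1 2
      + C * ((y$3)\<^sup>2 + (m 1 3 + m 2 3) / (c - b) + m 0 3 / (c - a))"
    unfolding Pair F0_int_def G_int_def F3_int_def J_int_def A_def B_def C_def
    by (simp add: gneg m13 power_one_over)
  also have "\<dots> = (A * (y$0)\<^sup>2 + B * ((y$1)\<^sup>2 + (y$2)\<^sup>2) + C * (y$3)\<^sup>2)
      + ((B - A) / (b - a)) * (m 0 1 + m 0 2) + ((C - B) / (c - b)) * (m 1 3 + m 2 3)
      + ((C - A) / (c - a)) * m 0 3 - B\<^sup>2 * m 1 2"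
    by (simp add: algebra_simps diff_divide_distrib add_divide_distrib)
  also have "\<dots> = tangency \<alpha> \<kappa> z"
    unfolding ab bc ac lag by (simp add: algebra_simps power2_eq_square)
  finally show ?thesis ..
qed

text \<open>The case \<kappa> = 0: a line tangent to the ellipsoid has zero discriminant for the
  ellipsoid itself.\<close>

lemma integral_relation:
  assumes "z \<in> phase_space \<alpha>"
  shows "F0_int \<alpha> z / a + G_int \<alpha> z / b - (J_int z)\<^sup>2 / b\<^sup>2 + F3_int \<alpha> z / c = 0"
proof (cases z)
  case (Pair x y)
  have "tangency \<alpha> 0 z = 0"
    using assms unfolding Pair by (simp add: tangency_def phase_space_iff_confocal_form)
  with tangency_expansion[of 0 z] axis_facts show ?thesis by simp
qed

text \<open>The sum of the integrals and their relation on the phase space are two linear equations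
  between H, J^2, G, F_0 and F_3. Eliminating F_3 gives the first formula, eliminating F_0 the
  second.\<close>

lemma curve_distances:
  assumes "z \<in> phase_space \<alpha>"
  shows "G_int \<alpha> z - curve_fun \<alpha> (H_int z) 3 (J_int z) = - (b * (c - a) / (a * (c - b))) * F0_int \<alpha> z"
    and "curve_fun \<alpha> (H_int z) 0 (J_int z) - G_int \<alpha> z = (b * (c - a) / (c * (b - a))) * F3_int \<alpha> z"
proof -
  define f0 f3 where "f0 = F0_int \<alpha> z / a" and "f3 = F3_int \<alpha> z / c"
  define g h d where "g = G_int \<alpha> z / b" and "h = H_int z" and "d = (J_int z)\<^sup>2 / b\<^sup>2"
  have eq: "F0_int \<alpha> z = a * f0" "F3_int \<alpha> z = c * f3" "G_int \<alpha> z = b * g" "(J_int z)\<^sup>2 = b\<^sup>2 * d"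
    using axis_facts by (simp_all add: f0_def f3_def g_def d_def)
  have h: "2 * h = a * f0 + b * g + c * f3"
    using sum_of_integrals[of z] by (simp add: eq h_def)
  have d: "d = f0 + g + f3"
    using integral_relation[OF assms] by (simp add: f0_def f3_def g_def d_def)
  have curve: "curve_fun \<alpha> (H_int z) k (J_int z) = b * (2 * h - \<alpha>$k * d) / (b - \<alpha>$k)" for k
  proof -
    have "\<alpha>$k / (b * (b - \<alpha>$k)) * (b\<^sup>2 * d) = b * (\<alpha>$k * d) / (b - \<alpha>$k)"
      using axis_facts by (simp add: power2_eq_square)
    then show ?thesis
      unfolding curve_fun_def eq h_def[symmetric] by (simp add: diff_divide_distrib right_diff_distrib)
  qed
  have "b * g * (b - c) - b * (2 * h - c * d) = b * (c - a) * f0"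
    unfolding h d by algebra
  then have "b * g - b * (2 * h - c * d) / (b - c) = b * (c - a) * f0 / (b - c)"
    using axis_facts by (simp add: field_simps)
  then show "G_int \<alpha> z - curve_fun \<alpha> (H_int z) 3 (J_int z) = - (b * (c - a) / (a * (c - b))) * F0_int \<alpha> z"
    unfolding curve eq using axis_facts minus_divide_right[of "b * (c - a) * f0" "c - b"] by simp
  have "b * (2 * h - a * d) - b * g * (b - a) = b * (c - a) * f3"
    unfolding h d by algebra
  then have "b * (2 * h - a * d) / (b - a) - b * g = b * (c - a) * f3 / (b - a)"
    using axis_facts by (simp add: field_simps)
  then show "curve_fun \<alpha> (H_int z) 0 (J_int z) - G_int \<alpha> z = (b * (c - a) / (c * (b - a))) * F3_int \<alpha> z"
    unfolding curve eq using axis_facts by simp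
qed

lemma phase_space_iff:
  "(x, y) \<in> phase_space \<alpha> \<longleftrightarrow> (x$0)\<^sup>2 / a + ((x$1)\<^sup>2 + (x$2)\<^sup>2) / b + (x$3)\<^sup>2 / c = 1
     \<and> x$0 * y$0 / a + (x$1 * y$1 + x$2 * y$2) / b + x$3 * y$3 / c = 0"
  by (simp add: phase_space_def sum_UNIV_4 eq12 add_divide_distrib add.assoc)

text \<open>Unlike F_3, F_0 has no sign term by term. On the phase space y_0 is a combination of
  minors, and Cauchy-Schwarz bounds its square by K times the subtracted part N. The strict bound K
  < 1 also forces N = 0 when F_0 vanishes.\<close>

lemma F0_bound:
  assumes "(x, y) \<in> phase_space \<alpha>"
  obtains N K where "0 \<le> N" "K < 1" "(y$0)\<^sup>2 \<le> K * N" "F0_int \<alpha> (x, y) = (y$0)\<^sup>2 - N"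
    "N = ((x$0 * y$1 - x$1 * y$0)\<^sup>2 + (x$0 * y$2 - x$2 * y$0)\<^sup>2) / (b - a)
         + (x$0 * y$3 - x$3 * y$0)\<^sup>2 / (c - a)"
proof -
  define u x1 x2 v p y1 y2 q where vars: "u = x$0" "x1 = x$1" "x2 = x$2" "v = x$3"
    "p = y$0" "y1 = y$1" "y2 = y$2" "q = y$3"
  define r1 r2 s where r: "r1 = u * y1 - x1 * p" "r2 = u * y2 - x2 * p" "s = u * q - v * p"
  define N where "N = (r1\<^sup>2 + r2\<^sup>2) / (b - a) + s\<^sup>2 / (c - a)"
  define K where "K = (b - a) * ((x1 / b)\<^sup>2 + (x2 / b)\<^sup>2) + (c - a) * (v / c)\<^sup>2"
  have 1: "u\<^sup>2 / a + (x1\<^sup>2 + x2\<^sup>2) / b + v\<^sup>2 / c = 1" and 2: "u * p / a + (x1 * y1 + x2 * y2) / b + v * q / c = 0"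
    using assms unfolding phase_space_iff vars by auto
  \<comment> \<open>p times the equation of the ellipsoid minus u times that of tangency; the terms
    in the coordinate 0 cancel and minors remain.\<close>
  have "p = p * (u\<^sup>2 / a + (x1\<^sup>2 + x2\<^sup>2) / b + v\<^sup>2 / c) - u * (u * p / a + (x1 * y1 + x2 * y2) / b + v * q / c)"
    unfolding 1 2 by simp
  also have "\<dots> = - (x1 / b * r1 + x2 / b * r2 + v / c * s)"
    unfolding r by (simp add: field_simps power2_eq_square add_divide_distrib diff_divide_distrib)
  finally have "p\<^sup>2 = (x1 / b * r1 + x2 / b * r2 + v / c * s)\<^sup>2"
    by (metis power2_minus)
  also have "\<dots> \<le> K * N"
    unfolding K_def N_def by (rule weighted_Cauchy_Schwarz_3) (use axis_facts in auto)
  finally have le: "p\<^sup>2 \<le> K * N" .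
  have "K = (x1\<^sup>2 + x2\<^sup>2) / b + v\<^sup>2 / c - a * ((x1\<^sup>2 + x2\<^sup>2) / b\<^sup>2 + v\<^sup>2 / c\<^sup>2)"
    unfolding K_def using axis_facts by (simp add: field_simps power2_eq_square)
  then have K: "K = 1 - u\<^sup>2 / a - a * ((x1\<^sup>2 + x2\<^sup>2) / b\<^sup>2 + v\<^sup>2 / c\<^sup>2)"
    using 1 by linarith
  have "K < 1"
  proof (cases "u = 0")
    case True
    then have "x1\<^sup>2 + x2\<^sup>2 \<noteq> 0 \<or> v \<noteq> 0" using 1 by auto
    then have "(x1\<^sup>2 + x2\<^sup>2) / b\<^sup>2 + v\<^sup>2 / c\<^sup>2 > 0"
      using axis_facts by (metis add_nonneg_pos add_pos_nonneg divide_nonneg_nonneg divide_pos_pos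
          sum_power2_ge_zero zero_le_power2 zero_less_power2 less_le)
    then show ?thesis unfolding K True using axis_facts by simp
  next
    case False
    then have "u\<^sup>2 / a > 0" using axis_facts by simp
    moreover have "a * ((x1\<^sup>2 + x2\<^sup>2) / b\<^sup>2 + v\<^sup>2 / c\<^sup>2) \<ge> 0" using axis_facts by simp
    ultimately show ?thesis unfolding K by linarith
  qed
  moreover have "0 \<le> N" unfolding N_def using axis_facts by simp
  ultimately show ?thesis
    using le that[of N K] unfolding N_def F0_int_def r vars by simp
qed

lemma F0_int_nonpos:
  assumes "z \<in> phase_space \<alpha>"
  shows "F0_int \<alpha> z \<le> 0"
proof (cases z)
  case (Pair x y)
  then obtain N K where NK: "0 \<le> N" "K < 1" "(y$0)\<^sup>2 \<le> K * N" "F0_int \<alpha> z = (y$0)\<^sup>2 - N"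
    using F0_bound assms by metis
  have "K * N \<le> 1 * N" using NK(1,2) by (intro mult_right_mono) auto
  then show ?thesis using NK by linarith
qed

lemma F0_int_eq_0_iff:
  assumes "(x, y) \<in> phase_space \<alpha>" "H_int (x, y) > 0"
  shows "F0_int \<alpha> (x, y) = 0 \<longleftrightarrow> x$0 = 0 \<and> y$0 = 0"
proof
  assume F0: "F0_int \<alpha> (x, y) = 0"
  obtain N K where NK: "0 \<le> N" "K < 1" "(y$0)\<^sup>2 \<le> K * N" "F0_int \<alpha> (x, y) = (y$0)\<^sup>2 - N"
    and N: "N = ((x$0 * y$1 - x$1 * y$0)\<^sup>2 + (x$0 * y$2 - x$2 * y$0)\<^sup>2) / (b - a)
         + (x$0 * y$3 - x$3 * y$0)\<^sup>2 / (c - a)"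
    using F0_bound assms(1) by metis
  have "N \<le> K * N" using NK F0 by linarith
  moreover have "K * N < 1 * N" if "N > 0" using NK(2) that by (intro mult_strict_right_mono) auto
  ultimately have "\<not> N > 0" by linarith
  then have "N = 0" using NK(1) by linarith
  then have y0: "y$0 = 0" using NK F0 by simp
  have "((x$0 * y$1 - x$1 * y$0)\<^sup>2 + (x$0 * y$2 - x$2 * y$0)\<^sup>2) / (b - a) \<ge> 0"
    "(x$0 * y$3 - x$3 * y$0)\<^sup>2 / (c - a) \<ge> 0"
    using axis_facts by simp_all
  then have "((x$0 * y$1 - x$1 * y$0)\<^sup>2 + (x$0 * y$2 - x$2 * y$0)\<^sup>2) / (b - a) = 0"
    "(x$0 * y$3 - x$3 * y$0)\<^sup>2 / (c - a) = 0"
    using \<open>N = 0\<close> unfolding N by linarith+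
  then have "x$0 * y$1 = 0" "x$0 * y$2 = 0" "x$0 * y$3 = 0"
    using axis_facts y0 by (auto simp: sum_power2_eq_zero_iff)
  then show "x$0 = 0 \<and> y$0 = 0"
    using assms(2) y0 by (auto simp: H_int_def)
qed (simp add: F0_int_def)

lemma F3_int_nonneg: "F3_int \<alpha> z \<ge> 0"
  using axis_facts by (cases z) (simp add: F3_int_def)

lemma F3_int_eq_0_iff:
  assumes "H_int (x, y) > 0"
  shows "F3_int \<alpha> (x, y) = 0 \<longleftrightarrow> x$3 = 0 \<and> y$3 = 0"
proof
  assume F3: "F3_int \<alpha> (x, y) = 0"
  have "((x$1 * y$3 - x$3 * y$1)\<^sup>2 + (x$2 * y$3 - x$3 * y$2)\<^sup>2) / (c - b) \<ge> 0"
    "(x$0 * y$3 - x$3 * y$0)\<^sup>2 / (c - a) \<ge> 0" "(y$3)\<^sup>2 \<ge> 0"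
    using axis_facts by simp_all
  with F3 have z: "((x$1 * y$3 - x$3 * y$1)\<^sup>2 + (x$2 * y$3 - x$3 * y$2)\<^sup>2) / (c - b) = 0"
    "(x$0 * y$3 - x$3 * y$0)\<^sup>2 / (c - a) = 0" "(y$3)\<^sup>2 = 0"
    unfolding F3_int_def prod.case by linarith+
  then have y3: "y$3 = 0" by simp
  then have "x$3 * y$1 = 0" "x$3 * y$2 = 0" "x$3 * y$0 = 0"
    using z axis_facts by (auto simp: sum_power2_eq_zero_iff)
  then show "x$3 = 0 \<and> y$3 = 0"
    using assms y3 by (auto simp: H_int_def)
qed (simp add: F3_int_def)

section \<open>The boundary curves and the region between them\<close>

text \<open>This form shows both curves through the common value j^2 / b where 2 h = j^2 / b, and
  separates them by a multiple of 2 h - j^2 / b.\<close>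

lemma curve_fun_alt:
  assumes "\<alpha>$k \<noteq> b"
  shows "curve_fun \<alpha> h k j = j\<^sup>2 / b + (2 * h - j\<^sup>2 / b) * (b / (b - \<alpha>$k))"
proof -
  define D where "D = j\<^sup>2 / b"
  define d where "d = b - \<alpha>$k"
  have D: "j\<^sup>2 = b * D" using axis_facts by (simp add: D_def)
  have d: "d \<noteq> 0" "\<alpha>$k = b - d" using assms by (simp_all add: d_def)
  have "curve_fun \<alpha> h k j = 2 * b / d * h - (b - d) / (b * d) * (b * D)"
    unfolding curve_fun_def D d_def by simp
  also have "\<dots> = D + (2 * h - D) * (b / d)"
    using d(1) axis_facts by (simp add: field_simps)
  finally show ?thesis unfolding D_def d_def .
qed

lemma curve_fun_3: "curve_fun \<alpha> h 3 j = j\<^sup>2 / b - (2 * h - j\<^sup>2 / b) * (b / (c - b))"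
proof -
  have "b / (b - c) = - (b / (c - b))" by (metis minus_diff_eq minus_divide_right)
  then show ?thesis using curve_fun_alt[of 3 h j] axis_facts by simp
qed

lemma curve_fun_0: "curve_fun \<alpha> h 0 j = j\<^sup>2 / b + (2 * h - j\<^sup>2 / b) * (b / (b - a))"
  using curve_fun_alt[of 0 h j] axis_facts by simp

lemma curve_fun_difference:
  "curve_fun \<alpha> h 0 j - curve_fun \<alpha> h 3 j = (1 / (b - a) + 1 / (c - b)) * (2 * h * b - j\<^sup>2)"
proof -
  define X where "X = 2 * h - j\<^sup>2 / b"
  have X: "2 * h * b - j\<^sup>2 = X * b"
    using axis_facts by (simp add: X_def field_simps)
  show ?thesis
    unfolding curve_fun_0 curve_fun_3 X X_def[symmetric] by (simp add: distrib_right)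
qed

lemma curve_fun_le_iff: "curve_fun \<alpha> h 3 j \<le> curve_fun \<alpha> h 0 j \<longleftrightarrow> j\<^sup>2 \<le> 2 * h * b"
proof -
  have "1 / (b - a) + 1 / (c - b) > 0" using axis_facts by (simp add: add_pos_pos)
  then show ?thesis
    using curve_fun_difference[of h j] by (metis diff_ge_0_iff_ge zero_le_mult_iff not_less order_less_imp_le less_irrefl)
qed

lemma curve_fun_eq_iff: "curve_fun \<alpha> h 3 j = curve_fun \<alpha> h 0 j \<longleftrightarrow> j\<^sup>2 = 2 * h * b"
proof -
  have "1 / (b - a) + 1 / (c - b) > 0" using axis_facts by (simp add: add_pos_pos)
  then show ?thesis
    using curve_fun_difference[of h j] by (metis eq_iff_diff_eq_0 mult_eq_0_iff less_irrefl)
qed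

lemma continuous_on_curve_fun [continuous_intros]:
  "continuous_on S f \<Longrightarrow> continuous_on S (\<lambda>z. curve_fun \<alpha> h k (f z))"
  unfolding curve_fun_def by (intro continuous_intros)

lemma region_eq: "region \<alpha> h = {z. curve_fun \<alpha> h 3 (fst z) \<le> snd z} \<inter> {z. snd z \<le> curve_fun \<alpha> h 0 (fst z)}"
  by (auto simp: region_def)

lemma closed_region: "closed (region \<alpha> h)"
  unfolding region_eq by (intro closed_Int closed_Collect_le continuous_intros)

lemma open_strict_region: "open {(j, g). curve_fun \<alpha> h 3 j < g \<and> g < curve_fun \<alpha> h 0 j}"
proof -
  have "{(j, g). curve_fun \<alpha> h 3 j < g \<and> g < curve_fun \<alpha> h 0 j}
    = {z. curve_fun \<alpha> h 3 (fst z) < snd z} \<inter> {z. snd z < curve_fun \<alpha> h 0 (fst z)}"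
    by auto
  then show ?thesis
    by (auto intro!: open_Int open_Collect_less continuous_intros)
qed

lemma compact_region: "compact (region \<alpha> h)"
proof -
  define f where "f k j = curve_fun \<alpha> h k j" for k j
  define J where "J = {j. j\<^sup>2 \<le> 2 * h * b}"
  have J: "J = {- sqrt (2 * h * b) .. sqrt (2 * h * b)}"
  proof (rule set_eqI)
    fix j :: real
    have "j \<in> J \<longleftrightarrow> sqrt (j\<^sup>2) \<le> sqrt (2 * h * b)"
      unfolding J_def by (simp only: mem_Collect_eq real_sqrt_le_iff)
    then show "j \<in> J \<longleftrightarrow> j \<in> {- sqrt (2 * h * b) .. sqrt (2 * h * b)}"
      by (simp only: real_sqrt_abs abs_le_iff atLeastAtMost_iff minus_le_iff[of j] conj_commute)
  qed
  then have "compact J" by simp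
  have "compact (f k ` J)" for k
    by (rule compact_continuous_image[OF _ \<open>compact J\<close>]) (auto simp: f_def intro!: continuous_intros)
  then have bdd: "bounded (f k ` J)" for k
    by (rule compact_imp_bounded)
  obtain B3 where B3: "\<And>j. j \<in> J \<Longrightarrow> \<bar>f 3 j\<bar> \<le> B3"
    using bdd[of 3] unfolding bounded_real by blast
  obtain B0 where B0: "\<And>j. j \<in> J \<Longrightarrow> \<bar>f 0 j\<bar> \<le> B0"
    using bdd[of 0] unfolding bounded_real by blast
  have "region \<alpha> h \<subseteq> J \<times> {- B3 .. B0}"
  proof clarify
    fix j g assume *: "(j, g) \<in> region \<alpha> h"
    then have "j \<in> J"
      using curve_fun_le_iff[of h j] by (auto simp: region_def J_def)
    with * B3[of j] B0[of j] show "j \<in> J \<and> g \<in> {- B3..B0}"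
      by (auto simp: region_def f_def)
  qed
  moreover have "bounded (J \<times> {- B3 .. B0})"
    using compact_imp_bounded[OF \<open>compact J\<close>] by (intro bounded_Times bounded_closed_interval)
  ultimately have "bounded (region \<alpha> h)"
    using bounded_subset by blast
  then show ?thesis
    using closed_region compact_eq_bounded_closed by blast
qed

lemma interior_region: "interior (region \<alpha> h) = {(j, g). curve_fun \<alpha> h 3 j < g \<and> g < curve_fun \<alpha> h 0 j}"
proof
  show "{(j, g). curve_fun \<alpha> h 3 j < g \<and> g < curve_fun \<alpha> h 0 j} \<subseteq> interior (region \<alpha> h)"
    by (rule interior_maximal[OF _ open_strict_region]) (auto simp: region_def)
  show "interior (region \<alpha> h) \<subseteq> {(j, g). curve_fun \<alpha> h 3 j < g \<and> g < curve_fun \<alpha> h 0 j}"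
  proof clarify
    fix j g assume "(j, g) \<in> interior (region \<alpha> h)"
    then obtain e where e: "e > 0" "ball (j, g) e \<subseteq> region \<alpha> h"
      by (meson mem_interior)
    have "(j, g + e / 2) \<in> ball (j, g) e" "(j, g - e / 2) \<in> ball (j, g) e"
      using e(1) by (simp_all add: dist_Pair_Pair dist_real_def)
    then have "(j, g + e / 2) \<in> region \<alpha> h" "(j, g - e / 2) \<in> region \<alpha> h" using e(2) by auto
    then show "curve_fun \<alpha> h 3 j < g \<and> g < curve_fun \<alpha> h 0 j"
      using e(1) by (auto simp: region_def)
  qed
qed

lemma frontier_region: "frontier (region \<alpha> h) = boundary_curves \<alpha> h"
  unfolding frontier_def interior_region closure_closed[OF closed_region]
  by (auto simp: region_def boundary_curves_def curve_def)

text \<open>Signs of F_0 and F_3 give one inclusion. For the other, a point of the equator suffices: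
  the rotational velocity is fixed by j, and the remaining energy is shared between the directions 0
  and 3.\<close>

lemma energy_image:
  assumes "h > 0"
  shows "(\<lambda>p. (J_int p, G_int \<alpha> p)) ` {p \<in> phase_space \<alpha>. H_int p = h} = region \<alpha> h"
proof (intro equalityI subsetI)
  fix t assume "t \<in> (\<lambda>p. (J_int p, G_int \<alpha> p)) ` {p \<in> phase_space \<alpha>. H_int p = h}"
  then obtain p where p: "p \<in> phase_space \<alpha>" "H_int p = h" "t = (J_int p, G_int \<alpha> p)" by auto
  have "b * (c - a) / (a * (c - b)) \<ge> 0" "b * (c - a) / (c * (b - a)) \<ge> 0" using axis_facts by simp_all
  then have "- (b * (c - a) / (a * (c - b))) * F0_int \<alpha> p \<ge> 0" "(b * (c - a) / (c * (b - a))) * F3_int \<alpha> p \<ge> 0"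
    using F0_int_nonpos[OF p(1)] F3_int_nonneg[of p] by (simp_all only: mult_minus_left mult_nonneg_nonpos neg_0_le_iff_le mult_nonneg_nonneg)
  then show "t \<in> region \<alpha> h"
    using curve_distances[OF p(1)] p by (auto simp: region_def)
next
  fix t assume "t \<in> region \<alpha> h"
  then obtain j g where t: "t = (j, g)" "curve_fun \<alpha> h 3 j \<le> g" "g \<le> curve_fun \<alpha> h 0 j"
    by (auto simp: region_def)
  define D where "D = j\<^sup>2 / b"
  have D: "j\<^sup>2 = b * D" using axis_facts by (simp add: D_def)
  define E where "E = 2 * h - D"
  have E: "E \<ge> 0"
  proof -
    have "b * D \<le> b * (2 * h)" using t curve_fun_le_iff[of h j] D by (simp add: mult.commute)
    then show ?thesis using axis_facts by (simp add: E_def)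
  qed
  have cf0: "curve_fun \<alpha> h 0 j = D + E * (b / (b - a))"
    and cf3: "curve_fun \<alpha> h 3 j = D - E * (b / (c - b))"
    unfolding curve_fun_0 curve_fun_3 D_def E_def by simp_all
  have neg: "X / (b - c) = - (X / (c - b))" for X by (metis minus_diff_eq minus_divide_right)
  define s where "s = b / (b - a) + b / (c - b)"
  have s: "s > 0" unfolding s_def using axis_facts by (simp add: add_pos_pos)
  \<comment> \<open>G is affine in the share P of direction 0 and runs from the lower curve at P = 0
    to the upper curve at P = E.\<close>
  define P where "P = (g - curve_fun \<alpha> h 3 j) / s"
  have P: "0 \<le> P" unfolding P_def using s t by simp
  have "curve_fun \<alpha> h 0 j - curve_fun \<alpha> h 3 j = E * s"
    by (simp only: cf0 cf3 s_def distrib_left)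
  moreover have "P * s = g - curve_fun \<alpha> h 3 j" unfolding P_def using s by simp
  ultimately have "P * s \<le> E * s" using t by linarith
  then have PE: "P \<le> E" using s by simp
  define x :: "real ^ 4" where "x = (\<chi> i. if i = 1 then sqrt b else 0)"
  define y :: "real ^ 4" where "y = (\<chi> i. if i = 0 then sqrt P else if i = 2 then j / sqrt b else if i = 3 then sqrt (E - P) else 0)"
  have comps: "x$0 = 0" "x$1 = sqrt b" "x$2 = 0" "x$3 = 0" "y$0 = sqrt P" "y$1 = 0" "y$2 = j / sqrt b" "y$3 = sqrt (E - P)"
    by (simp_all add: x_def y_def)
  have sq: "(j / sqrt b)\<^sup>2 = D" using axis_facts by (simp add: power_divide D_def)
  have "(x, y) \<in> phase_space \<alpha>"
    using axis_facts by (simp add: phase_space_iff comps)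
  moreover have "H_int (x, y) = h"
    using P PE by (simp add: H_int_def comps sq) (simp add: E_def)
  moreover have "J_int (x, y) = j"
    using axis_facts by (simp add: J_int_def comps)
  moreover have "G_int \<alpha> (x, y) = g"
  proof -
    have "G_int \<alpha> (x, y) = D + b * P / (b - a) - b * (E - P) / (c - b)"
      using P PE axis_facts by (simp add: G_int_def comps sq power_mult_distrib neg)
    also have "\<dots> = (D - E * (b / (c - b))) + P * s" unfolding s_def by (simp add: algebra_simps diff_divide_distrib)
    also have "\<dots> = g" using s cf3 by (simp add: P_def)
    finally show ?thesis .
  qed
  ultimately show "t \<in> (\<lambda>p. (J_int p, G_int \<alpha> p)) ` {p \<in> phase_space \<alpha>. H_int p = h}"
    unfolding t by (intro image_eqI[of _ _ "(x, y)"]) auto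
qed

lemma zero_in_interior_region:
  assumes "h > 0"
  shows "curve_fun \<alpha> h 3 0 < 0 \<and> 0 < curve_fun \<alpha> h 0 0"
  using assms axis_facts unfolding curve_fun_0 curve_fun_3 by simp

subsection \<open>Singular values\<close>

lemma confocal_form_0_nonneg: "confocal_form \<alpha> 0 x x \<ge> 0"
  using axis_facts by (simp add: confocal_form_def sum_UNIV_4 eq12)

text \<open>A tangent vector needs a curve that stays in the phase space for all times. The straight
  motion is therefore rescaled onto the ellipsoid, and its velocity is corrected along the new
  position; both corrections are of second order at 0.\<close>

lemma in_tangent_space:
  assumes "(x, y) \<in> phase_space \<alpha>" "confocal_form \<alpha> 0 x x' = 0"
    "confocal_form \<alpha> 0 x' y + confocal_form \<alpha> 0 x y' = 0"
  shows "(x', y') \<in> tangent_space (phase_space \<alpha>) (x, y)"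
proof -
  let ?B = "confocal_form \<alpha> 0"
  define n m where "n = ?B x' x'" and "m = ?B x' y'"
  have n: "n \<ge> 0" unfolding n_def by (rule confocal_form_0_nonneg)
  have pos: "1 + t\<^sup>2 * n > 0" for t using n by (simp add: add_pos_nonneg)
  define X where "X t = (1 / sqrt (1 + t\<^sup>2 * n)) *\<^sub>R (x + t *\<^sub>R x')" for t
  define Y where "Y t = y + t *\<^sub>R y' - (t\<^sup>2 * m / (1 + t\<^sup>2 * n)) *\<^sub>R (x + t *\<^sub>R x')" for t
  have B: "?B x x = 1" "?B x y = 0" "?B y x = 0" "?B x x' = 0" "?B x' x = 0" "?B x y' = - ?B x' y"
    using assms confocal_form_commute[of \<alpha> 0] unfolding phase_space_iff_confocal_form by simp_all
  have xx: "?B (x + t *\<^sub>R x') (x + t *\<^sub>R x') = 1 + t\<^sup>2 * n" for t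
    by (simp add: confocal_form_simps B n_def power2_eq_square)
  have "(X t, Y t) \<in> phase_space \<alpha>" for t
  proof -
    have "?B (X t) (X t) = (1 / sqrt (1 + t\<^sup>2 * n))\<^sup>2 * (1 + t\<^sup>2 * n)"
      unfolding X_def confocal_form_simps(5,6) xx by (simp add: power2_eq_square)
    also have "\<dots> = 1" using pos[of t] by (simp add: power_divide)
    finally have 1: "?B (X t) (X t) = 1" .
    have "?B (x + t *\<^sub>R x') (Y t) = ?B (x + t *\<^sub>R x') (y + t *\<^sub>R y') - t\<^sup>2 * m / (1 + t\<^sup>2 * n) * (1 + t\<^sup>2 * n)"
      unfolding Y_def confocal_form_simps(4)[of _ _ _ "y + t *\<^sub>R y'"] confocal_form_simps(6) xx ..
    also have "t\<^sup>2 * m / (1 + t\<^sup>2 * n) * (1 + t\<^sup>2 * n) = t\<^sup>2 * m" using pos[of t] by simp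
    also have "?B (x + t *\<^sub>R x') (y + t *\<^sub>R y') - t\<^sup>2 * m = 0"
      by (simp add: confocal_form_simps B m_def power2_eq_square algebra_simps)
    finally have "?B (X t) (Y t) = 0"
      unfolding X_def confocal_form_simps(5) by simp
    with 1 show ?thesis by (simp add: phase_space_iff_confocal_form)
  qed
  moreover have "X 0 = x" "Y 0 = y" by (simp_all add: X_def Y_def)
  moreover have "((\<lambda>t. (X t, Y t)) has_vector_derivative (x', y')) (at 0)"
  proof (rule has_vector_derivative_Pair)
    have lin: "((\<lambda>t. u + t *\<^sub>R v) has_vector_derivative v) (at 0)" for u v :: "real ^ 4"
      by (auto intro!: derivative_eq_intros)
    have s: "((\<lambda>t. 1 / sqrt (1 + t\<^sup>2 * n)) has_real_derivative 0) (at 0)"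
      by (auto intro!: derivative_eq_intros)
    have r: "((\<lambda>t. t\<^sup>2 * m / (1 + t\<^sup>2 * n)) has_real_derivative 0) (at 0)"
      by (rule derivative_eq_intros | simp)+
    show "(X has_vector_derivative x') (at 0)"
      using has_vector_derivative_scaleR[OF s lin[of x x']] by (simp add: X_def[abs_def])
    show "(Y has_vector_derivative y') (at 0)"
      using has_vector_derivative_diff[OF lin[of y y'] has_vector_derivative_scaleR[OF r lin[of x x']]]
      by (simp add: Y_def[abs_def])
  qed
  ultimately show ?thesis
    unfolding tangent_space_def by (intro CollectI exI[of _ "\<lambda>t. (X t, Y t)"]) auto
qed

text \<open>On the phase space this is the numerator of \<open>tangency \<alpha> r z\<close> as a rational function of \<open>r\<close>,
  divided by \<open>- r\<close>; its roots are the parameters of the confocal quadrics touched by the geodesic.\<close>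

definition separation_poly :: "real \<Rightarrow> phase \<Rightarrow> real" where
  "separation_poly r z = 2 * H_int z * (b - r)\<^sup>2
     + (b - r) * ((b - a) * (c - b) / b * G_int \<alpha> z - (1 - a * c / b\<^sup>2) * (J_int z)\<^sup>2)
     - (b - a) * (c - b) / b * (J_int z)\<^sup>2"

text \<open>The right-hand side is minus the numerator of the partial fractions. Its constant term
  vanishes by \<open>integral_relation\<close>, which splits off r, and the leading coefficient is 2
  H by \<open>sum_of_integrals\<close>.\<close>

lemma separation_poly_integrals:
  assumes "z \<in> phase_space \<alpha>"
  shows "r * separation_poly r z = - (F0_int \<alpha> z * (b - r)\<^sup>2 * (c - r) + G_int \<alpha> z * (a - r) * (b - r) * (c - r)
     - (J_int z)\<^sup>2 * (a - r) * (c - r) + F3_int \<alpha> z * (a - r) * (b - r)\<^sup>2)"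
proof -
  define f0 f3 where "f0 = F0_int \<alpha> z / a" and "f3 = F3_int \<alpha> z / c"
  define g h d where "g = G_int \<alpha> z / b" and "h = H_int z" and "d = (J_int z)\<^sup>2 / b\<^sup>2"
  have eq: "F0_int \<alpha> z = a * f0" "F3_int \<alpha> z = c * f3" "G_int \<alpha> z = b * g" "(J_int z)\<^sup>2 = b\<^sup>2 * d"
    using axis_facts by (simp_all add: f0_def f3_def g_def d_def)
  have h: "2 * h = a * f0 + b * g + c * f3"
    using sum_of_integrals[of z] by (simp add: eq h_def)
  have d: "d = f0 + g + f3"
    using integral_relation[OF assms] by (simp add: f0_def f3_def g_def d_def)
  have k: "(b - a) * (c - b) / b * (b * g) = (b - a) * (c - b) * g"
    "(b - a) * (c - b) / b * (b\<^sup>2 * d) = (b - a) * (c - b) * b * d"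
    "(1 - a * c / b\<^sup>2) * (b\<^sup>2 * d) = (b\<^sup>2 - a * c) * d"
    using axis_facts by (simp_all add: power2_eq_square field_simps)
  show ?thesis
    unfolding separation_poly_def eq k h_def[symmetric] h unfolding d by algebra
qed

lemma separation_poly_tangency:
  assumes "z \<in> phase_space \<alpha>" "r \<noteq> 0" "r \<noteq> a" "r \<noteq> b" "r \<noteq> c"
  shows "separation_poly r z = - ((a - r) * (b - r)\<^sup>2 * (c - r) / r) * tangency \<alpha> r z"
proof -
  have nz: "a - r \<noteq> 0" "b - r \<noteq> 0" "c - r \<noteq> 0" using assms by auto
  have clear: "p * q\<^sup>2 * s * (X / p + Y / q - Z / q\<^sup>2 + W / s)
      = X * q\<^sup>2 * s + Y * p * q * s - Z * p * s + W * p * q\<^sup>2"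
    if "p \<noteq> 0" "q \<noteq> 0" "s \<noteq> 0" for p q s X Y Z W :: real
    using that by (simp add: field_simps power2_eq_square)
  have "(a - r) * (b - r)\<^sup>2 * (c - r) * tangency \<alpha> r z = - (r * separation_poly r z)"
    unfolding separation_poly_integrals[OF assms(1)] tangency_expansion[OF assms(3-5)]
    using clear[OF nz] by simp
  then show ?thesis using assms(2) by (simp add: field_simps)
qed

lemma axis_cases: "\<alpha> $ i \<in> {a, b, c}"
proof -
  have "(i :: 4) \<in> {0, 1, 2, 3}" using exhaust_4[of i] by auto
  then show ?thesis using eq12 by auto
qed

text \<open>The resolvent identity 1 / ((p - r) (p - s)). It decouples the parameters: it expresses
  the effect of a normal of the quadric r on the quadric s by the two forms themselves.\<close>

lemma confocal_form_resolvent: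
  assumes "r \<notin> {a, b, c}" "s \<notin> {a, b, c}" "r \<noteq> s"
  shows "confocal_form \<alpha> s x (resolvent \<alpha> r y) = (confocal_form \<alpha> s x y - confocal_form \<alpha> r x y) / (s - r)"
    and "confocal_form \<alpha> s (resolvent \<alpha> r x) y = (confocal_form \<alpha> s x y - confocal_form \<alpha> r x y) / (s - r)"
proof -
  have *: "X / ((p - r) * (p - s)) = (X / (p - s) - X / (p - r)) / (s - r)" if "p \<noteq> r" "p \<noteq> s" for p X
  proof -
    define u v where "u = p - r" and "v = p - s"
    have sr: "s - r = u - v" and "u \<noteq> 0" "v \<noteq> 0" "u - v \<noteq> 0" using that assms(3) by (auto simp: u_def v_def)
    then show ?thesis unfolding u_def[symmetric] v_def[symmetric] sr by (simp add: field_simps)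
  qed
  have ne: "\<alpha> $ i \<noteq> r" "\<alpha> $ i \<noteq> s" for i
    using axis_cases[of i] assms by auto
  show "confocal_form \<alpha> s x (resolvent \<alpha> r y) = (confocal_form \<alpha> s x y - confocal_form \<alpha> r x y) / (s - r)"
    unfolding confocal_form_def resolvent_def sum_subtractf[symmetric] sum_divide_distrib
    by (rule sum.cong) (simp_all add: *[OF ne])
  then show "confocal_form \<alpha> s (resolvent \<alpha> r x) y = (confocal_form \<alpha> s x y - confocal_form \<alpha> r x y) / (s - r)" for x y
    unfolding confocal_form_def resolvent_def sum_subtractf[symmetric] sum_divide_distrib
    by (intro sum.cong) (simp_all add: *[OF ne])
qed

text \<open>The form may be indefinite, but paired with the normal it gives a square norm; hence the
  derivatives in \<open>test_vector\<close> do not vanish.\<close>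

lemma confocal_form_resolvent_self:
  assumes "r \<notin> {a, b, c}"
  shows "confocal_form \<alpha> r x (resolvent \<alpha> r x) = (norm (resolvent \<alpha> r x))\<^sup>2"
  unfolding power2_norm_eq_inner inner_vec_def confocal_form_def resolvent_def by simp

lemma resolvent_eq_0_iff:
  assumes "r \<notin> {a, b, c}"
  shows "resolvent \<alpha> r x = 0 \<longleftrightarrow> x = 0"
proof -
  have "\<alpha> $ i \<noteq> r" for i using axis_cases[of i] assms by auto
  then show ?thesis by (simp add: resolvent_def vec_eq_iff)
qed

text \<open>The test vector turns the line towards the normal \<open>n\<close> in its point of tangency with the quadric \<open>r\<close>.
  If that point is \<open>x\<close> itself, this has no effect to first order, and \<open>x\<close> is moved along the normal.\<close>

lemma test_vector:
  assumes M: "(x, y) \<in> phase_space \<alpha>" and y: "y \<noteq> 0" and r: "r \<notin> {0, a, b, c}"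
    and root: "tangency \<alpha> r (x, y) = 0"
    and nondeg: "\<not> (confocal_form \<alpha> r x x = 1 \<and> confocal_form \<alpha> r x y = 0 \<and> confocal_form \<alpha> r y y = 0)"
  obtains x' y' where "(x', y') \<in> tangent_space (phase_space \<alpha>) (x, y)"
    "tangency_deriv \<alpha> r (x, y) (x', y') \<noteq> 0"
    "\<And>s. s \<notin> {0, a, b, c} \<Longrightarrow> s \<noteq> r \<Longrightarrow> tangency \<alpha> s (x, y) = 0 \<Longrightarrow> tangency_deriv \<alpha> s (x, y) (x', y') = 0"
    "J_int (x, y) = 0 \<Longrightarrow> x'$1 * y$2 + x$1 * y'$2 - x'$2 * y$1 - x$2 * y'$1 = 0"
proof -
  let ?B = "confocal_form \<alpha> r"
  have r': "r \<notin> {a, b, c}" "0 \<notin> {a, b, c}" "r \<noteq> 0" using r axis_facts(1-3) by simp_all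
  note com = confocal_form_commute[of \<alpha>]
  have M0: "confocal_form \<alpha> 0 x x = 1" "confocal_form \<alpha> 0 x y = 0" "confocal_form \<alpha> 0 y x = 0"
    using M com by (auto simp: phase_space_iff_confocal_form)
  \<comment> \<open>If the form does not vanish on y, v is a multiple of the point of tangency.
    Written without division it also covers an asymptotic line, which touches at infinity.\<close>
  define v where "v = ?B x y *\<^sub>R x + (1 - ?B x x) *\<^sub>R y"
  have Bxv: "?B x v = ?B x y" and Byv: "?B y v = 0"
  proof -
    show "?B x v = ?B x y" unfolding v_def by (simp add: confocal_form_simps algebra_simps)
    have "?B y v = tangency \<alpha> r (x, y)"
      unfolding v_def by (simp add: confocal_form_simps tangency_def com[of r y x] power2_eq_square)
    then show "?B y v = 0" using root by simp
  qed
  show ?thesis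
  proof (cases "v = 0")
    case False
    define n where "n = resolvent \<alpha> r v"
    have "confocal_form \<alpha> 0 x v = ?B x y"
      unfolding v_def by (simp add: confocal_form_simps M0)
    then have "confocal_form \<alpha> 0 x n = 0"
      unfolding n_def confocal_form_resolvent[OF r'] Bxv by simp
    then have 1: "(0, n) \<in> tangent_space (phase_space \<alpha>) (x, y)"
      using in_tangent_space[OF M, of 0 n] by (simp add: confocal_form_simps)
    have "tangency_deriv \<alpha> r (x, y) (0, n) = 2 * ?B v n"
      unfolding v_def by (simp add: tangency_deriv_def confocal_form_simps algebra_simps)
    also have "\<dots> = 2 * (norm n)\<^sup>2"
      unfolding n_def confocal_form_resolvent_self[OF r'(1)] ..
    finally have 2: "tangency_deriv \<alpha> r (x, y) (0, n) \<noteq> 0"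
      using False resolvent_eq_0_iff[OF r'(1), of v] by (simp add: n_def)
    have 3: "tangency_deriv \<alpha> s (x, y) (0, n) = 0"
      if s: "s \<notin> {0, a, b, c}" "s \<noteq> r" "tangency \<alpha> s (x, y) = 0" for s
    proof -
      let ?C = "confocal_form \<alpha> s"
      have s': "s \<notin> {a, b, c}" using s by auto
      have C: "?C x v = ?B x y * ?C x x + (1 - ?B x x) * ?C x y" "?C y v = ?B x y * ?C x y + (1 - ?B x x) * ?C y y"
        unfolding v_def by (simp_all add: confocal_form_simps com[of s y x])
      have "tangency_deriv \<alpha> s (x, y) (0, n) = 2 * (?C y n * (1 - ?C x x) + ?C x y * ?C x n)"
        by (simp add: tangency_deriv_def confocal_form_simps)
      also have "\<dots> = 2 * (?C y v * (1 - ?C x x) + ?C x y * (?C x v - ?B x y)) / (s - r)"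
        unfolding n_def confocal_form_resolvent[OF r'(1) s' s(2)[symmetric]] Bxv Byv
        by (simp add: add_divide_distrib)
      \<comment> \<open>By the resolvent identity the derivative at another parameter s is a
        multiple of the discriminant at s, so it vanishes at the other root.\<close>
      also have "?C y v * (1 - ?C x x) + ?C x y * (?C x v - ?B x y) = (1 - ?B x x) * tangency \<alpha> s (x, y)"
        unfolding C tangency_def prod.case by algebra
      finally show ?thesis using s(3) by simp
    qed
    have 4: "0$1 * y$2 + x$1 * n$2 - 0$2 * y$1 - x$2 * n$1 = 0" if "J_int (x, y) = 0"
    proof -
      have "x$1 * n$2 - x$2 * n$1 = (x$1 * v$2 - x$2 * v$1) / (b - r)"
        by (simp add: n_def resolvent_def eq12 diff_divide_distrib)
      also have "x$1 * v$2 - x$2 * v$1 = (1 - ?B x x) * J_int (x, y)"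
        by (simp add: v_def J_int_def algebra_simps)
      finally have "x$1 * n$2 - x$2 * n$1 = (1 - ?B x x) * J_int (x, y) / (b - r)" .
      then show ?thesis using that by simp
    qed
    show ?thesis using that[OF 1 2 3 4] by blast
  next
    case True
    have Bxy: "?B x y = 0"
    proof -
      have "confocal_form \<alpha> 0 x v = ?B x y" unfolding v_def by (simp add: confocal_form_simps M0)
      then show ?thesis using True by (simp add: confocal_form_simps)
    qed
    then have Bxx: "?B x x = 1" using True y by (simp add: v_def)
    have Byy: "?B y y \<noteq> 0" using nondeg Bxx Bxy by simp
    define m where "m = resolvent \<alpha> r x"
    have "x \<noteq> 0" using M0 by (auto simp: confocal_form_simps)
    then have m: "norm m \<noteq> 0" using resolvent_eq_0_iff[OF r'(1), of x] by (simp add: m_def)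
    have 1: "(m, 0) \<in> tangent_space (phase_space \<alpha>) (x, y)"
      by (intro in_tangent_space[OF M])
        (simp_all add: confocal_form_simps m_def confocal_form_resolvent[OF r'] M0 Bxx Bxy)
    have 2: "tangency_deriv \<alpha> r (x, y) (m, 0) \<noteq> 0"
      using m Byy unfolding m_def
      by (simp add: tangency_deriv_def confocal_form_simps confocal_form_resolvent_self[OF r'(1)] Bxx Bxy)
    have 3: "tangency_deriv \<alpha> s (x, y) (m, 0) = 0"
      if s: "s \<notin> {0, a, b, c}" "s \<noteq> r" "tangency \<alpha> s (x, y) = 0" for s
    proof -
      let ?C = "confocal_form \<alpha> s"
      have s': "s \<notin> {a, b, c}" using s by auto
      have "tangency_deriv \<alpha> s (x, y) (m, 0) = 2 * (?C x y * ?C m y - ?C y y * ?C x m)"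
        by (simp add: tangency_deriv_def confocal_form_simps)
      also have "\<dots> = 2 * (?C x y * ?C x y - ?C y y * (?C x x - 1)) / (s - r)"
        unfolding m_def confocal_form_resolvent[OF r'(1) s' s(2)[symmetric]] Bxx Bxy
        by (simp add: diff_divide_distrib right_diff_distrib)
      also have "?C x y * ?C x y - ?C y y * (?C x x - 1) = tangency \<alpha> s (x, y)"
        unfolding tangency_def prod.case by algebra
      finally show ?thesis using s(3) by simp
    qed
    have 4: "m$1 * y$2 + x$1 * 0$2 - m$2 * y$1 - x$2 * 0$1 = 0" if "J_int (x, y) = 0"
    proof -
      have "m$1 * y$2 - m$2 * y$1 = J_int (x, y) / (b - r)"
        by (simp add: m_def resolvent_def J_int_def eq12 diff_divide_distrib)
      then show ?thesis using that by simp
    qed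
    show ?thesis using that[OF 1 2 3 4] by blast
  qed
qed


text \<open>\<open>separation_poly_tangency\<close> holds only on the phase space, so it is
  differentiated along a curve inside it; the left-hand side is the chain rule for H, J^2 and
  G.\<close>

lemma tangent_relations:
  assumes M: "(x, y) \<in> phase_space \<alpha>" and V: "(x', y') \<in> tangent_space (phase_space \<alpha>) (x, y)"
  shows "frechet_derivative J_int (at (x, y)) (x', y') = x'$1 * y$2 + x$1 * y'$2 - x'$2 * y$1 - x$2 * y'$1"
    and "r \<notin> {0, a, b, c} \<Longrightarrow>
      2 * frechet_derivative H_int (at (x, y)) (x', y') * (b - r)\<^sup>2
      + (b - r) * ((b - a) * (c - b) / b * frechet_derivative (G_int \<alpha>) (at (x, y)) (x', y')
          - (1 - a * c / b\<^sup>2) * (2 * J_int (x, y) * frechet_derivative J_int (at (x, y)) (x', y')))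
      - (b - a) * (c - b) / b * (2 * J_int (x, y) * frechet_derivative J_int (at (x, y)) (x', y'))
      = - ((a - r) * (b - r)\<^sup>2 * (c - r) / r) * tangency_deriv \<alpha> r (x, y) (x', y')" (is "_ \<Longrightarrow> ?L = ?R")
proof -
  obtain \<gamma> where \<gamma>: "\<And>t. \<gamma> t \<in> phase_space \<alpha>" "\<gamma> 0 = (x, y)"
    "(\<gamma> has_vector_derivative (x', y')) (at 0)"
    using V unfolding tangent_space_def by blast
  note D = DERIV_along_curve[OF \<gamma>(3,2)]
  note DH = D[OF differentiable_integrals(1)] and DJ = D[OF differentiable_integrals(2)]
    and DG = D[OF differentiable_integrals(3), of \<alpha>]
  show "frechet_derivative J_int (at (x, y)) (x', y') = x'$1 * y$2 + x$1 * y'$2 - x'$2 * y$1 - x$2 * y'$1"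
    using DERIV_unique[OF DJ DERIV_J_int[OF \<gamma>(3,2)]] .
  assume r: "r \<notin> {0, a, b, c}"
  have JJ: "((\<lambda>t. (J_int (\<gamma> t))\<^sup>2) has_real_derivative
      2 * J_int (x, y) * frechet_derivative J_int (at (x, y)) (x', y')) (at 0)"
    using DERIV_power[OF DJ, of 2] by (simp add: \<gamma>(2) mult_ac)
  have 1: "((\<lambda>t. separation_poly r (\<gamma> t)) has_real_derivative
     ?L) (at 0)"
    unfolding separation_poly_def
    by (intro DERIV_diff DERIV_add DERIV_cmult DERIV_cmult_right DH DG JJ)
  have eq: "separation_poly r (\<gamma> t) = - ((a - r) * (b - r)\<^sup>2 * (c - r) / r) * tangency \<alpha> r (\<gamma> t)" for t
    using separation_poly_tangency[OF \<gamma>(1)] r by simp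
  have 2: "((\<lambda>t. separation_poly r (\<gamma> t)) has_real_derivative
     ?R) (at 0)"
    unfolding eq by (intro DERIV_cmult DERIV_tangency[OF \<gamma>(3,2)])
  show "?L = ?R"
    by (rule DERIV_unique[OF 1 2])
qed

text \<open>Euler's relation: the phase space is invariant under scaling y, H and G are quadratic in
  y and J is linear.\<close>

lemma scaling_derivatives:
  assumes M: "(x, y) \<in> phase_space \<alpha>"
  shows "(0, y) \<in> tangent_space (phase_space \<alpha>) (x, y)"
    and "frechet_derivative H_int (at (x, y)) (0, y) = 2 * H_int (x, y)"
    and "frechet_derivative J_int (at (x, y)) (0, y) = J_int (x, y)"
    and "frechet_derivative (G_int \<alpha>) (at (x, y)) (0, y) = 2 * G_int \<alpha> (x, y)"
proof -
  define \<gamma> where "\<gamma> t = (x, (1 + t) *\<^sub>R y)" for t :: real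
  have \<gamma>0: "\<gamma> 0 = (x, y)" by (simp add: \<gamma>_def)
  have \<gamma>M: "\<gamma> t \<in> phase_space \<alpha>" for t
    using M by (simp add: \<gamma>_def phase_space_iff_confocal_form confocal_form_simps)
  have "((\<lambda>t. (1 + t) *\<^sub>R y) has_vector_derivative y) (at 0)"
    by (auto intro!: derivative_eq_intros)
  then have \<gamma>': "(\<gamma> has_vector_derivative (0, y)) (at 0)"
    unfolding \<gamma>_def[abs_def] by (intro has_vector_derivative_Pair has_vector_derivative_const)
  show "(0, y) \<in> tangent_space (phase_space \<alpha>) (x, y)"
    unfolding tangent_space_def using \<gamma>0 \<gamma>M \<gamma>' by blast
  note D = DERIV_along_curve[OF \<gamma>' \<gamma>0]
  have sq: "((\<lambda>t. (1 + t)\<^sup>2 * k) has_real_derivative 2 * k) (at 0)" and lin: "((\<lambda>t. (1 + t) * k) has_real_derivative k) (at 0)"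
    for k :: real
    by (auto intro!: derivative_eq_intros)
  have "H_int (\<gamma> t) = (1 + t)\<^sup>2 * H_int (x, y)" for t
    unfolding \<gamma>_def H_int_def prod.case vector_scaleR_component real_scaleR_def power_mult_distrib
    by (simp add: distrib_left)
  then show "frechet_derivative H_int (at (x, y)) (0, y) = 2 * H_int (x, y)"
    using DERIV_unique[OF D[OF differentiable_integrals(1)]] sq by presburger
  have "J_int (\<gamma> t) = (1 + t) * J_int (x, y)" for t
    unfolding \<gamma>_def J_int_def prod.case by (simp add: algebra_simps)
  then show "frechet_derivative J_int (at (x, y)) (0, y) = J_int (x, y)"
    using DERIV_unique[OF D[OF differentiable_integrals(2)]] lin by presburger
  have "G_int \<alpha> (\<gamma> t) = (1 + t)\<^sup>2 * G_int \<alpha> (x, y)" for t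
  proof -
    have p: "u * (s * v) - w * (s * z) = s * (u * v - w * z)" for u s v w z :: real
      by algebra
    show ?thesis
      unfolding \<gamma>_def G_int_def prod.case vector_scaleR_component real_scaleR_def p power_mult_distrib
      by (simp add: distrib_left add_divide_distrib)
  qed
  then show "frechet_derivative (G_int \<alpha>) (at (x, y)) (0, y) = 2 * G_int \<alpha> (x, y)"
    using DERIV_unique[OF D[OF differentiable_integrals(3)]] sq by presburger
qed

text \<open>The three equations say that the whole line lies in the quadric r. Then the discriminant
  has a multiple zero in the parameter at r, and so does the separation polynomial; the conclusion
  is minus its derivative.\<close>

lemma degenerate_root:
  assumes M: "(x, y) \<in> phase_space \<alpha>" and r: "r \<notin> {0, a, b, c}"
    and "confocal_form \<alpha> r x x = 1" "confocal_form \<alpha> r x y = 0" "confocal_form \<alpha> r y y = 0"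
  shows "4 * H_int (x, y) * (b - r)
    + ((b - a) * (c - b) / b * G_int \<alpha> (x, y) - (1 - a * c / b\<^sup>2) * (J_int (x, y))\<^sup>2) = 0"
proof -
  let ?z = "(x, y)"
  define \<beta> where "\<beta> = (b - a) * (c - b) / b * G_int \<alpha> ?z - (1 - a * c / b\<^sup>2) * (J_int ?z)\<^sup>2"
  define d where "d x y = (\<Sum>i\<in>UNIV. x $ i * y $ i / (\<alpha> $ i - r)\<^sup>2)" for x y :: "real ^ 4"
  have ne: "\<alpha> $ i \<noteq> r" for i using axis_cases[of i] r by auto
  have dB: "((\<lambda>s. confocal_form \<alpha> s x y) has_real_derivative d x y) (at r)" for x y
  proof -
    have "((\<lambda>s. k / (\<alpha> $ i - s)) has_real_derivative k / (\<alpha> $ i - r)\<^sup>2) (at r)" for k i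
      using ne[of i] by (auto intro!: derivative_eq_intros simp: power2_eq_square)
    then show ?thesis unfolding confocal_form_def d_def by (intro DERIV_sum)
  qed
  have dT: "((\<lambda>s. tangency \<alpha> s ?z) has_real_derivative 0) (at r)"
    using DERIV_add[OF DERIV_mult[OF dB[of y y] DERIV_diff[OF DERIV_const[of "1::real"] dB[of x x]]] DERIV_power[OF dB[of x y], of 2]]
    by (simp add: tangency_def assms)
  have T0: "tangency \<alpha> r ?z = 0" by (simp add: tangency_def assms)
  define C where "C s = - ((a - s) * (b - s)\<^sup>2 * (c - s) / s)" for s
  have "\<exists>C'. (C has_real_derivative C') (at r)"
    unfolding C_def using r by (intro exI) (rule derivative_eq_intros refl | simp)+
  then obtain C' where C': "(C has_real_derivative C') (at r)" ..
  have 1: "((\<lambda>s. C s * tangency \<alpha> s ?z) has_real_derivative 0) (at r)"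
    using DERIV_mult[OF C' dT] by (simp add: T0)
  \<comment> \<open>The factorisation fails at these parameters, so the derivative is transferred on
    a neighbourhood of r that avoids them.\<close>
  have "open (- {0, a, b, c})" "r \<in> - {0, a, b, c}" using r by (auto intro!: open_Compl finite_imp_closed)
  then have "((\<lambda>s. separation_poly s ?z) has_real_derivative 0) (at r)"
    by (rule has_field_derivative_transform_within_open[OF 1])
      (use separation_poly_tangency[OF M] in \<open>auto simp: C_def\<close>)
  moreover have "((\<lambda>s. separation_poly s ?z) has_real_derivative
    2 * H_int ?z * (2 * (b - r) * (-1)) + (-1) * \<beta>) (at r)"
    unfolding separation_poly_def \<beta>_def by (rule derivative_eq_intros refl | simp)+
  ultimately have "0 = 2 * H_int ?z * (2 * (b - r) * (-1)) + (-1) * \<beta>"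
    by (rule DERIV_unique)
  then show ?thesis unfolding \<beta>_def by algebra
qed

text \<open>Applied to the rotated position as a change of velocity, dJ gives x_1^2 + x_2^2. Once
  this vanishes, the rotated velocity is an admissible change of position, and dJ gives minus y_1^2
  + y_2^2.\<close>

lemma double_zero_rotation:
  assumes M: "(x, y) \<in> phase_space \<alpha>"
    and J: "\<And>v. v \<in> tangent_space (phase_space \<alpha>) (x, y) \<Longrightarrow> frechet_derivative J_int (at (x, y)) v = 0"
  shows "x$1 = 0 \<and> x$2 = 0 \<and> y$1 = 0 \<and> y$2 = 0"
proof -
  define rot :: "real ^ 4 \<Rightarrow> real ^ 4" where "rot x = (\<chi> i. if i = 1 then - (x$2) else if i = 2 then x$1 else 0)" for x
  have c: "rot x $ 0 = 0" "rot x $ 1 = - (x$2)" "rot x $ 2 = x$1" "rot x $ 3 = 0" for x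
    by (simp_all add: rot_def)
  have B: "confocal_form \<alpha> 0 x (rot x) = 0" "confocal_form \<alpha> 0 (rot x) x = 0" for x
    by (simp_all add: confocal_form_def sum_UNIV_4 c eq12)
  have v1: "(0, rot x) \<in> tangent_space (phase_space \<alpha>) (x, y)"
    by (rule in_tangent_space[OF M]) (simp_all add: B confocal_form_simps)
  have "x$1 * x$1 + x$2 * x$2 = 0"
    using J[OF v1] tangent_relations(1)[OF M v1] by (simp add: c)
  then have x: "x$1 = 0 \<and> x$2 = 0" by (simp add: sum_squares_eq_zero_iff)
  then have "confocal_form \<alpha> 0 x (rot y) = 0"
    by (simp add: confocal_form_def sum_UNIV_4 c)
  then have v2: "(rot y, 0) \<in> tangent_space (phase_space \<alpha>) (x, y)"
    by (intro in_tangent_space[OF M]) (simp_all add: B confocal_form_simps)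
  have "- (y$2) * y$2 - y$1 * y$1 = 0"
    using J[OF v2] tangent_relations(1)[OF M v2] unfolding c by simp
  then have "y$1 * y$1 + y$2 * y$2 = 0" by linarith
  then have "y$1 = 0 \<and> y$2 = 0" by (simp only: sum_squares_eq_zero_iff)
  then show ?thesis using x by simp
qed


text \<open>Restates \<open>test_vector\<close> for roots of the separation polynomial; a simple
  root excludes the degenerate contact. The clause on J serves the case J = 0, where the
  differential of J^2 carries no information.\<close>

lemma simple_root_test_vector:
  assumes M: "(x, y) \<in> phase_space \<alpha>" and H: "H_int (x, y) > 0" and r: "r \<notin> {0, a, b, c}"
    and root: "separation_poly r (x, y) = 0"
    and simple: "4 * H_int (x, y) * (b - r)
    + ((b - a) * (c - b) / b * G_int \<alpha> (x, y) - (1 - a * c / b\<^sup>2) * (J_int (x, y))\<^sup>2) \<noteq> 0"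
  obtains v where "v \<in> tangent_space (phase_space \<alpha>) (x, y)" "tangency_deriv \<alpha> r (x, y) v \<noteq> 0"
    "\<And>s. s \<notin> {0, a, b, c} \<Longrightarrow> s \<noteq> r \<Longrightarrow> separation_poly s (x, y) = 0 \<Longrightarrow> tangency_deriv \<alpha> s (x, y) v = 0"
    "J_int (x, y) = 0 \<Longrightarrow> frechet_derivative J_int (at (x, y)) v = 0"
proof -
  have iff: "separation_poly s (x, y) = 0 \<longleftrightarrow> tangency \<alpha> s (x, y) = 0" if "s \<notin> {0, a, b, c}" for s
    using separation_poly_tangency[OF M, of s] that by auto
  have y: "y \<noteq> 0" using H by (auto simp: H_int_def)
  have nondeg: "\<not> (confocal_form \<alpha> r x x = 1 \<and> confocal_form \<alpha> r x y = 0 \<and> confocal_form \<alpha> r y y = 0)"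
    using degenerate_root[OF M r] simple by blast
  obtain x' y' where v: "(x', y') \<in> tangent_space (phase_space \<alpha>) (x, y)"
    "tangency_deriv \<alpha> r (x, y) (x', y') \<noteq> 0"
    "\<And>s. s \<notin> {0, a, b, c} \<Longrightarrow> s \<noteq> r \<Longrightarrow> tangency \<alpha> s (x, y) = 0 \<Longrightarrow> tangency_deriv \<alpha> s (x, y) (x', y') = 0"
    "J_int (x, y) = 0 \<Longrightarrow> x'$1 * y$2 + x$1 * y'$2 - x'$2 * y$1 - x$2 * y'$1 = 0"
    using test_vector[OF M y r iffD1[OF iff[OF r] root] nondeg] by blast
  show ?thesis
    by (rule that[OF v(1,2)]) (use v iff tangent_relations(1)[OF M v(1)] in auto)
qed

text \<open>Off the boundary the polynomial q is positive at a and c, and q(b) is a negative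
  multiple of J^2. For J nonzero this yields two simple roots and two test vectors, which with
  scaling make the differentials of H, J^2 and G independent; for J = 0 one root is b.\<close>

lemma singular_point_cases:
  assumes sing: "singular_point \<alpha> z" and H: "H_int z > 0"
  shows "F0_int \<alpha> z = 0 \<or> F3_int \<alpha> z = 0 \<or> J_int z = 0 \<and> G_int \<alpha> z = 0"
proof (rule ccontr)
  assume contra: "\<not> ?thesis"
  obtain x y where z: "z = (x, y)" by (cases z)
  have M: "z \<in> phase_space \<alpha>" using sing by (simp add: singular_point_def)
  obtain l1 l2 l3 where l: "(l1, l2, l3) \<noteq> (0, 0, 0)"
    "\<And>v. v \<in> tangent_space (phase_space \<alpha>) z \<Longrightarrow> l1 * frechet_derivative H_int (at z) v
       + l2 * frechet_derivative J_int (at z) v + l3 * frechet_derivative (G_int \<alpha>) (at z) v = 0"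
    using sing unfolding singular_point_def by blast
  have F: "F0_int \<alpha> z < 0" "F3_int \<alpha> z > 0"
    using contra F0_int_nonpos[OF M] F3_int_nonneg[of z] by auto
  define k where "k = (b - a) * (c - b) / b"
  define m where "m = 1 - a * c / b\<^sup>2"
  define q where "q r = separation_poly r z" for r
  define h j g where "h = H_int z" and "j = J_int z" and "g = G_int \<alpha> z"
  have q: "q r = 2 * h * (b - r)\<^sup>2 + (b - r) * (k * g - m * j\<^sup>2) - k * j\<^sup>2" for r
    by (simp add: q_def separation_poly_def h_def j_def g_def k_def m_def)
  have k: "k > 0" using axis_facts by (simp add: k_def)
  have h: "h > 0" using H by (simp add: h_def)
  have qa: "q a > 0"
  proof -
    have "a * q a = - F0_int \<alpha> z * ((b - a)\<^sup>2 * (c - a))"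
      using separation_poly_integrals[OF M, of a] by (simp add: q_def)
    moreover have "\<dots> > 0" using F axis_facts by (intro mult_pos_pos) auto
    ultimately show ?thesis using zero_less_mult_pos[of a "q a"] axis_facts(1) by simp
  qed
  have qc: "q c > 0"
  proof -
    have "c * q c = F3_int \<alpha> z * ((c - a) * (b - c)\<^sup>2)"
      using separation_poly_integrals[OF M, of c] by (simp add: q_def algebra_simps)
    moreover have "\<dots> > 0" using F axis_facts by (intro mult_pos_pos) auto
    ultimately show ?thesis using zero_less_mult_pos[of c "q c"] axis_facts(3) by simp
  qed
  have cont: "continuous_on S q" for S
    unfolding q by (intro continuous_intros)
  note lin = l(2)[unfolded z]
  note Mxy = M[unfolded z] and Hxy = H[unfolded z]
  show False
  proof (cases "j = 0")
    case False
    \<comment> \<open>The sign changes place one root on each side of b, so both are simple and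
      differ from all axis parameters.\<close>
    have qb: "q b < 0" using False k by (simp add: q)
    obtain r1 where r1: "a \<le> r1" "r1 \<le> b" "q r1 = 0"
      using IVT2'[of q b 0 a] qa qb axis_facts(10) cont[of "{a..b}"] by (meson less_imp_le)
    obtain r2 where r2: "b \<le> r2" "r2 \<le> c" "q r2 = 0"
      using IVT'[of q b 0 c] qc qb axis_facts(11) cont[of "{b..c}"] by (meson less_imp_le)
    have "r1 \<noteq> a" "r1 \<noteq> b" "r2 \<noteq> b" "r2 \<noteq> c"
      using r1(3) r2(3) qa qb qc by auto
    then have ne: "r1 \<notin> {0, a, b, c}" "r2 \<notin> {0, a, b, c}" "r1 < r2"
      using r1(1,2) r2(1,2) axis_facts(1,10-12) by simp_all
    have "(r2 - r1) * (2 * h * ((b - r1) + (b - r2)) + (k * g - m * j\<^sup>2)) = 0"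
      using r1(3) r2(3) unfolding q by algebra
    then have sum: "k * g - m * j\<^sup>2 = - 2 * h * ((b - r1) + (b - r2))" using ne by simp
    have simple: "4 * h * (b - r) + (k * g - m * j\<^sup>2) \<noteq> 0" if "r \<in> {r1, r2}" for r
    proof -
      have "4 * h * (b - r1) + (k * g - m * j\<^sup>2) = 2 * h * (r2 - r1)"
        "4 * h * (b - r2) + (k * g - m * j\<^sup>2) = - (2 * h * (r2 - r1))"
        unfolding sum by (simp_all add: algebra_simps)
      then show ?thesis using that h ne(3) by auto
    qed
    define dP where "dP v r = 2 * frechet_derivative H_int (at (x, y)) v * (b - r)\<^sup>2
      + (b - r) * (k * frechet_derivative (G_int \<alpha>) (at (x, y)) v
          - m * (2 * j * frechet_derivative J_int (at (x, y)) v))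
      - k * (2 * j * frechet_derivative J_int (at (x, y)) v)" for v r
    have dP: "dP v r = 0 \<longleftrightarrow> tangency_deriv \<alpha> r (x, y) v = 0"
      if "v \<in> tangent_space (phase_space \<alpha>) (x, y)" "r \<notin> {0, a, b, c}" for v r
      using tangent_relations(2)[OF Mxy, of "fst v" "snd v" r] that
      by (simp add: dP_def j_def k_def m_def z)
    obtain v1 where v1: "v1 \<in> tangent_space (phase_space \<alpha>) (x, y)" "dP v1 r1 \<noteq> 0" "dP v1 r2 = 0"
    proof (rule simple_root_test_vector[OF Mxy Hxy ne(1)], goal_cases)
      case 1 show ?case using r1(3) by (simp add: q_def z)
    next
      case 2 show ?case using simple[of r1] by (simp add: h_def j_def g_def k_def m_def z)
    next
      case (3 v)
      have "separation_poly r2 (x, y) = 0" using r2(3) by (simp add: q_def z)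
      then have "tangency_deriv \<alpha> r2 (x, y) v = 0" using 3(4) ne by blast
      then show ?case using dP[OF 3(2) ne(1)] dP[OF 3(2) ne(2)] 3(2,3) by (intro 3(1)) blast+
    qed
    obtain v2 where v2: "v2 \<in> tangent_space (phase_space \<alpha>) (x, y)" "dP v2 r2 \<noteq> 0" "dP v2 r1 = 0"
    proof (rule simple_root_test_vector[OF Mxy Hxy ne(2)], goal_cases)
      case 1 show ?case using r2(3) by (simp add: q_def z)
    next
      case 2 show ?case using simple[of r2] by (simp add: h_def j_def g_def k_def m_def z)
    next
      case (3 v)
      have "separation_poly r1 (x, y) = 0" using r1(3) by (simp add: q_def z)
      then have "tangency_deriv \<alpha> r1 (x, y) v = 0" using 3(4) ne by blast
      then show ?case using dP[OF 3(2) ne(1)] dP[OF 3(2) ne(2)] 3(2,3) by (intro 3(1)) blast+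
    qed
    \<comment> \<open>The functional is expressed in the differential of J^2, which is 2 j dJ with j
      nonzero.\<close>
    define l2' where "l2' = l2 / (2 * j)"
    have l2: "l2 * w = l2' * (2 * j * w)" for w using False by (simp add: l2'_def)
    note E = scaling_derivatives[OF Mxy]
    have "l1 = 0 \<and> l2' = 0 \<and> l3 = 0"
    proof (rule quadratic_functional_zero[where k = k and m = m and ?\<rho>1.0 = "b - r1" and ?\<rho>2.0 = "b - r2"
          and ?h0.0 = "2 * h" and ?j0.0 = "2 * j * j" and ?g0.0 = "2 * g"
          and ?h1.0 = "frechet_derivative H_int (at (x, y)) v1" and ?j1.0 = "2 * j * frechet_derivative J_int (at (x, y)) v1"
          and ?g1.0 = "frechet_derivative (G_int \<alpha>) (at (x, y)) v1"
          and ?h2.0 = "frechet_derivative H_int (at (x, y)) v2" and ?j2.0 = "2 * j * frechet_derivative J_int (at (x, y)) v2"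
          and ?g2.0 = "frechet_derivative (G_int \<alpha>) (at (x, y)) v2"], goal_cases)
      case 1 show ?case using k by simp
    next
      case 2 show ?case using ne by simp
    next
      case 3 show ?case using r1(3) unfolding q prod.case by algebra
    next
      case 4 show ?case using r2(3) unfolding q prod.case by algebra
    next
      case 5 show ?case using h by simp
    next
      case 6 show ?case using lin[OF E(1)] unfolding E(2-4) l2 by (simp add: h_def j_def g_def z)
    next
      case 7 show ?case using v1(2) by (simp add: dP_def)
    next
      case 8 show ?case using v1(3) by (simp add: dP_def)
    next
      case 9 show ?case using lin[OF v1(1)] unfolding l2 .
    next
      case 10 show ?case using v2(2) by (simp add: dP_def)
    next
      case 11 show ?case using v2(3) by (simp add: dP_def)
    next
      case 12 show ?case using lin[OF v2(1)] unfolding l2 .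
    qed
    then show False using l(1) False by (simp add: l2'_def)
  next
    case True
    then have g: "g \<noteq> 0" using contra by (simp add: j_def g_def)
    define \<rho> where "\<rho> = - (k * g) / (2 * h)"
    have \<rho>: "2 * h * \<rho> = - (k * g)" "\<rho> \<noteq> 0" using h k g by (simp_all add: \<rho>_def)
    define r where "r = b - \<rho>"
    \<comment> \<open>One root is the excluded parameter b; positivity at a and c puts the other
      one, r, strictly between a and c, and G nonzero keeps it from b.\<close>
    have q': "q s = 2 * h * (b - s) * (r - s)" for s
      unfolding q using \<rho>(1) True by (simp add: r_def) algebra
    have "0 < 2 * h * (b - a) * (r - a)" "0 < 2 * h * (c - b) * (c - r)"
      using qa qc unfolding q' by (simp_all add: algebra_simps)
    moreover have "0 < 2 * h * (b - a)" "0 < 2 * h * (c - b)" using h axis_facts(4,5) by simp_all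
    ultimately have "a < r" "r < c" using zero_less_mult_pos diff_gt_0_iff_gt by blast+
    moreover have "r \<noteq> b" using \<rho>(2) by (simp add: r_def)
    ultimately have r: "r \<notin> {0, a, b, c}" using axis_facts(1) by simp
    have simple: "4 * h * (b - r) + (k * g - m * j\<^sup>2) \<noteq> 0"
    proof -
      have "4 * h * (b - r) + (k * g - m * j\<^sup>2) = 4 * h * \<rho> + k * g"
        using True by (simp add: r_def)
      also have "\<dots> = 2 * h * \<rho>" using \<rho>(1) by linarith
      finally have "4 * h * (b - r) + (k * g - m * j\<^sup>2) = 2 * h * \<rho>" .
      then show ?thesis using h \<rho>(2) by simp
    qed
    have q0: "q r = 0" by (simp add: q')
    obtain v where v: "v \<in> tangent_space (phase_space \<alpha>) (x, y)" "tangency_deriv \<alpha> r (x, y) v \<noteq> 0"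
      "frechet_derivative J_int (at (x, y)) v = 0"
    proof (rule simple_root_test_vector[OF Mxy Hxy r], goal_cases)
      case 1 show ?case using q0 by (simp add: q_def z)
    next
      case 2 show ?case using simple by (simp add: h_def j_def g_def k_def m_def z)
    next
      case (3 v)
      then show ?case using True by (auto simp: j_def z)
    qed
    define h' g' where "h' = frechet_derivative H_int (at (x, y)) v" and "g' = frechet_derivative (G_int \<alpha>) (at (x, y)) v"
    have "2 * h' * \<rho>\<^sup>2 + \<rho> * (k * g') \<noteq> 0"
      using tangent_relations(2)[OF Mxy, of "fst v" "snd v" r] v r
      by (simp add: h'_def g'_def k_def r_def)
    moreover have "2 * h' * \<rho>\<^sup>2 + \<rho> * (k * g') = \<rho> * (2 * h' * \<rho> + k * g')" by algebra
    ultimately have ne: "2 * h' * \<rho> + k * g' \<noteq> 0" by auto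
    note E = scaling_derivatives[OF Mxy]
    have 1: "l1 * h + l3 * g = 0"
      using lin[OF E(1)] True unfolding E(2-4) by (simp add: h_def j_def g_def z) 
    have 2: "l1 * h' + l3 * g' = 0"
      using lin[OF v(1)] v(3) by (simp add: h'_def g'_def)
    \<comment> \<open>Scaling and v both have dJ = 0, so they isolate l1 and l3. Any remaining
      multiple of dJ is excluded by \<open>double_zero_rotation\<close>, which would give G =
      0.\<close>
    have "h * (l3 * (2 * h' * \<rho> + k * g')) = 0"
      using 1 2 \<rho>(1) by algebra
    then have "l3 = 0" using h ne by simp
    moreover from this have "l1 = 0" using 1 h by simp
    ultimately have "l2 \<noteq> 0" using l(1) by simp
    have "\<And>v. v \<in> tangent_space (phase_space \<alpha>) (x, y) \<Longrightarrow> l2 * frechet_derivative J_int (at (x, y)) v = 0"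
      using lin unfolding \<open>l1 = 0\<close> \<open>l3 = 0\<close> by simp
    then have "x$1 = 0 \<and> x$2 = 0 \<and> y$1 = 0 \<and> y$2 = 0"
      using double_zero_rotation[OF Mxy] \<open>l2 \<noteq> 0\<close> by simp
    then have "G_int \<alpha> z = 0" by (simp add: z G_int_def)
    then show False using g by (simp add: g_def)
  qed
qed

section \<open>Points that are singular\<close>

text \<open>The signed distance from the curve has a global minimum zero at z, so its differential
  vanishes on tangent vectors. It is nontrivial because G enters with coefficient 1.\<close>

lemma singular_point_minimum:
  assumes M: "z \<in> phase_space \<alpha>" and z: "G_int \<alpha> z = curve_fun \<alpha> (H_int z) k (J_int z)"
    and s: "s \<noteq> 0" "\<And>w. w \<in> phase_space \<alpha> \<Longrightarrow> s * (G_int \<alpha> w - curve_fun \<alpha> (H_int w) k (J_int w)) \<ge> 0"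
  shows "singular_point \<alpha> z"
  unfolding singular_point_def
proof (intro conjI exI ballI M)
  \<comment> \<open>The coefficients of h and of -j^2 in \<open>curve_fun\<close>; the covector is
    the gradient of the distance with respect to H, J, G.\<close>
  define A B where "A = 2 * b / (b - \<alpha>$k)" and "B = \<alpha>$k / (b * (b - \<alpha>$k))"
  show "(- A, 2 * B * J_int z, 1 :: real) \<noteq> (0, 0, 0)" by simp
  fix v assume "v \<in> tangent_space (phase_space \<alpha>) z"
  then obtain \<gamma> where \<gamma>: "\<And>t. \<gamma> t \<in> phase_space \<alpha>" "\<gamma> 0 = z"
    "(\<gamma> has_vector_derivative v) (at 0)"
    unfolding tangent_space_def by blast
  note D = DERIV_along_curve[OF \<gamma>(3,2)]
  note DH = D[OF differentiable_integrals(1)] and DJ = D[OF differentiable_integrals(2)]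
    and DG = D[OF differentiable_integrals(3), of \<alpha>]
  define f where "f t = s * (G_int \<alpha> (\<gamma> t) - (A * H_int (\<gamma> t) - B * (J_int (\<gamma> t))\<^sup>2))" for t
  have f: "f t = s * (G_int \<alpha> (\<gamma> t) - curve_fun \<alpha> (H_int (\<gamma> t)) k (J_int (\<gamma> t)))" for t
    by (simp add: f_def curve_fun_def A_def B_def)
  have JJ: "((\<lambda>t. (J_int (\<gamma> t))\<^sup>2) has_real_derivative
      2 * J_int z * frechet_derivative J_int (at z) v) (at 0)"
    using DERIV_power[OF DJ, of 2] by (simp add: \<gamma>(2) mult_ac)
  have Df: "(f has_real_derivative s * (frechet_derivative (G_int \<alpha>) (at z) v
     - (A * frechet_derivative H_int (at z) v - B * (2 * J_int z * frechet_derivative J_int (at z) v)))) (at 0)"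
    unfolding f_def[abs_def] by (intro DERIV_cmult DERIV_diff DG DH JJ)
  have "\<forall>t. \<bar>0 - t\<bar> < 1 \<longrightarrow> f 0 \<le> f t"
    unfolding f using s(2)[OF \<gamma>(1)] by (simp add: \<gamma>(2) z)
  then have "s * (frechet_derivative (G_int \<alpha>) (at z) v
     - (A * frechet_derivative H_int (at z) v - B * (2 * J_int z * frechet_derivative J_int (at z) v))) = 0"
    by (rule DERIV_local_min[OF Df zero_less_one])
  then show "- A * frechet_derivative H_int (at z) v + 2 * B * J_int z * frechet_derivative J_int (at z) v
      + 1 * frechet_derivative (G_int \<alpha>) (at z) v = 0"
    using s(1) unfolding mult_eq_0_iff by (simp add: algebra_simps)
qed

lemma singular_point_rotation_axis:
  assumes M: "(x, y) \<in> phase_space \<alpha>" and z: "x$1 = 0" "x$2 = 0" "y$1 = 0" "y$2 = 0"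
  shows "singular_point \<alpha> (x, y)"
  unfolding singular_point_def
proof (intro conjI exI ballI M)
  show "(0 :: real, 1 :: real, 0 :: real) \<noteq> (0, 0, 0)" by simp
  fix v assume "v \<in> tangent_space (phase_space \<alpha>) (x, y)"
  then show "0 * frechet_derivative H_int (at (x, y)) v + 1 * frechet_derivative J_int (at (x, y)) v
      + 0 * frechet_derivative (G_int \<alpha>) (at (x, y)) v = 0"
    using tangent_relations(1)[OF M, of "fst v" "snd v"] z by simp
qed

lemma singular_values_slice:
  assumes h: "h > 0"
  shows "{(j, g). (h, j, g) \<in> singular_values \<alpha>} = boundary_curves \<alpha> h \<union> {(0, 0)}"
proof (intro equalityI subsetI)
  fix t assume "t \<in> {(j, g). (h, j, g) \<in> singular_values \<alpha>}"
  then obtain z where z: "singular_point \<alpha> z" "H_int z = h" "t = (J_int z, G_int \<alpha> z)"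
    by (auto simp: singular_values_def EM_def)
  have M: "z \<in> phase_space \<alpha>" using z by (simp add: singular_point_def)
  have "t \<in> region \<alpha> h" using energy_image[OF h] M z by blast
  moreover have "F0_int \<alpha> z = 0 \<or> F3_int \<alpha> z = 0 \<or> t = (0, 0)"
    using singular_point_cases[OF z(1)] z h by auto
  ultimately show "t \<in> boundary_curves \<alpha> h \<union> {(0, 0)}"
    using curve_distances[OF M] z by (auto simp: boundary_curves_def curve_def)
next
  fix t assume t: "t \<in> boundary_curves \<alpha> h \<union> {(0, 0)}"
  show "t \<in> {(j, g). (h, j, g) \<in> singular_values \<alpha>}"
  proof (cases "t \<in> boundary_curves \<alpha> h")
    case True
    then have "t \<in> region \<alpha> h" by (simp add: boundary_curves_def)
    then obtain z where z: "z \<in> phase_space \<alpha>" "H_int z = h" "t = (J_int z, G_int \<alpha> z)"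
      using energy_image[OF h] by blast
    have pos: "b * (c - a) / (a * (c - b)) \<ge> 0" "b * (c - a) / (c * (b - a)) \<ge> 0"
      using axis_facts by simp_all
    have "singular_point \<alpha> z"
    proof (cases "t \<in> curve \<alpha> h 3")
      case True
      show ?thesis
      proof (rule singular_point_minimum[OF z(1), of 3 1])
        show "G_int \<alpha> z = curve_fun \<alpha> (H_int z) 3 (J_int z)"
          using True z by (simp add: curve_def)
        fix w assume w: "w \<in> phase_space \<alpha>"
        show "0 \<le> 1 * (G_int \<alpha> w - curve_fun \<alpha> (H_int w) 3 (J_int w))"
          using curve_distances(1)[OF w] mult_nonneg_nonpos[OF pos(1) F0_int_nonpos[OF w]] by simp
      qed simp
    next
      case False
      show ?thesis
      proof (rule singular_point_minimum[OF z(1), of 0 "-1"])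
        show "G_int \<alpha> z = curve_fun \<alpha> (H_int z) 0 (J_int z)"
          using False \<open>t \<in> boundary_curves \<alpha> h\<close> z by (auto simp: curve_def boundary_curves_def)
        fix w assume w: "w \<in> phase_space \<alpha>"
        show "0 \<le> -1 * (G_int \<alpha> w - curve_fun \<alpha> (H_int w) 0 (J_int w))"
          using curve_distances(2)[OF w] mult_nonneg_nonneg[OF pos(2) F3_int_nonneg[of w]] by simp
      qed simp
    qed
    then show ?thesis using z by (force simp: singular_values_def EM_def)
  next
    case False
    \<comment> \<open>A witness over the origin: the vertex on axis 0, moving in direction 3, inside
      the plane fixed by the rotation.\<close>
    define x :: "real ^ 4" where "x = (\<chi> i. if i = 0 then sqrt a else 0)"
    define y :: "real ^ 4" where "y = (\<chi> i. if i = 3 then sqrt (2 * h) else 0)"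
    have comps: "x$0 = sqrt a" "x$1 = 0" "x$2 = 0" "x$3 = 0" "y$0 = 0" "y$1 = 0" "y$2 = 0" "y$3 = sqrt (2 * h)"
      by (simp_all add: x_def y_def)
    have "(x, y) \<in> phase_space \<alpha>"
      using axis_facts by (simp add: phase_space_iff comps)
    then have "singular_point \<alpha> (x, y)"
      by (rule singular_point_rotation_axis) (simp_all add: comps)
    moreover have "EM \<alpha> (x, y) = (h, 0, 0)"
      using h by (simp add: EM_def H_int_def J_int_def G_int_def comps)
    ultimately show ?thesis
      using False t by (force simp: singular_values_def)
  qed
qed

lemma zero_isolated:
  assumes h: "h > 0"
  shows "(0, 0) isolated_in {(j, g). (h, j, g) \<in> singular_values \<alpha>}"
  unfolding isolated_in_def singular_values_slice[OF h]
  using open_strict_region[of h] zero_in_interior_region[OF h]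
  by (auto simp: boundary_curves_def curve_def intro!: exI[of _ "{(j, g). curve_fun \<alpha> h 3 j < g \<and> g < curve_fun \<alpha> h 0 j}"])

subsection \<open>Singular fibres\<close>

lemma phase_of_in_phase_space:
  "phase_of u z v p w q \<in> phase_space \<alpha> \<longleftrightarrow>
    u\<^sup>2 / a + (cmod z)\<^sup>2 / b + v\<^sup>2 / c = 1 \<and> u * p / a + Re (cnj z * w) / b + v * q / c = 0"
  using phase_space_iff[of "fst (phase_of u z v p w q)" "snd (phase_of u z v p w q)"]
  by (simp add: phase_of_components cmod_power2)

lemma fibre_curve_3:
  assumes h: "h > 0" and g: "g = curve_fun \<alpha> h 3 j"
  shows "fibre \<alpha> (h, j, g) = (\<lambda>(v, q, z, w). phase_of 0 z v 0 w q) ` revolution_level c b h j"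
proof (intro equalityI subsetI)
  fix t assume t: "t \<in> fibre \<alpha> (h, j, g)"
  obtain u z v p w q where tp: "t = phase_of u z v p w q" by (rule phase_of_exhaust)
  have M: "t \<in> phase_space \<alpha>" and E: "H_int t = h" "J_int t = j" "G_int \<alpha> t = g"
    using t by (auto simp: fibre_def EM_def)
  have "b * (c - a) / (a * (c - b)) * F0_int \<alpha> t = 0"
    using curve_distances(1)[OF M] E g by simp
  then have "F0_int \<alpha> t = 0" using axis_facts by simp
  then have "fst t $ 0 = 0 \<and> snd t $ 0 = 0"
    using F0_int_eq_0_iff[of "fst t" "snd t"] M E h by simp
  then have up: "u = 0" "p = 0" by (simp_all add: tp phase_of_components)
  have "(v, q, z, w) \<in> revolution_level c b h j"
    using M E unfolding tp up phase_of_in_phase_space H_int_phase_of J_int_phase_of revolution_level_def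
    by (simp add: add.commute)
  then show "t \<in> (\<lambda>(v, q, z, w). phase_of 0 z v 0 w q) ` revolution_level c b h j"
    unfolding tp up by force
next
  fix t assume "t \<in> (\<lambda>(v, q, z, w). phase_of 0 z v 0 w q) ` revolution_level c b h j"
  then obtain v q z w where t: "t = phase_of 0 z v 0 w q" and E: "(v, q, z, w) \<in> revolution_level c b h j" by auto
  have M: "t \<in> phase_space \<alpha>" and H: "H_int t = h" "J_int t = j"
    using E unfolding t phase_of_in_phase_space H_int_phase_of J_int_phase_of revolution_level_def
    by (simp_all add: add.commute)
  have "F0_int \<alpha> t = 0"
    by (simp add: F0_int_def split_beta t phase_of_components)
  then have "G_int \<alpha> t = g" using curve_distances(1)[OF M] H g by simp
  then show "t \<in> fibre \<alpha> (h, j, g)" using M H by (simp add: fibre_def EM_def)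
qed

lemma fibre_curve_0:
  assumes h: "h > 0" and g: "g = curve_fun \<alpha> h 0 j"
  shows "fibre \<alpha> (h, j, g) = (\<lambda>(u, p, z, w). phase_of u z 0 p w 0) ` revolution_level a b h j"
proof (intro equalityI subsetI)
  fix t assume t: "t \<in> fibre \<alpha> (h, j, g)"
  obtain u z v p w q where tp: "t = phase_of u z v p w q" by (rule phase_of_exhaust)
  have M: "t \<in> phase_space \<alpha>" and E: "H_int t = h" "J_int t = j" "G_int \<alpha> t = g"
    using t by (auto simp: fibre_def EM_def)
  have "b * (c - a) / (c * (b - a)) * F3_int \<alpha> t = 0"
    using curve_distances(2)[OF M] E g by simp
  then have "F3_int \<alpha> t = 0" using axis_facts by simp
  then have "fst t $ 3 = 0 \<and> snd t $ 3 = 0"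
    using F3_int_eq_0_iff[of "fst t" "snd t"] E h by simp
  then have vq: "v = 0" "q = 0" by (simp_all add: tp phase_of_components)
  have "(u, p, z, w) \<in> revolution_level a b h j"
    using M E unfolding tp vq phase_of_in_phase_space H_int_phase_of J_int_phase_of revolution_level_def
    by simp
  then show "t \<in> (\<lambda>(u, p, z, w). phase_of u z 0 p w 0) ` revolution_level a b h j"
    unfolding tp vq by force
next
  fix t assume "t \<in> (\<lambda>(u, p, z, w). phase_of u z 0 p w 0) ` revolution_level a b h j"
  then obtain u p z w where t: "t = phase_of u z 0 p w 0" and E: "(u, p, z, w) \<in> revolution_level a b h j" by auto
  have M: "t \<in> phase_space \<alpha>" and H: "H_int t = h" "J_int t = j"
    using E unfolding t phase_of_in_phase_space H_int_phase_of J_int_phase_of revolution_level_def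
    by simp_all
  have "F3_int \<alpha> t = 0"
    by (simp add: F3_int_def split_beta t phase_of_components)
  then have "G_int \<alpha> t = g" using curve_distances(2)[OF M] H g by simp
  then show "t \<in> fibre \<alpha> (h, j, g)" using M H by (simp add: fibre_def EM_def)
qed

lemma fibre_homeomorphic_revolution_level:
  assumes h: "h > 0" and g: "(j, g) \<in> curve \<alpha> h 3 \<union> curve \<alpha> h 0"
  obtains \<kappa> where "\<kappa> > 0" "fibre \<alpha> (h, j, g) homeomorphic revolution_level \<kappa> b h j"
proof -
  have hom: "f ` revolution_level \<kappa> b h j homeomorphic revolution_level \<kappa> b h j"
    if "\<kappa> > 0" "continuous_on (revolution_level \<kappa> b h j) f" "inj f" for \<kappa> and f :: "_ \<Rightarrow> phase"
    using homeomorphic_compact[OF compact_revolution_level[OF that(1) axis_facts(2) h] that(2) refl] that(3)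
    by (meson homeomorphic_sym inj_on_subset subset_UNIV)
  show ?thesis
  proof (cases "(j, g) \<in> curve \<alpha> h 3")
    case True
    have "continuous_on S (\<lambda>(v, q, z, w). phase_of 0 z v 0 w q)" for S
      unfolding split_beta by (intro continuous_intros)
    then have "fibre \<alpha> (h, j, g) homeomorphic revolution_level c b h j"
      using fibre_curve_3[OF h] True axis_facts by (auto simp: curve_def inj_def intro!: hom)
    then show ?thesis using that axis_facts by blast
  next
    case False
    have "continuous_on S (\<lambda>(u, p, z, w). phase_of u z 0 p w 0)" for S
      unfolding split_beta by (intro continuous_intros)
    then have "fibre \<alpha> (h, j, g) homeomorphic revolution_level a b h j"
      using fibre_curve_0[OF h] False g axis_facts by (auto simp: curve_def inj_def intro!: hom)
    then show ?thesis using that axis_facts by blast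
  qed
qed

lemma boundary_fibre_torus:
  assumes h: "h > 0" and "(j, g) \<in> boundary_curves \<alpha> h - curve \<alpha> h 3 \<inter> curve \<alpha> h 0"
  shows "fibre \<alpha> (h, j, g) homeomorphic torus"
proof -
  have "(j, g) \<in> curve \<alpha> h 3 \<union> curve \<alpha> h 0" using assms by (auto simp: boundary_curves_def)
  then obtain \<kappa> where \<kappa>: "\<kappa> > 0" "fibre \<alpha> (h, j, g) homeomorphic revolution_level \<kappa> b h j"
    using fibre_homeomorphic_revolution_level[OF h] by blast
  have "j\<^sup>2 < 2 * h * b"
    using curve_fun_le_iff[of h j] curve_fun_eq_iff[of h j] assms(2)
    by (auto simp: boundary_curves_def region_def curve_def)
  then have "revolution_level \<kappa> b h j homeomorphic torus"
    using revolution_level_torus[OF \<kappa>(1) axis_facts(2) h] by blast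
  then show ?thesis using \<kappa>(2) homeomorphic_trans by blast
qed

lemma corner_fibre_circle:
  assumes h: "h > 0" and "(j, g) \<in> curve \<alpha> h 3 \<inter> curve \<alpha> h 0"
  shows "fibre \<alpha> (h, j, g) homeomorphic circle"
proof -
  have "(j, g) \<in> curve \<alpha> h 3 \<union> curve \<alpha> h 0" using assms by auto
  then obtain \<kappa> where \<kappa>: "\<kappa> > 0" "fibre \<alpha> (h, j, g) homeomorphic revolution_level \<kappa> b h j"
    using fibre_homeomorphic_revolution_level[OF h] by blast
  have "j\<^sup>2 = 2 * h * b"
    using curve_fun_eq_iff[of h j] assms(2) by (auto simp: curve_def)
  then have "revolution_level \<kappa> b h j homeomorphic circle"
    using revolution_level_circle[OF \<kappa>(1) axis_facts(2) h] by blast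
  then show ?thesis using \<kappa>(2) homeomorphic_trans by blast
qed

section \<open>The fibre over the origin in affine coordinates\<close>

text \<open>Undoes the scaling of the ellipsoid to the unit sphere; r is the length of the velocity
  in the scaled coordinates, split off so that (\<xi>', W) can be a unit vector.\<close>

definition affine_phase :: "real \<Rightarrow> complex \<times> complex \<times> complex \<times> complex \<Rightarrow> phase" where
  "affine_phase r = (\<lambda>(\<xi>, Z, \<xi>', W). phase_of (sqrt a * Re \<xi>) (sqrt b *\<^sub>R Z) (sqrt c * Im \<xi>)
     (sqrt a * (r * Re \<xi>')) (sqrt b *\<^sub>R r *\<^sub>R W) (sqrt c * (r * Im \<xi>')))"

definition affine_energy :: "complex \<times> complex \<times> complex \<times> complex \<Rightarrow> real" where
  "affine_energy = (\<lambda>(\<xi>, Z, \<xi>', W). a * (Re \<xi>')\<^sup>2 + c * (Im \<xi>')\<^sup>2 + b * (cmod W)\<^sup>2)"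

lemma continuous_on_affine_phase:
  assumes "continuous_on S f"
  shows "continuous_on S (\<lambda>v. affine_phase (f v) v)"
  unfolding affine_phase_def split_beta by (intro continuous_intros assms)

lemma affine_phase_in_phase_space:
  assumes "r > 0"
  shows "affine_phase r (\<xi>, Z, \<xi>', W) \<in> phase_space \<alpha> \<longleftrightarrow>
    (cmod \<xi>)\<^sup>2 + (cmod Z)\<^sup>2 = 1 \<and> Re (cnj \<xi> * \<xi>') + Re (cnj Z * W) = 0"
proof -
  have "(sqrt a * Re \<xi>)\<^sup>2 / a + (cmod (sqrt b *\<^sub>R Z))\<^sup>2 / b + (sqrt c * Im \<xi>)\<^sup>2 / c = (cmod \<xi>)\<^sup>2 + (cmod Z)\<^sup>2"
    using axis_facts(1-3) by (simp add: power_mult_distrib) (simp add: cmod_power2)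
  moreover have sq: "sqrt k * x * (sqrt k * (r * y)) / k = r * (x * y)" if "k > 0" for k x y
  proof -
    have "sqrt k * x * (sqrt k * (r * y)) = (sqrt k * sqrt k) * (r * (x * y))" by algebra
    then have "sqrt k * x * (sqrt k * (r * y)) / k = (sqrt k * sqrt k) * (r * (x * y)) / k" by (rule arg_cong)
    then show ?thesis using that by simp
  qed
  moreover have "Re (cnj (sqrt b *\<^sub>R Z) * (sqrt b *\<^sub>R r *\<^sub>R W)) / b = r * Re (cnj Z * W)"
  proof -
    have eq: "cnj (sqrt b *\<^sub>R Z) * (sqrt b *\<^sub>R r *\<^sub>R W) = (b * r) *\<^sub>R (cnj Z * W)"
      unfolding scaleR_scaleR cnj_scaleR_mult_scaleR using axis_facts(2) by (simp flip: mult.assoc)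
    show ?thesis unfolding eq using axis_facts(2) by simp
  qed
  ultimately have "affine_phase r (\<xi>, Z, \<xi>', W) \<in> phase_space \<alpha> \<longleftrightarrow>
    (cmod \<xi>)\<^sup>2 + (cmod Z)\<^sup>2 = 1 \<and> r * (Re \<xi> * Re \<xi>') + r * Re (cnj Z * W) + r * (Im \<xi> * Im \<xi>') = 0"
    unfolding affine_phase_def prod.case phase_of_in_phase_space sq[OF axis_facts(1)] sq[OF axis_facts(3)] by simp
  moreover have "r * (Re \<xi> * Re \<xi>') + r * Re (cnj Z * W) + r * (Im \<xi> * Im \<xi>') = r * (Re (cnj \<xi> * \<xi>') + Re (cnj Z * W))"
    by (simp add: algebra_simps)
  ultimately show ?thesis using assms by (simp only: mult_eq_0_iff) auto
qed

lemma H_int_affine_phase: "H_int (affine_phase r v) = r\<^sup>2 * affine_energy v / 2"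
  using axis_facts(1-3)
  by (cases v) (simp add: affine_phase_def affine_energy_def H_int_phase_of power_mult_distrib algebra_simps)

lemma J_int_affine_phase: "J_int (affine_phase r (\<xi>, Z, \<xi>', W)) = b * r * Im (cnj Z * W)"
proof -
  have eq: "cnj (sqrt b *\<^sub>R Z) * (sqrt b *\<^sub>R r *\<^sub>R W) = (b * r) *\<^sub>R (cnj Z * W)"
    unfolding scaleR_scaleR cnj_scaleR_mult_scaleR using axis_facts(2) by (simp flip: mult.assoc)
  show ?thesis
    unfolding affine_phase_def prod.case J_int_phase_of eq by simp
qed

text \<open>The origin of the constants A = a / (b - a) and C = c / (c - b) of
  \<open>pinched_level\<close>.\<close>

lemma G_int_affine_phase:
  "G_int \<alpha> (affine_phase r (\<xi>, Z, \<xi>', W)) = b * r\<^sup>2 * ((cmod W)\<^sup>2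
     + a / (b - a) * (cmod (Re \<xi> *\<^sub>R W - Re \<xi>' *\<^sub>R Z))\<^sup>2 - c / (c - b) * (cmod (Im \<xi> *\<^sub>R W - Im \<xi>' *\<^sub>R Z))\<^sup>2)"
proof -
  have fac: "(s * x) *\<^sub>R sqrt b *\<^sub>R r *\<^sub>R W - (s * (r * x')) *\<^sub>R sqrt b *\<^sub>R Z = (s * sqrt b * r) *\<^sub>R (x *\<^sub>R W - x' *\<^sub>R Z)"
    for s x x' :: real
    by (simp add: scaleR_diff_right mult_ac)
  have neg: "P / (b - c) = - (P / (c - b))" for P by (metis minus_diff_eq minus_divide_right)
  show ?thesis
    unfolding affine_phase_def prod.case G_int_phase_of fac neg norm_scaleR power_mult_distrib power2_abs
    using axis_facts(1-3) by (simp add: algebra_simps)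
qed

lemma affine_energy_pos:
  assumes "(cmod \<xi>')\<^sup>2 + (cmod W)\<^sup>2 = 1"
  shows "affine_energy (\<xi>, Z, \<xi>', W) > 0"
proof -
  have "a * 1 \<le> affine_energy (\<xi>, Z, \<xi>', W)"
    unfolding assms[symmetric] affine_energy_def prod.case cmod_power2[of \<xi>'] distrib_left
    using axis_facts by (intro add_mono mult_right_mono) auto
  then show ?thesis using axis_facts(1) by linarith
qed

lemma affine_phase_inj:
  assumes "affine_phase r (\<xi>, Z, \<xi>', W) = affine_phase s (\<eta>, Y, \<eta>', V)" "r > 0" "s > 0"
    and "(cmod \<xi>')\<^sup>2 + (cmod W)\<^sup>2 = 1" "(cmod \<eta>')\<^sup>2 + (cmod V)\<^sup>2 = 1"
  shows "(\<xi>, Z, \<xi>', W) = (\<eta>, Y, \<eta>', V)"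
proof -
  have eq: "Re \<xi> = Re \<eta>" "Z = Y" "Im \<xi> = Im \<eta>" "r * Re \<xi>' = s * Re \<eta>'" "r *\<^sub>R W = s *\<^sub>R V" "r * Im \<xi>' = s * Im \<eta>'"
    using assms(1) axis_facts(1-3)
    unfolding affine_phase_def prod.case phase_of_eq_iff scaleR_cancel_left mult_cancel_left by auto
  have 1: "r *\<^sub>R \<xi>' = s *\<^sub>R \<eta>'" using eq by (simp add: complex_eq_iff)
  have "r\<^sup>2 = (cmod (r *\<^sub>R \<xi>'))\<^sup>2 + (cmod (r *\<^sub>R W))\<^sup>2"
    using assms(4) by (simp add: power_mult_distrib flip: distrib_left)
  also have "\<dots> = s\<^sup>2"
    unfolding 1 eq(5) using assms(5) by (simp add: power_mult_distrib flip: distrib_left)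
  finally have "r = s" using assms(2,3) by (simp add: power2_eq_iff)
  then show ?thesis using eq 1 assms(3) by (simp add: complex_eq_iff)
qed

text \<open>J = 0 and G = 0 are homogeneous in the velocity, so they constrain only its direction.
  The energy then fixes the length as the square root of
  \<open>2 * h / affine_energy v\<close>.\<close>

lemma fibre_0_image:
  assumes h: "h > 0"
  shows "fibre \<alpha> (h, 0, 0)
    = (\<lambda>v. affine_phase (sqrt (2 * h / affine_energy v)) v) ` pinched_level (a / (b - a)) (c / (c - b))"
proof (intro equalityI subsetI)
  fix t assume "t \<in> fibre \<alpha> (h, 0, 0)"
  then have t: "t \<in> phase_space \<alpha>" "H_int t = h" "J_int t = 0" "G_int \<alpha> t = 0"
    by (auto simp: fibre_def EM_def)
  obtain u z v p w q where tp: "t = phase_of u z v p w q" by (rule phase_of_exhaust)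
  define r where "r = sqrt (p\<^sup>2 / a + (cmod w)\<^sup>2 / b + q\<^sup>2 / c)"
  have pwq: "p\<^sup>2 + (cmod w)\<^sup>2 + q\<^sup>2 > 0" using t(2) h by (simp add: tp H_int_phase_of)
  have "p\<^sup>2 / a + (cmod w)\<^sup>2 / b + q\<^sup>2 / c > 0"
  proof -
    have "p\<^sup>2 / a \<ge> p\<^sup>2 / c" "(cmod w)\<^sup>2 / b \<ge> (cmod w)\<^sup>2 / c"
      using axis_facts by (auto intro!: divide_left_mono mult_pos_pos)
    moreover have "p\<^sup>2 / c + (cmod w)\<^sup>2 / c + q\<^sup>2 / c > 0"
      using pwq axis_facts(3) by (simp flip: add_divide_distrib)
    ultimately show ?thesis by linarith
  qed
  then have r: "r > 0" "r\<^sup>2 = p\<^sup>2 / a + (cmod w)\<^sup>2 / b + q\<^sup>2 / c" by (simp_all add: r_def)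
  define \<xi> \<xi>' where "\<xi> = Complex (u / sqrt a) (v / sqrt c)" and "\<xi>' = Complex (p / sqrt a / r) (q / sqrt c / r)"
  define Z W where "Z = (1 / sqrt b) *\<^sub>R z" and "W = (1 / (sqrt b * r)) *\<^sub>R w"
  have t_affine: "t = affine_phase r (\<xi>, Z, \<xi>', W)"
    using axis_facts(1-3) r(1) by (simp add: tp affine_phase_def \<xi>_def \<xi>'_def Z_def W_def)
  have norm': "(cmod \<xi>')\<^sup>2 + (cmod W)\<^sup>2 = 1"
  proof -
    have "(cmod \<xi>')\<^sup>2 + (cmod W)\<^sup>2 = (p\<^sup>2 / a + (cmod w)\<^sup>2 / b + q\<^sup>2 / c) / r\<^sup>2"
      unfolding \<xi>'_def W_def cmod_power2[of "Complex _ _"] using axis_facts(1-3)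
      by (simp add: power_mult_distrib power_divide add_divide_distrib)
    also have "\<dots> = 1" unfolding r(2)[symmetric] using r(1) by simp
    finally show ?thesis .
  qed
  note M = t(1)[unfolded t_affine affine_phase_in_phase_space[OF r(1)]]
  have "Im (cnj Z * W) = 0"
    using t(3) r(1) axis_facts(2) unfolding t_affine J_int_affine_phase mult_eq_0_iff by linarith
  moreover have "(cmod W)\<^sup>2 + a / (b - a) * (cmod (Re \<xi> *\<^sub>R W - Re \<xi>' *\<^sub>R Z))\<^sup>2
      - c / (c - b) * (cmod (Im \<xi> *\<^sub>R W - Im \<xi>' *\<^sub>R Z))\<^sup>2 = 0"
    using t(4) r(1) axis_facts(2) unfolding t_affine G_int_affine_phase mult_eq_0_iff power_eq_0_iff by linarith
  ultimately have L: "(\<xi>, Z, \<xi>', W) \<in> pinched_level (a / (b - a)) (c / (c - b))"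
    using M norm' by (simp add: pinched_level_def)
  have "r\<^sup>2 * affine_energy (\<xi>, Z, \<xi>', W) = 2 * h"
    using t(2) unfolding t_affine H_int_affine_phase by simp
  then have "r\<^sup>2 = 2 * h / affine_energy (\<xi>, Z, \<xi>', W)"
    using affine_energy_pos[OF norm', of \<xi> Z] by (simp add: eq_divide_eq)
  then have "r = sqrt (2 * h / affine_energy (\<xi>, Z, \<xi>', W))"
    using r(1) by (metis abs_of_pos real_sqrt_abs)
  then show "t \<in> (\<lambda>v. affine_phase (sqrt (2 * h / affine_energy v)) v) ` pinched_level (a / (b - a)) (c / (c - b))"
    using L t_affine by blast
next
  fix t assume "t \<in> (\<lambda>v. affine_phase (sqrt (2 * h / affine_energy v)) v) ` pinched_level (a / (b - a)) (c / (c - b))"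
  then obtain v where v: "v \<in> pinched_level (a / (b - a)) (c / (c - b))"
    and t: "t = affine_phase (sqrt (2 * h / affine_energy v)) v" by blast
  obtain \<xi> Z \<xi>' W where veq: "v = (\<xi>, Z, \<xi>', W)" by (cases v) auto
  have l: "(cmod \<xi>)\<^sup>2 + (cmod Z)\<^sup>2 = 1" "(cmod \<xi>')\<^sup>2 + (cmod W)\<^sup>2 = 1"
    "Re (cnj \<xi> * \<xi>') + Re (cnj Z * W) = 0" "Im (cnj Z * W) = 0"
    "(cmod W)\<^sup>2 + a / (b - a) * (cmod (Re \<xi> *\<^sub>R W - Re \<xi>' *\<^sub>R Z))\<^sup>2
      = c / (c - b) * (cmod (Im \<xi> *\<^sub>R W - Im \<xi>' *\<^sub>R Z))\<^sup>2"
    using v unfolding veq pinched_level_def by auto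
  have e: "affine_energy v > 0" using affine_energy_pos[OF l(2)] by (simp add: veq)
  define r where "r = sqrt (2 * h / affine_energy v)"
  have r: "r > 0" "r\<^sup>2 = 2 * h / affine_energy v" using e h by (simp_all add: r_def)
  have "t \<in> phase_space \<alpha>"
    unfolding t r_def[symmetric] unfolding veq affine_phase_in_phase_space[OF r(1)] using l by blast
  moreover have "H_int t = h"
    unfolding t r_def[symmetric] H_int_affine_phase r(2) using e by simp
  moreover have "J_int t = 0"
    unfolding t r_def[symmetric] unfolding veq J_int_affine_phase l(4) by simp
  moreover have "G_int \<alpha> t = 0"
    unfolding t r_def[symmetric] unfolding veq G_int_affine_phase l(5) by simp
  ultimately show "t \<in> fibre \<alpha> (h, 0, 0)" by (simp add: fibre_def EM_def)
qed

lemma fibre_0_homeomorphic: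
  assumes h: "h > 0"
  shows "fibre \<alpha> (h, 0, 0) homeomorphic circle \<times> pinched_torus_model"
proof -
  define A C where "A = a / (b - a)" and "C = c / (c - b)"
  have AC: "A > 0" "C > 1" using axis_facts by (simp_all add: A_def C_def)
  let ?f = "\<lambda>v. affine_phase (sqrt (2 * h / affine_energy v)) v"
  have e: "affine_energy v > 0" if "v \<in> pinched_level A C" for v
  proof -
    obtain \<xi> Z \<xi>' W where veq: "v = (\<xi>, Z, \<xi>', W)" by (cases v) auto
    show ?thesis using that unfolding veq pinched_level_def by (intro affine_energy_pos) simp
  qed
  have "continuous_on (pinched_level A C) affine_energy"
    unfolding affine_energy_def split_beta
    by (intro continuous_on_add continuous_on_mult continuous_on_power continuous_on_norm continuous_on_const
      continuous_on_Re continuous_on_Im continuous_on_fst continuous_on_snd continuous_on_id)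
  moreover have "\<forall>v\<in>pinched_level A C. affine_energy v \<noteq> 0" using e by force
  ultimately have "continuous_on (pinched_level A C) (\<lambda>v. sqrt (2 * h / affine_energy v))"
    by (intro continuous_on_real_sqrt continuous_on_divide continuous_on_const)
  then have "continuous_on (pinched_level A C) ?f"
    by (rule continuous_on_affine_phase)
  moreover have "inj_on ?f (pinched_level A C)"
  proof (rule inj_onI)
    fix v v' assume v: "v \<in> pinched_level A C" "v' \<in> pinched_level A C" "?f v = ?f v'"
    obtain \<xi> Z \<xi>' W where veq: "v = (\<xi>, Z, \<xi>', W)" by (cases v) auto
    obtain \<eta> Y \<eta>' V where veq': "v' = (\<eta>, Y, \<eta>', V)" by (cases v') auto
    have 1: "(cmod \<xi>')\<^sup>2 + (cmod W)\<^sup>2 = 1" "(cmod \<eta>')\<^sup>2 + (cmod V)\<^sup>2 = 1"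
      using v(1,2) by (simp_all add: veq veq' pinched_level_def)
    have 2: "sqrt (2 * h / affine_energy v) > 0" "sqrt (2 * h / affine_energy v') > 0"
      using e[OF v(1)] e[OF v(2)] h by simp_all
    show "v = v'"
      using affine_phase_inj[OF v(3)[unfolded veq veq'] 2[unfolded veq veq'] 1] unfolding veq veq' .
  qed
  ultimately have "pinched_level A C homeomorphic fibre \<alpha> (h, 0, 0)"
    by (rule homeomorphic_compact[OF compact_pinched_level[OF AC] _ fibre_0_image[OF h, folded A_def C_def, symmetric]])
  then have "fibre \<alpha> (h, 0, 0) homeomorphic pinched_level A C"
    by (rule homeomorphic_sym[THEN iffD1])
  then show ?thesis
    by (rule homeomorphic_trans[OF _ pinched_level_homeomorphic[OF AC]])
qed

lemma fibre_0_pinched: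
  assumes h: "h > 0"
  shows "\<exists>X :: (complex \<times> complex) set topology. doubly_pinched_torus X \<and>
    top_of_set (fibre \<alpha> (h, 0, 0)) homeomorphic_space prod_topology (top_of_set circle) X"
proof -
  obtain X :: "(complex \<times> complex) set topology"
    where X: "doubly_pinched_torus X" "top_of_set pinched_torus_model homeomorphic_space X"
    by (rule pinched_torus_model)
  have "top_of_set (fibre \<alpha> (h, 0, 0)) homeomorphic_space top_of_set (circle \<times> pinched_torus_model)"
    by (rule homeomorphic_imp_homeomorphic_space[OF fibre_0_homeomorphic[OF h]])
  also have "top_of_set (circle \<times> pinched_torus_model) = prod_topology (top_of_set circle) (top_of_set pinched_torus_model)"
    by (simp only: prod_topology_euclidean flip: subtopology_Times)
  also have "\<dots> homeomorphic_space prod_topology (top_of_set circle) X"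
    by (intro homeomorphic_space_prod_topology homeomorphic_space_refl X)
  finally have "top_of_set (fibre \<alpha> (h, 0, 0)) homeomorphic_space prod_topology (top_of_set circle) X" .
  then show ?thesis by (intro exI[of _ X] conjI X(1))
qed

end

theorem theorem5p2:
  fixes \<alpha> :: "real ^ 4" and h :: real
  assumes "0 < \<alpha>$0" and "\<alpha>$0 < \<alpha>$1" and "\<alpha>$1 = \<alpha>$2" and "\<alpha>$2 < \<alpha>$3"
    and "h > 0"
  shows "compact (region \<alpha> h) \<and> frontier (region \<alpha> h) = boundary_curves \<alpha> h
    \<and> (\<lambda>p. (J_int p, G_int \<alpha> p)) ` {p \<in> phase_space \<alpha>. H_int p = h} = region \<alpha> h
    \<and> {(j, g). (h, j, g) \<in> singular_values \<alpha>} = boundary_curves \<alpha> h \<union> {(0, 0)}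
    \<and> (0, 0) isolated_in {(j, g). (h, j, g) \<in> singular_values \<alpha>}
    \<and> (\<forall>(j, g) \<in> boundary_curves \<alpha> h - curve \<alpha> h 3 \<inter> curve \<alpha> h 0.
          fibre \<alpha> (h, j, g) homeomorphic torus)
    \<and> (\<forall>(j, g) \<in> curve \<alpha> h 3 \<inter> curve \<alpha> h 0. fibre \<alpha> (h, j, g) homeomorphic circle)
    \<and> (\<exists>X :: (complex \<times> complex) set topology. doubly_pinched_torus X \<and>
          top_of_set (fibre \<alpha> (h, 0, 0)) homeomorphic_space
            prod_topology (top_of_set circle) X)"
proof -
  interpret revolution_ellipsoid \<alpha>
    using assms by unfold_locales auto
  note h = \<open>h > 0\<close>
  show ?thesis
  proof (intro conjI)
    show "\<forall>(j, g) \<in> boundary_curves \<alpha> h - curve \<alpha> h 3 \<inter> curve \<alpha> h 0. fibre \<alpha> (h, j, g) homeomorphic torus"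
      using boundary_fibre_torus[OF h] by blast
    show "\<forall>(j, g) \<in> curve \<alpha> h 3 \<inter> curve \<alpha> h 0. fibre \<alpha> (h, j, g) homeomorphic circle"
      using corner_fibre_circle[OF h] by blast
  qed (fact compact_region frontier_region energy_image[OF h] singular_values_slice[OF h]
      zero_isolated[OF h] fibre_0_pinched[OF h])+
qed

end
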